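(* Let $(V_n)$ be a sequence of normalized variance profiles, $V_n=\big(\tfrac1n(\sigma_{ij}^{(n)})^2\big)_{i,j\in[n]}$, that is uniformly bounded (there is $\sigma_{\max}\in(0,\infty)$ with $\sup_n\max_{i,j}\sigma_{ij}^{(n)}\le\sigma_{\max}$) and block fully indecomposable (there are constants $\phi>0$, $K\in\mathbb{N}$ independent of $n$ such that for every $n$ in the sequence, $n$ ranging over multiples of $K$, there are a fully indecomposable matrix $Z=(z_{ij})_{i,j\in[K]}$ with $z_{ij}\in\{0,1\}$ and a partition $(I_j)_{j\in[K]}$ of $[n]$ such that $|I_i|=n/K$ and $(V_n)_{xy}\ge\frac{\phi}{n}z_{ij}$ for all $x\in I_i$, $y\in I_j$, $i,j\in[K]$). Let $\vec{q}(s)$, $\vec{r}(s,t)$, $\mu_n$ and $f_n$ be the objects associated with $V_n$ in the context. Then: (1) The limits $\lim_{t\downarrow 0}\vec{r}(0,t)$ and $\lim_{s\downarrow 0}\vec{q}(s)$ exist and are equal. Writing $q(0)=(q_i(0))=\lim_{s\downarrow 0}q(s)$ and $\widetilde q(0)=(\widetilde q_i(0))=\lim_{s\downarrow 0}\widetilde q(s)$, one has $$q_i(0)\,(V_n\widetilde q(0))_i=1\quad\text{and}\quad \widetilde q_i(0)\,(V_n^{\mathsf T}q(0))_i=1,\qquad i\in[n].$$ In particular $\mu_n(\{0\})=0$. (2) The density $f_n$ of $\mu_n$ on $\mathbb{C}\setminus\{0\}$ admits a limit $f_n(0)$ as $z\to 0$, given by $$f_n(0)=\frac{1}{\pi n}\sum_{i\in[n]}\frac{1}{(V_n^{\mathsf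 T}q(0))_i\,(V_n\widetilde q(0))_i}=\frac{1}{\pi n}\sum_{i\in[n]}q_i(0)\,\widetilde q_i(0).$$ In particular, there exist finite constants $\kappa_1,\kappa_2$, independent of $n$, such that $0<\kappa_1\le f_n(0)\le \kappa_2$.
   Context: Write $[n]=\{1,\dots,n\}$, and $\rho(\cdot)$ for the spectral radius. For each $n$, $A_n=(\sigma_{ij}^{(n)})$ is a deterministic $n\times n$ matrix with nonnegative entries (standard deviation profile) and $V_n=\big(\tfrac1n(\sigma_{ij}^{(n)})^2\big)_{i,j\in[n]}$ is the normalized variance profile. Uniformly bounded: there is $\sigma_{\max}\in(0,\infty)$ with $\sup_n\max_{i,j}\sigma_{ij}^{(n)}\le\sigma_{\max}$. Fully indecomposable: a $K\times K$ matrix $T=(t_{ij})$ with nonnegative entries is fully indecomposable if for any two nonempty subsets $I,J\subset[K]$ with $|I|+|J|\ge K$ the submatrix $(t_{ij})_{i\in I,j\in J}$ contains a nonzero entry. Block fully indecomposable: there are constants $\phi>0$, $K\in\mathbb{N}$ independent of $n$ such that for every $n$ in the sequence (the index $n$ ranges over multiples of $K$) there are a fully indecomposable matrix $Z=(z_{ij})_{i,j\in[K]}$ with $z_{ij}\in\{0,1\}$ and a partition $(I_j)_{j\in[K]}$ of $[n]$ such that $|I_i|=n/K$ and $(V_n)_{xy}\ge\frac{\phi}{n}z_{ij}$ for all $x\in I_i$, $y\in I_j$, $i,j\in[K]$. (This implies that $V_n$ is irreducible.) Regularized Master Equations: for $s\ge0$, $t>0$, $\vec r(s,t)=\binom{r(s,t)}{\widetilde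 r(s,t)}\in(0,\infty)^{2n}$ denotes the unique entrywise positive solution of $$r_i=\frac{(V_n^{\mathsf T}r)_i+t}{s^2+((V_n\widetilde r)_i+t)((V_n^{\mathsf T}r)_i+t)},\qquad \widetilde r_i=\frac{(V_n\widetilde r)_i+t}{s^2+((V_n\widetilde r)_i+t)((V_n^{\mathsf T}r)_i+t)},\quad i\in[n].$$ Master Equations: for $s>0$, consider $$q_i=\frac{(V_n^{\mathsf T}q)_i}{s^2+(V_n\widetilde q)_i(V_n^{\mathsf T}q)_i},\quad \widetilde q_i=\frac{(V_n\widetilde q)_i}{s^2+(V_n\widetilde q)_i(V_n^{\mathsf T}q)_i},\quad \sum_{i}q_i=\sum_i\widetilde q_i,\quad q_i,\widetilde q_i\ge0 .$$ It is known that, for irreducible $V_n$, this system has only the zero solution when $s\ge\sqrt{\rho(V_n)}$ and has a unique nonzero solution (entrywise positive) when $s\in(0,\sqrt{\rho(V_n)})$. $\vec q(s)=\binom{q(s)}{\widetilde q(s)}$ denotes this nonzero solution when $s<\sqrt{\rho(V_n)}$ and $0$ when $s\ge\sqrt{\rho(V_n)}$; it is continuous on $(0,\infty)$ and continuously differentiable on $(0,\sqrt{\rho(V_n)})$. The measure $\mu_n$: the function $F_n(s)=1-\frac1n\langle q(s),V_n\widetilde q(s)\rangle$, $s>0$, extends to an absolutely continuous function on $[0,\infty)$ which is a CDF, and $\mu_n$ is the unique radially symmetric probability measure on $\mathbb{C}$ with $\mu_n(\{|z|\le s\})=F_n(s)$ for $s>0$. Its density on $\mathbb{C}\setminus\{0\}$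 is $f_n(z)=\frac{1}{2\pi|z|}F_n'(|z|)$ for $|z|\notin\{0,\sqrt{\rho(V_n)}\}$, with the convention $f_n(z)=0$ for $|z|=\sqrt{\rho(V_n)}$. *)

theory Defs
  imports "HOL-Probability.Probability" "Jordan_Normal_Form.Spectral_Radius"
begin

unbundle no vec_syntax
no_notation inner (infix \<open>\<bullet>\<close> 70)

text \<open>
  Since the dimension n varies, vectors and matrices are the dimension-free ones of
  Jordan_Normal_Form, with the index set [n] = {1, ..., n} rendered as {0, ..., n - 1}.
  Convergence of vectors of fixed dimension is entrywise convergence.
\<close>

definition standard_deviation_profile :: "nat \<Rightarrow> real mat \<Rightarrow> bool" where
  "standard_deviation_profile n A \<longleftrightarrow>
     A \<in> carrier_mat n n \<and> (\<forall>i<n. \<forall>j<n. 0 \<le> A $$ (i, j))"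

definition variance_profile :: "nat \<Rightarrow> real mat \<Rightarrow> real mat" where
  "variance_profile n A = mat n n (\<lambda>(i, j). (A $$ (i, j))\<^sup>2 / real n)"

text \<open>The set N below is the set of those n that occur as indices of the sequence.\<close>

definition uniformly_bounded :: "nat set \<Rightarrow> (nat \<Rightarrow> real mat) \<Rightarrow> bool" where
  "uniformly_bounded N A \<longleftrightarrow>
     (\<exists>\<sigma>max>0. \<forall>n\<in>N. \<forall>i<n. \<forall>j<n. A n $$ (i, j) \<le> \<sigma>max)"

definition fully_indecomposable :: "nat \<Rightarrow> real mat \<Rightarrow> bool" where
  "fully_indecomposable K T \<longleftrightarrow>
     T \<in> carrier_mat K K \<and> (\<forall>i<K. \<forall>j<K. 0 \<le> T $$ (i, j)) \<and>
     (\<forall>I J. I \<subseteq> {..<K} \<and> J \<subseteq> {..<K} \<and> I \<noteq> {} \<and> J \<noteq> {} \<and> K \<le> card I + card J \<longrightarrow>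
        (\<exists>i\<in>I. \<exists>j\<in>J. T $$ (i, j) \<noteq> 0))"

definition block_fully_indecomposable :: "nat set \<Rightarrow> (nat \<Rightarrow> real mat) \<Rightarrow> bool" where
  "block_fully_indecomposable N V \<longleftrightarrow>
     (\<exists>\<phi>>0. \<exists>K\<ge>1. \<forall>n\<in>N. K dvd n \<and>
        (\<exists>Z I. fully_indecomposable K Z \<and> (\<forall>i<K. \<forall>j<K. Z $$ (i, j) \<in> {0, 1}) \<and>
           (\<Union>i<K. I i) = {..<n} \<and> disjoint_family_on I {..<K} \<and>
           (\<forall>i<K. card (I i) = n div K) \<and>
           (\<forall>i<K. \<forall>j<K. \<forall>x\<in>I i. \<forall>y\<in>I j. V n $$ (x, y) \<ge> \<phi> / real n * Z $$ (i, j))))"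

text \<open>The spectral radius in the library is that of a complex matrix.\<close>

definition rho :: "real mat \<Rightarrow> real" where
  "rho V = spectral_radius (map_mat complex_of_real V)"

definition regularized_master_solution ::
    "nat \<Rightarrow> real mat \<Rightarrow> real \<Rightarrow> real \<Rightarrow> real vec \<Rightarrow> real vec \<Rightarrow> bool" where
  "regularized_master_solution n V s t r r' \<longleftrightarrow>
     r \<in> carrier_vec n \<and> r' \<in> carrier_vec n \<and>
     (\<forall>i<n. 0 < r $ i \<and> 0 < r' $ i) \<and>
     (\<forall>i<n. r $ i = ((V\<^sup>T *\<^sub>v r) $ i + t) /
          (s\<^sup>2 + ((V *\<^sub>v r') $ i + t) * ((V\<^sup>T *\<^sub>v r) $ i + t))) \<and>
     (\<forall>i<n. r' $ i = ((V *\<^sub>v r') $ i + t) /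
          (s\<^sup>2 + ((V *\<^sub>v r') $ i + t) * ((V\<^sup>T *\<^sub>v r) $ i + t)))"

definition master_solution ::
    "nat \<Rightarrow> real mat \<Rightarrow> real \<Rightarrow> real vec \<Rightarrow> real vec \<Rightarrow> bool" where
  "master_solution n V s q q' \<longleftrightarrow>
     q \<in> carrier_vec n \<and> q' \<in> carrier_vec n \<and>
     (\<forall>i<n. 0 \<le> q $ i \<and> 0 \<le> q' $ i) \<and>
     (\<forall>i<n. q $ i = (V\<^sup>T *\<^sub>v q) $ i / (s\<^sup>2 + (V *\<^sub>v q') $ i * (V\<^sup>T *\<^sub>v q) $ i)) \<and>
     (\<forall>i<n. q' $ i = (V *\<^sub>v q') $ i / (s\<^sup>2 + (V *\<^sub>v q') $ i * (V\<^sup>T *\<^sub>v q) $ i)) \<and>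
     (\<Sum>i<n. q $ i) = (\<Sum>i<n. q' $ i)"

text \<open>
  The functions (s, t) \<mapsto> (r(s,t), r'(s,t)) and s \<mapsto> (q(s), q'(s)) attached to V are introduced
  through the conditions that determine them; uniqueness is not made part of the condition.
\<close>

definition is_r :: "nat \<Rightarrow> real mat \<Rightarrow> (real \<Rightarrow> real \<Rightarrow> real vec) \<Rightarrow> (real \<Rightarrow> real \<Rightarrow> real vec) \<Rightarrow> bool"
  where
  "is_r n V r r' \<longleftrightarrow> (\<forall>s\<ge>0. \<forall>t>0. regularized_master_solution n V s t (r s t) (r' s t))"

definition is_q :: "nat \<Rightarrow> real mat \<Rightarrow> (real \<Rightarrow> real vec) \<Rightarrow> (real \<Rightarrow> real vec) \<Rightarrow> bool" where
  "is_q n V q q' \<longleftrightarrow>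
     (\<forall>s>0. if s < sqrt (rho V)
        then master_solution n V s (q s) (q' s) \<and> \<not> (q s = 0\<^sub>v n \<and> q' s = 0\<^sub>v n)
        else q s = 0\<^sub>v n \<and> q' s = 0\<^sub>v n)"

definition radial_cdf :: "nat \<Rightarrow> real mat \<Rightarrow> (real \<Rightarrow> real vec) \<Rightarrow> (real \<Rightarrow> real vec) \<Rightarrow> real \<Rightarrow> real" where
  "radial_cdf n V q q' s = 1 - (q s \<bullet> (V *\<^sub>v q' s)) / real n"

definition radially_symmetric :: "complex measure \<Rightarrow> bool" where
  "radially_symmetric M \<longleftrightarrow> (\<forall>\<theta>::real. distr M borel (\<lambda>z. cis \<theta> * z) = M)"

definition is_mu ::
    "nat \<Rightarrow> real mat \<Rightarrow> (real \<Rightarrow> real vec) \<Rightarrow> (real \<Rightarrow> real vec) \<Rightarrow> complex measure \<Rightarrow> bool" where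
  "is_mu n V q q' M \<longleftrightarrow>
     prob_space M \<and> sets M = sets borel \<and> radially_symmetric M \<and>
     (\<forall>s>0. measure M {z. cmod z \<le> s} = radial_cdf n V q q' s)"

text \<open>
  The density on the punctured plane of the radially symmetric measure with radial distribution
  function radial_cdf, in polar coordinates; it vanishes by convention on the critical circle.
  The junk value at 0 plays no role: the limit at 0 does not depend on it.
\<close>

definition mu_density :: "nat \<Rightarrow> real mat \<Rightarrow> (real \<Rightarrow> real vec) \<Rightarrow> (real \<Rightarrow> real vec) \<Rightarrow> complex \<Rightarrow> real" where
  "mu_density n V q q' z =
     (if cmod z = sqrt (rho V) then 0
      else 1 / (2 * pi * cmod z) * deriv (radial_cdf n V q q') (cmod z))"

end

theory Submission
  imports Defs
begin

text \<open>
  Write \<open>a = V\<^sup>T q\<close>, \<open>b = V q'\<close> and \<open>u = s\<^sup>2\<close>. A positive solution of the Master Equations satisfies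
  \<open>1 / q\<^sub>i = u / a\<^sub>i + b\<^sub>i\<close> and \<open>1 / q'\<^sub>i = u / b\<^sub>i + a\<^sub>i\<close>; put \<open>p\<^sub>i = q\<^sub>i b\<^sub>i = q'\<^sub>i a\<^sub>i\<close>, a number in \<open>(0, 1)\<close>.
  The matrix with entries \<open>q\<^sub>i V\<^sub>i\<^sub>j q'\<^sub>j\<close> has \<open>p\<close> as its vector of row sums and of column sums. At \<open>u = 0\<close>
  this is the problem of scaling \<open>V\<close> by diagonal matrices to a doubly stochastic matrix, which for a fully
  indecomposable \<open>V\<close> and under the normalization \<open>\<Sum> q = \<Sum> q'\<close> has at most one solution
  (\<open>scaling_unique\<close>, a maximum principle). The regularized equations at \<open>s = 0\<close> are
  another perturbation of the same problem. So both limits in the theorem are the limit of approximate scalings,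
  and the proof consists of showing that approximate scalings converge, and how fast.

  A priori bounds come from one combinatorial argument (\<open>indecomposable_no_gap\<close>): if the sizes of the rows
  (the entries of \<open>q\<close>, or those of \<open>1 / b\<close>) were to split into large and much smaller ones, then the columns where
  \<open>q'\<close> is not large would be more numerous than the large rows, by full indecomposability, while almost all their mass
  would have to come from these rows. Applied to block averages, it bounds approximate scalings
  from above and below with constants that depend only on \<open>K\<close>, \<open>\<phi>\<close> and \<open>\<sigma>\<close>
  (\<open>approx_scaling_bounds\<close>); this gives the constants \<open>\<kappa>\<^sub>1\<close> and \<open>\<kappa>\<^sub>2\<close>. Applied
  to the entries of \<open>V\<close> for a fixed \<open>n\<close>, it shows that solutions are approximate scalings at all: \<open>1 - p\<^sub>i = O(s\<^sup>2)\<close>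
  for every nonzero solution of the Master Equations (\<open>master_near_scaling\<close>), and \<open>r(0,t)\<close> stays bounded, so that
  its row sums are \<open>1 - O(t)\<close> (\<open>regularized_bounded_above\<close>). Compactness and uniqueness then give both limits
  and their equality (\<open>scaling_limit\<close>).

  For the density, \<open>F(s) = 1 - \<langle>q, V q'\<rangle> / n\<close> is the mean of \<open>1 - p\<^sub>i = s\<^sup>2 q'\<^sub>i / b\<^sub>i\<close>, so that \<open>F'(s) / (2 \<pi> s)\<close>
  is the mean of \<open>q'\<^sub>i / b\<^sub>i\<close> over \<open>\<pi>\<close>, up to \<open>s\<close> times the derivative of \<open>q'\<^sub>i / b\<^sub>i\<close>. All that is needed
  is that \<open>q\<close> and \<open>q'\<close> are differentiable near \<open>0\<close> with bounded derivatives. The linearization at \<open>s = 0\<close> is injective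
  on the tangent space of the normalization, again by a maximum principle (\<open>scaling_kernel\<close>). This survives
  small changes of the coefficients (\<open>linear_stability\<close>). Difference quotients of
  solutions satisfy exactly such a perturbed linear system (\<open>master_sol_secant\<close>), hence
  are bounded and converge (\<open>master_differentiable\<close>).
\<close>

section \<open>Fully indecomposable patterns and the gap argument\<close>

definition mv :: "nat \<Rightarrow> (nat \<Rightarrow> nat \<Rightarrow> real) \<Rightarrow> (nat \<Rightarrow> real) \<Rightarrow> nat \<Rightarrow> real" where
  "mv n v x i = (\<Sum>j<n. v i j * x j)"

definition flip :: "('a \<Rightarrow> 'a \<Rightarrow> 'b) \<Rightarrow> 'a \<Rightarrow> 'a \<Rightarrow> 'b" where
  "flip v = (\<lambda>i j. v j i)"

lemma flip_flip [simp]: "flip (flip v) = v"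
  by (simp add: flip_def)

text \<open>
  Full indecomposability of a pattern of nonzero entries. It is used both for the \<open>K \<times> K\<close> pattern of the blocks and for
  the support of \<open>V\<close> itself.
\<close>

definition indecomposable :: "nat \<Rightarrow> (nat \<Rightarrow> nat \<Rightarrow> bool) \<Rightarrow> bool" where
  "indecomposable K z \<longleftrightarrow> (\<forall>I J. I \<subseteq> {..<K} \<longrightarrow> J \<subseteq> {..<K} \<longrightarrow> I \<noteq> {} \<longrightarrow> J \<noteq> {} \<longrightarrow>
     K \<le> card I + card J \<longrightarrow> (\<exists>i\<in>I. \<exists>j\<in>J. z i j))"

lemma indecomposableD:
  assumes "indecomposable K z" "I \<subseteq> {..<K}" "J \<subseteq> {..<K}" "I \<noteq> {}" "J \<noteq> {}" "K \<le> card I + card J"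
  obtains i j where "i \<in> I" "j \<in> J" "z i j"
  using assms unfolding indecomposable_def by metis

lemma indecomposable_transpose: "indecomposable K z \<Longrightarrow> indecomposable K (flip z)"
  unfolding indecomposable_def flip_def by (metis add.commute)

lemma indecomposable_row:
  assumes "indecomposable K z" "i < K"
  obtains j where "j < K" "z i j"
proof -
  have "K \<le> card {i} + card {..<K}" by simp
  then obtain i' j where "i' \<in> {i}" "j \<in> {..<K}" "z i' j"
    using indecomposableD[of K z "{i}" "{..<K}"] assms by (metis empty_iff insert_not_empty lessThan_iff
      empty_subsetI insert_subset subset_refl)
  then show ?thesis using that by auto
qed

text \<open>
  Let \<open>I\<close> be the set of rows with \<open>g \<ge> \<theta>\<close> and \<open>Jc\<close> the set of columns with \<open>h \<le> C / \<theta>\<close>. The pattern vanishes on \<open>I\<close>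
  times the complement of \<open>Jc\<close>, so that full indecomposability yields \<open>card I < card Jc\<close>. If no \<open>g i\<close> were in
  \<open>[\<theta> / M, \<theta>)\<close>, then \<open>T\<close> would be at most \<open>C\<^sup>2 / M\<close> on the remaining rows and the columns \<open>Jc\<close>; the columns
  \<open>Jc\<close> would then draw almost all their mass from the fewer rows \<open>I\<close>, whose sums are at most 1.

  The second alternative in the hypothesis on column sums admits columns of small mass, provided that the row
  with the same index is in \<open>I\<close> and is no heavier: such an index cancels from the comparison.
\<close>

lemma indecomposable_no_gap:
  fixes T :: "nat \<Rightarrow> nat \<Rightarrow> real"
  assumes z: "indecomposable K z" and C: "0 < C" and \<theta>: "0 < \<theta>" and M: "4 * (real K)\<^sup>2 * C\<^sup>2 \<le> M" "0 < M"
    and g: "\<And>i. i < K \<Longrightarrow> 0 < g i" and h: "\<And>i. i < K \<Longrightarrow> 0 < h i"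
    and T0: "\<And>i j. i < K \<Longrightarrow> j < K \<Longrightarrow> 0 \<le> T i j"
    and T1: "\<And>i j. i < K \<Longrightarrow> j < K \<Longrightarrow> T i j \<le> C * g i * h j"
    and zC: "\<And>i j. i < K \<Longrightarrow> j < K \<Longrightarrow> z i j \<Longrightarrow> g i * h j \<le> C"
    and row: "\<And>i. i < K \<Longrightarrow> (\<Sum>j<K. T i j) \<le> 1"
    and col: "\<And>j. j < K \<Longrightarrow> h j \<le> C / \<theta> \<Longrightarrow>
       1 - 1 / (4 * real K) \<le> (\<Sum>i<K. T i j) \<or> (\<theta> \<le> g j \<and> (\<Sum>i<K. T j i) \<le> (\<Sum>i<K. T i j))"
    and k: "k < K" "\<theta> \<le> g k" and l: "l < K" "g l < \<theta>"
  shows "\<exists>i<K. g i < \<theta> \<and> \<theta> / M \<le> g i"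
proof (rule ccontr)
  assume "\<not> ?thesis"
  then have gap: "g i < \<theta> / M" if "i < K" "g i < \<theta>" for i
    using that by force
  define I where "I = {i. i < K \<and> \<theta> \<le> g i}"
  define Ic where "Ic = {i. i < K \<and> g i < \<theta>}"
  define J where "J = {j. j < K \<and> C / \<theta> < h j}"
  define Jc where "Jc = {j. j < K \<and> h j \<le> C / \<theta>}"
  define row_sum where "row_sum i = (\<Sum>j<K. T i j)" for i
  define col_sum where "col_sum j = (\<Sum>i<K. T i j)" for j
  \<comment> \<open>The indices that cancel from the comparison of rows and columns.\<close>
  define B where "B = {j\<in>Jc \<inter> I. row_sum j \<le> col_sum j}"
  have fin: "finite I" "finite Ic" "finite J" "finite Jc" "finite B"
    unfolding B_def I_def Ic_def J_def Jc_def by auto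
  have split_I: "{..<K} = I \<union> Ic" "I \<inter> Ic = {}" unfolding I_def Ic_def by auto
  have split_J: "{..<K} = Jc \<union> J" "Jc \<inter> J = {}" unfolding Jc_def J_def by auto
  have cI: "K = card I + card Ic" using card_Un_disjoint[OF fin(1,2) split_I(2)] split_I(1)
    by (metis card_lessThan)
  have cJ: "K = card Jc + card J" using card_Un_disjoint[OF fin(4,3) split_J(2)] split_J(1)
    by (metis card_lessThan)
  have "l \<in> Ic" "k \<in> I" using k l unfolding I_def Ic_def by auto
  then have ne: "I \<noteq> {}" "card Ic > 0" using fin by (auto simp: card_gt_0_iff)
  have card_lt: "card I < card Jc"
  proof (cases "J = {}")
    case True
    then show ?thesis using cI cJ ne by simp
  next
    case False
    show ?thesis
    proof (rule ccontr)
      assume "\<not> ?thesis"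
      then have "K \<le> card I + card J" using cJ by simp
      then obtain i j where ij: "i \<in> I" "j \<in> J" "z i j"
        using indecomposableD[OF z, of I J] ne False I_def J_def by auto
      have "C < g i * h j"
      proof -
        have "C = \<theta> * (C / \<theta>)" using \<theta> by simp
        also have "\<dots> < \<theta> * h j" using ij(2) \<theta> unfolding J_def by (intro mult_strict_left_mono) auto
        also have "\<dots> \<le> g i * h j" using ij(1) h[of j] ij(2) unfolding I_def J_def
          by (intro mult_right_mono) auto
        finally show ?thesis .
      qed
      then show False using zC[OF _ _ ij(3)] ij unfolding I_def J_def by auto
    qed
  qed
  have small: "T i j \<le> C\<^sup>2 / M" if "i \<in> Ic" "j \<in> Jc" for i j
  proof -
    have ij: "i < K" "j < K" "g i < \<theta> / M" "h j \<le> C / \<theta>" using that gap unfolding Ic_def Jc_def by auto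
    have "T i j \<le> C * (g i * h j)" using T1 ij by (simp add: mult.assoc)
    also have "\<dots> \<le> C * (\<theta> / M * (C / \<theta>))"
      using ij C g[of i] h[of j] \<theta> M by (intro mult_left_mono mult_mono) auto
    also have "\<dots> = C\<^sup>2 / M" using \<theta> by (simp add: power2_eq_square)
    finally show ?thesis .
  qed
  have "sum col_sum Jc = (\<Sum>j\<in>Jc. \<Sum>i\<in>I. T i j) + (\<Sum>j\<in>Jc. \<Sum>i\<in>Ic. T i j)"
    unfolding col_sum_def split_I(1) using split_I(2) fin
    by (simp add: sum.union_disjoint sum.distrib)
  also have "(\<Sum>j\<in>Jc. \<Sum>i\<in>Ic. T i j) \<le> (\<Sum>j\<in>Jc. \<Sum>i\<in>Ic. C\<^sup>2 / M)"
    by (intro sum_mono small)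
  also have "\<dots> = real (card Jc) * (real (card Ic) * (C\<^sup>2 / M))" by simp
  also have "\<dots> \<le> real K * (real K * (C\<^sup>2 / M))"
    using cI cJ M by (intro mult_mono) auto
  also have "\<dots> = ((real K)\<^sup>2 * C\<^sup>2) / M" by (simp add: power2_eq_square)
  also have "\<dots> \<le> 1 / 4" using M by (simp add: field_simps)
  also have "(\<Sum>j\<in>Jc. \<Sum>i\<in>I. T i j) = (\<Sum>i\<in>I. \<Sum>j\<in>Jc. T i j)" by (rule sum.swap)
  also have "\<dots> \<le> (\<Sum>i\<in>I. row_sum i)"
    unfolding row_sum_def by (intro sum_mono sum_mono2) (auto simp: I_def Jc_def T0)
  finally have main: "sum col_sum Jc \<le> sum row_sum I + 1 / 4" by simp
  have BI: "B \<subseteq> I" "B \<subseteq> Jc" unfolding B_def by auto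
  have sI: "sum row_sum I = sum row_sum B + sum row_sum (I - B)"
    using BI(1) fin(1) by (metis add.commute sum.subset_diff)
  have sJ: "sum col_sum Jc = sum col_sum B + sum col_sum (Jc - B)"
    using BI(2) fin(4) by (metis add.commute sum.subset_diff)
  have "sum row_sum (I - B) \<le> (\<Sum>i\<in>I-B. 1)"
    by (intro sum_mono) (auto simp: I_def row_sum_def row)
  then have r1: "sum row_sum (I - B) \<le> real (card (I - B))" by simp
  have "(\<Sum>i\<in>Jc-B. 1 - 1 / (4 * real K)) \<le> sum col_sum (Jc - B)"
  proof (rule sum_mono)
    fix j assume j: "j \<in> Jc - B"
    then have "j < K" "h j \<le> C / \<theta>" unfolding Jc_def by auto
    from col[OF this] j show "1 - 1 / (4 * real K) \<le> col_sum j"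
      unfolding B_def I_def col_sum_def row_sum_def Jc_def by auto
  qed
  then have r2: "real (card (Jc - B)) * (1 - 1 / (4 * real K)) \<le> sum col_sum (Jc - B)" by simp
  have r3: "sum row_sum B \<le> sum col_sum B"
    by (intro sum_mono) (auto simp: B_def)
  have c1: "card (I - B) = card I - card B" "card (Jc - B) = card Jc - card B"
    using BI fin by (auto simp: card_Diff_subset)
  have c2: "card B \<le> card I" using BI fin by (simp add: card_mono)
  have c3: "real (card (I - B)) + 1 \<le> real (card (Jc - B))" using c1 c2 card_lt by linarith
  have "real (card (Jc - B)) \<le> real K" using c1 cJ by linarith
  moreover have "K > 0" using k by simp
  ultimately have "real (card (Jc - B)) * (1 / (4 * real K)) \<le> 1 / 4" by (simp add: field_simps)
  then show False using main sI sJ r1 r2 r3 c3 by (simp add: algebra_simps)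
qed

text \<open>
  The sets \<open>{i. g m / M ^ p \<le> g i}\<close> gain an element with each step of \<open>p\<close>, because there is no gap, until they exhaust
  the index set; this takes fewer than \<open>K\<close> steps.
\<close>

lemma indecomposable_flat:
  fixes T :: "nat \<Rightarrow> nat \<Rightarrow> real"
  assumes z: "indecomposable K z" and C: "0 < C" and M: "4 * (real K)\<^sup>2 * C\<^sup>2 \<le> M" "1 \<le> M"
    and g: "\<And>i. i < K \<Longrightarrow> 0 < g i" and h: "\<And>i. i < K \<Longrightarrow> 0 < h i"
    and T0: "\<And>i j. i < K \<Longrightarrow> j < K \<Longrightarrow> 0 \<le> T i j"
    and T1: "\<And>i j. i < K \<Longrightarrow> j < K \<Longrightarrow> T i j \<le> C * g i * h j"
    and zC: "\<And>i j. i < K \<Longrightarrow> j < K \<Longrightarrow> z i j \<Longrightarrow> g i * h j \<le> C"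
    and row: "\<And>i. i < K \<Longrightarrow> (\<Sum>j<K. T i j) \<le> 1"
    and m: "m < K" "\<And>i. i < K \<Longrightarrow> g i \<le> g m"
    and col: "\<And>j \<theta>. j < K \<Longrightarrow> g m / M ^ K \<le> \<theta> \<Longrightarrow> h j \<le> C / \<theta> \<Longrightarrow>
       1 - 1 / (4 * real K) \<le> (\<Sum>i<K. T i j) \<or> (\<theta> \<le> g j \<and> (\<Sum>i<K. T j i) \<le> (\<Sum>i<K. T i j))"
    and i: "i < K"
  shows "g m \<le> M ^ K * g i"
proof -
  define R where "R p = {i. i < K \<and> g m / M ^ p \<le> g i}" for p
  have M0: "M > 0" using M by simp
  have claim: "R p = {..<K} \<or> p + 1 \<le> card (R p)" if "p \<le> K" for p
    using that
  proof (induction p)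
    case 0
    have "m \<in> R 0" using m by (simp add: R_def)
    moreover have "finite (R 0)" by (simp add: R_def)
    ultimately have "card (R 0) > 0" by (auto simp: card_gt_0_iff)
    then show ?case by simp
  next
    case (Suc p)
    have sub: "R p \<subseteq> R (Suc p)"
    proof
      fix i assume "i \<in> R p"
      moreover have "g m / M ^ Suc p \<le> g m / M ^ p"
        using M g[OF m(1)] by (intro divide_left_mono power_increasing) auto
      ultimately show "i \<in> R (Suc p)" unfolding R_def by force
    qed
    have fin: "finite (R q)" "R q \<subseteq> {..<K}" for q by (auto simp: R_def)
    show ?case
    proof (cases "R p = {..<K}")
      case True
      then have "R (Suc p) = {..<K}" using sub fin(2)[of "Suc p"] by auto
      then show ?thesis by simp
    next
      case False
      then obtain l where l: "l < K" "g l < g m / M ^ p" unfolding R_def by (force simp: not_le)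
      have gm: "g m / M ^ p \<le> g m"
        using M g[OF m(1)] one_le_power[OF M(2), of p] by (simp add: divide_le_eq)
      have gp: "0 < g m / M ^ p" using g[OF m(1)] M0 by simp
      have pK: "g m / M ^ K \<le> g m / M ^ p"
        using M M0 g[OF m(1)] Suc.prems by (intro divide_left_mono power_increasing) auto
      have "\<exists>i<K. g i < g m / M ^ p \<and> g m / M ^ p / M \<le> g i"
        by (rule indecomposable_no_gap[OF z C gp M(1) M0, where h = h and T = T and k = m and l = l])
          (use g h T0 T1 zC row m gm l col[OF _ pK] in auto)
      then obtain i where "i < K" "g i < g m / M ^ p" "g m / M ^ p / M \<le> g i" by auto
      then have "i \<in> R (Suc p) - R p" unfolding R_def by (simp add: mult.commute)
      then have "R p \<subset> R (Suc p)" using sub by blast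
      then have "card (R p) < card (R (Suc p))" using fin(1) by (intro psubset_card_mono)
      then show ?thesis using Suc False by simp
    qed
  qed
  have "card (R K) \<le> K" using card_mono[of "{..<K}" "R K"] by (auto simp: R_def)
  then have "R K = {..<K}" using claim[of K] by simp
  then have "g m / M ^ K \<le> g i" using i unfolding R_def by blast
  then show ?thesis using M0 by (simp add: divide_le_eq mult.commute)
qed

section \<open>A priori bounds for approximate scalings\<close>

text \<open>
  For \<open>\<epsilon> = 0\<close> the matrix with entries \<open>x i * v i j * y j\<close> is doubly stochastic. The last condition
  removes the freedom to replace \<open>(x, y)\<close> by \<open>(c x, y / c)\<close>.
\<close>

definition approx_scaling ::
    "nat \<Rightarrow> (nat \<Rightarrow> nat \<Rightarrow> real) \<Rightarrow> real \<Rightarrow> (nat \<Rightarrow> real) \<Rightarrow> (nat \<Rightarrow> real) \<Rightarrow> bool" where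
  "approx_scaling n v \<epsilon> x y \<longleftrightarrow>
     (\<forall>i<n. 0 < x i \<and> 0 < y i \<and>
        1 - \<epsilon> \<le> x i * mv n v y i \<and> x i * mv n v y i \<le> 1 \<and>
        1 - \<epsilon> \<le> y i * mv n (flip v) x i \<and> y i * mv n (flip v) x i \<le> 1) \<and>
     sum x {..<n} = sum y {..<n}"

lemma approx_scaling_transpose: "approx_scaling n v \<epsilon> x y \<Longrightarrow> approx_scaling n (flip v) \<epsilon> y x"
  unfolding approx_scaling_def by auto

definition block_profile ::
    "nat \<Rightarrow> real \<Rightarrow> real \<Rightarrow> nat \<Rightarrow> (nat \<Rightarrow> nat \<Rightarrow> bool) \<Rightarrow> (nat \<Rightarrow> nat set) \<Rightarrow>
     (nat \<Rightarrow> nat \<Rightarrow> real) \<Rightarrow> bool" where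
  "block_profile K \<phi> \<sigma> n z I v \<longleftrightarrow>
     0 < n \<and> K dvd n \<and> indecomposable K z \<and>
     (\<Union>k<K. I k) = {..<n} \<and> disjoint_family_on I {..<K} \<and> (\<forall>k<K. card (I k) = n div K) \<and>
     (\<forall>i<n. \<forall>j<n. 0 \<le> v i j \<and> v i j \<le> \<sigma> / n) \<and>
     (\<forall>k<K. \<forall>l<K. z k l \<longrightarrow> (\<forall>i\<in>I k. \<forall>j\<in>I l. \<phi> / n \<le> v i j))"

lemma block_profile_transpose: "block_profile K \<phi> \<sigma> n z I v \<Longrightarrow> block_profile K \<phi> \<sigma> n (flip z) I (flip v)"
  unfolding block_profile_def using indecomposable_transpose by (auto simp: flip_def)

text \<open>
  The blocks that meet the sides of a zero rectangle of \<open>v\<close> form a zero rectangle of \<open>z\<close>, which has at most \<open>K - 1\<close> blocks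
  on its two sides together. As all blocks have the same size, the sides of the rectangle of \<open>v\<close> have fewer than \<open>n\<close>
  elements together.
\<close>

lemma block_profile_indecomposable:
  assumes bp: "block_profile K \<phi> \<sigma> n z I v" and \<phi>: "0 < \<phi>"
  shows "indecomposable n (\<lambda>i j. 0 < v i j)"
  unfolding indecomposable_def
proof (intro allI impI)
  fix X Y assume XY: "X \<subseteq> {..<n}" "Y \<subseteq> {..<n}" "X \<noteq> {}" "Y \<noteq> {}" "n \<le> card X + card Y"
  note bp = bp[unfolded block_profile_def]
  define m where "m = n div K"
  have n: "n = K * m" "0 < n" "0 < m" using bp unfolding m_def by auto
  define X' where "X' = {k. k < K \<and> I k \<inter> X \<noteq> {}}"
  define Y' where "Y' = {k. k < K \<and> I k \<inter> Y \<noteq> {}}"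
  have cover: "card W \<le> card {k. k < K \<and> I k \<inter> W \<noteq> {}} * m" if W: "W \<subseteq> {..<n}" for W
  proof -
    let ?W = "{k. k < K \<and> I k \<inter> W \<noteq> {}}"
    have "W \<subseteq> (\<Union>k\<in>?W. I k)"
    proof
      fix x assume x: "x \<in> W"
      have "(\<Union>k<K. I k) = {..<n}" using bp by simp
      then have "x \<in> (\<Union>k<K. I k)" using W x by auto
      then show "x \<in> (\<Union>k\<in>?W. I k)" using x by blast
    qed
    moreover have "finite (\<Union>k\<in>?W. I k)"
      by (rule finite_subset[of _ "{..<n}"]) (use bp in auto)
    ultimately have "card W \<le> card (\<Union>k\<in>?W. I k)" by (rule card_mono[rotated])
    also have "\<dots> \<le> (\<Sum>k\<in>?W. card (I k))" by (rule card_UN_le) auto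
    also have "\<dots> = (\<Sum>k\<in>?W. m)" using bp by (intro sum.cong) (auto simp: m_def)
    finally show ?thesis by simp
  qed
  have "K * m \<le> (card X' + card Y') * m"
    using XY(5) cover[OF XY(1)] cover[OF XY(2)] n(1) unfolding X'_def Y'_def
    by (simp add: add_mult_distrib)
  then have KXY: "K \<le> card X' + card Y'" using n by simp
  have UI: "(\<Union>k<K. I k) = {..<n}" using bp by simp
  obtain x y where x: "x \<in> X" and y: "y \<in> Y" using XY by auto
  have "x \<in> (\<Union>k<K. I k)" "y \<in> (\<Union>k<K. I k)" unfolding UI using x y XY by auto
  then have ne: "X' \<noteq> {}" "Y' \<noteq> {}" unfolding X'_def Y'_def using x y by auto
  have sub: "X' \<subseteq> {..<K}" "Y' \<subseteq> {..<K}" unfolding X'_def Y'_def by auto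
  have "indecomposable K z" using bp by simp
  from indecomposableD[OF this sub ne KXY] obtain k l where kl: "k \<in> X'" "l \<in> Y'" "z k l" .
  then obtain x y where xy: "x \<in> I k" "x \<in> X" "y \<in> I l" "y \<in> Y" unfolding X'_def Y'_def by auto
  have "k < K" "l < K" using kl unfolding X'_def Y'_def by auto
  then have "\<phi> / n \<le> v x y" using bp kl(3) xy by simp
  moreover have "0 < \<phi> / n" using \<phi> n by simp
  ultimately have "0 < v x y" by linarith
  then show "\<exists>i\<in>X. \<exists>j\<in>Y. 0 < v i j" using xy by blast
qed

lemma sum_over_blocks:
  assumes "block_profile K \<phi> \<sigma> n z I v"
  shows "sum f {..<n} = (\<Sum>k<K. sum f (I k))"
proof -
  note bp = assms[unfolded block_profile_def]
  have "finite (I k)" if "k < K" for k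
    by (rule finite_subset[of _ "{..<n}"]) (use bp that in auto)
  then have "sum f (\<Union>k<K. I k) = (\<Sum>k<K. sum f (I k))"
    using bp by (intro sum.UNION_disjoint) (auto simp: disjoint_family_on_def)
  then show ?thesis using bp by simp
qed

text \<open>
  Averaging \<open>x i * v i j * y j\<close> over blocks gives a \<open>K \<times> K\<close> matrix to which the gap argument applies, with constants
  that do not involve \<open>n\<close>.
\<close>

lemma block_flat:
  assumes bp: "block_profile K \<phi> \<sigma> n z I v" and \<phi>: "0 < \<phi>" and \<sigma>: "0 < \<sigma>"
    and ap: "approx_scaling n v (1 / (4 * real K)) x y"
    and M: "M = 4 * (real K)\<^sup>2 * (\<sigma> + K / \<phi>)\<^sup>2 + 1"
    and kl: "k < K" "l < K"
  shows "sum x (I k) \<le> M ^ K * sum x (I l)"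
proof -
  note bp' = bp[unfolded block_profile_def]
  note ap' = ap[unfolded approx_scaling_def]
  define C where "C = \<sigma> + K / \<phi>"
  define m where "m = n div K"
  have n: "n = K * m" "0 < n" "0 < m" "0 < K" using bp' unfolding m_def by (auto intro: gr0I)
  have C: "0 < C" "\<sigma> \<le> C" "K / \<phi> \<le> C" using \<phi> \<sigma> n unfolding C_def by (auto intro: add_pos_nonneg)
  have I: "finite (I k)" "I k \<subseteq> {..<n}" "card (I k) = m" "I k \<noteq> {}" if "k < K" for k
  proof -
    show sub: "I k \<subseteq> {..<n}" using bp' that by auto
    show "finite (I k)" by (rule finite_subset[OF sub]) auto
    show c: "card (I k) = m" using bp' that unfolding m_def by auto
    show "I k \<noteq> {}" using c n by auto
  qed
  define g where "g k = sum x (I k) / m" for k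
  define h where "h k = sum y (I k) / m" for k
  define T where "T k l = (\<Sum>i\<in>I k. \<Sum>j\<in>I l. x i * v i j * y j) / m" for k l
  have g0: "0 < g k" if "k < K" for k
    unfolding g_def using ap' I[OF that] n by (intro divide_pos_pos sum_pos) (auto simp: subset_iff)
  have h0: "0 < h k" if "k < K" for k
    unfolding h_def using ap' I[OF that] n by (intro divide_pos_pos sum_pos) (auto simp: subset_iff)
  have pos: "0 \<le> x i" "0 \<le> y i" if "i < n" for i using ap' that by (auto intro: less_imp_le)
  have T0: "0 \<le> T k l" if "k < K" "l < K" for k l
    unfolding T_def using that bp' I pos
    by (intro divide_nonneg_nonneg sum_nonneg mult_nonneg_nonneg) (auto simp: subset_iff)
  have prod_eq: "(\<Sum>i\<in>I k. \<Sum>j\<in>I l. x i * (c / n) * y j) / m = c / K * g k * h l"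
    if "k < K" "l < K" for k l c
  proof -
    have "(\<Sum>i\<in>I k. \<Sum>j\<in>I l. x i * (c / n) * y j) = c / n * (sum x (I k) * sum y (I l))"
      by (subst sum_product) (simp add: sum_distrib_left mult_ac)
    then show ?thesis unfolding g_def h_def using n by (simp add: field_simps)
  qed
  have T_up: "T k l \<le> \<sigma> / K * g k * h l" if kl: "k < K" "l < K" for k l
  proof -
    have "T k l \<le> (\<Sum>i\<in>I k. \<Sum>j\<in>I l. x i * (\<sigma> / n) * y j) / m"
      unfolding T_def using I kl pos bp' n
      by (intro divide_right_mono sum_mono mult_right_mono mult_left_mono) (auto simp: subset_iff)
    then show ?thesis using prod_eq[OF kl] by simp
  qed
  have T_low: "\<phi> / K * g k * h l \<le> T k l" if kl: "k < K" "l < K" "z k l" for k l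
  proof -
    have "(\<Sum>i\<in>I k. \<Sum>j\<in>I l. x i * (\<phi> / n) * y j) / m \<le> T k l"
      unfolding T_def using I kl pos bp' n
      by (intro divide_right_mono sum_mono mult_right_mono mult_left_mono) (auto simp: subset_iff)
    then show ?thesis using prod_eq[OF kl(1,2)] by simp
  qed
  have avg: "c \<le> sum f (I k) / m \<and> sum f (I k) / m \<le> d"
    if "k < K" "\<And>i. i < n \<Longrightarrow> c \<le> f i \<and> f i \<le> d" for k c d and f :: "nat \<Rightarrow> real"
  proof -
    have "real m * c \<le> sum f (I k)" "sum f (I k) \<le> real m * d"
      using sum_bounded_below[of "I k" c f] sum_bounded_above[of "I k" f d] that I[OF that(1)]
      by auto
    then show ?thesis using n by (simp add: field_simps)
  qed
  have rows: "(\<Sum>l<K. T k l) = (\<Sum>i\<in>I k. x i * mv n v y i) / m" if "k < K" for k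
  proof -
    have "(\<Sum>l<K. \<Sum>i\<in>I k. \<Sum>j\<in>I l. x i * v i j * y j) = (\<Sum>i\<in>I k. \<Sum>l<K. \<Sum>j\<in>I l. x i * v i j * y j)"
      by (rule sum.swap)
    also have "\<dots> = (\<Sum>i\<in>I k. x i * mv n v y i)"
      unfolding mv_def sum_over_blocks[OF bp, symmetric] by (simp add: sum_distrib_left mult_ac)
    finally show ?thesis unfolding T_def by (simp add: sum_divide_distrib[symmetric])
  qed
  have cols: "(\<Sum>k<K. T k l) = (\<Sum>j\<in>I l. y j * mv n (flip v) x j) / m" if "l < K" for l
  proof -
    have "(\<Sum>k<K. \<Sum>i\<in>I k. \<Sum>j\<in>I l. x i * v i j * y j) = (\<Sum>i<n. \<Sum>j\<in>I l. x i * v i j * y j)"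
      by (rule sum_over_blocks[OF bp, symmetric])
    also have "\<dots> = (\<Sum>j\<in>I l. \<Sum>i<n. x i * v i j * y j)" by (rule sum.swap)
    also have "\<dots> = (\<Sum>j\<in>I l. y j * mv n (flip v) x j)"
      unfolding mv_def flip_def by (simp add: sum_distrib_left mult_ac)
    finally show ?thesis unfolding T_def by (simp add: sum_divide_distrib[symmetric])
  qed
  have row: "(\<Sum>l<K. T k l) \<le> 1" if "k < K" for k
    unfolding rows[OF that] using avg[OF that, of "1 - 1 / (4 * real K)" "\<lambda>i. x i * mv n v y i" 1] ap'
    by blast
  have col: "1 - 1 / (4 * real K) \<le> (\<Sum>k<K. T k l)" if "l < K" for l
    unfolding cols[OF that]
    using avg[OF that, of "1 - 1 / (4 * real K)" "\<lambda>i. y i * mv n (flip v) x i" 1] ap' by blast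
  have zC: "g k * h l \<le> C" if "k < K" "l < K" "z k l" for k l
  proof -
    have "T k l \<le> (\<Sum>l<K. T k l)" using that T0 by (intro member_le_sum) auto
    then have "\<phi> / K * (g k * h l) \<le> 1" using T_low[OF that] row[OF that(1)] by (simp add: mult_ac)
    then have "g k * h l \<le> K / \<phi>" using \<phi> n by (simp add: field_simps)
    then show ?thesis using C by simp
  qed
  have T1: "T k l \<le> C * g k * h l" if "k < K" "l < K" for k l
  proof -
    have "\<sigma> / K \<le> \<sigma> / 1" using \<sigma> n by (intro divide_left_mono) auto
    then have "\<sigma> / K \<le> C" using C by simp
    then have "\<sigma> / K * (g k * h l) \<le> C * (g k * h l)"
      using g0[OF that(1)] h0[OF that(2)] by (intro mult_right_mono) auto
    then show ?thesis using T_up[OF that] by (simp add: mult_ac)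
  qed
  have "Max (g ` {..<K}) \<in> g ` {..<K}" using n by (intro Max_in) auto
  then obtain m' where m': "m' < K" "g m' = Max (g ` {..<K})" by auto
  have gm: "g i \<le> g m'" if "i < K" for i unfolding m'(2) using that by (intro Max_ge) auto
  have "g m' \<le> M ^ K * g l"
    by (rule indecomposable_flat[of K z C M g h T])
      (use bp' C g0 h0 T0 T1 zC row m' gm col kl in \<open>auto simp: M C_def\<close>)
  then have "g k \<le> M ^ K * g l" using gm[OF kl(1)] by simp
  then show ?thesis unfolding g_def using n by (simp add: field_simps)
qed

text \<open>
  The vectors \<open>x\<close> and \<open>y\<close> have the same mean \<open>Q\<close>, and all their block averages are comparable with it. So an entry of the
  averaged matrix at a place where \<open>z\<close> holds is at least a multiple of \<open>Q\<^sup>2\<close>, while row sums are at most 1; and the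
  total mass, which is at least \<open>n / 2\<close>, is at most \<open>n \<sigma> Q\<^sup>2\<close>. Hence \<open>Q\<close> and all \<open>mv n v y i\<close> are of order one, and
  \<open>x i\<close> is of the order of \<open>1 / mv n v y i\<close>. The point is that \<open>c\<close> and \<open>U\<close> are the same for all \<open>n\<close>.
\<close>

lemma approx_scaling_bounds:
  assumes K: "0 < K" and \<phi>: "0 < \<phi>" and \<sigma>: "0 < \<sigma>"
  obtains c U where "0 < c" "c \<le> U"
    "\<And>n z I v x y i. block_profile K \<phi> \<sigma> n z I v \<Longrightarrow> approx_scaling n v (1 / (4 * real K)) x y \<Longrightarrow>
       i < n \<Longrightarrow> c \<le> x i \<and> x i \<le> U \<and> c \<le> y i \<and> y i \<le> U"
proof -
  \<comment> \<open>The gap factor of the gap argument for the constant \<open>\<sigma> + K / \<phi>\<close>.\<close>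
  define M where "M = 4 * (real K)\<^sup>2 * (\<sigma> + K / \<phi>)\<^sup>2 + 1"
  define D where "D = M ^ K"
  have M: "1 \<le> M" unfolding M_def by simp
  then have D: "1 \<le> D" unfolding D_def by (rule one_le_power)
  \<comment> \<open>The bounds for the mean: \<open>L \<le> Q \<le> H\<close>.\<close>
  define H where "H = D * sqrt (K / \<phi>)"
  define L where "L = sqrt (1 / (2 * \<sigma>))"
  have HL: "0 < H" "0 < L" unfolding H_def L_def using D K \<phi> \<sigma> by auto
  define c where "c = 1 / (2 * \<sigma> * H)"
  define U where "U = K * D / (\<phi> * L)"
  have c: "0 < c" unfolding c_def using HL \<sigma> by simp
  have one_side: "c \<le> x i \<and> x i \<le> U"
    if bp: "block_profile K \<phi> \<sigma> n z I v" and ap: "approx_scaling n v (1 / (4 * real K)) x y" and i: "i < n"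
    for n z I v x y i
  proof -
    note bp' = bp[unfolded block_profile_def]
    note ap' = ap[unfolded approx_scaling_def]
    have fidz: "indecomposable K z" using bp' by simp
    define Q where "Q = sum x {..<n} / n"
    have Qy: "Q = sum y {..<n} / n" unfolding Q_def using ap' by simp
    have n: "0 < n" using i by simp
    have pos: "0 \<le> x i" "0 \<le> y i" "0 < x i" if "i < n" for i using ap' that by (auto intro: less_imp_le)
    have Q0: "0 < Q" unfolding Q_def using n pos by (intro divide_pos_pos sum_pos) auto
    define m where "m = n div K"
    have m: "real n = K * m" "0 < m" using bp' n by (auto simp: m_def)
    have eps: "1 / (4 * real K) \<le> 1 / 2" using K by (simp add: field_simps)
    have p: "1 / 2 \<le> x i * mv n v y i" "x i * mv n v y i \<le> 1" if "i < n" for i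
    proof -
      have "1 - 1 / (4 * real K) \<le> x i * mv n v y i" "x i * mv n v y i \<le> 1" using ap' that by blast+
      then show "1 / 2 \<le> x i * mv n v y i" "x i * mv n v y i \<le> 1" using eps by linarith+
    qed
    have Ik: "I k \<subseteq> {..<n}" if "k < K" for k using bp' that by auto
    have fx: "Q * m \<le> D * sum x (I k)" if "k < K" for k
    proof -
      have "sum x {..<n} = (\<Sum>l<K. sum x (I l))" by (rule sum_over_blocks[OF bp])
      also have "\<dots> \<le> (\<Sum>l<K. D * sum x (I k))"
        unfolding D_def by (intro sum_mono block_flat[OF bp \<phi> \<sigma> ap M_def]) (use that in auto)
      also have "\<dots> = K * (D * sum x (I k))" by simp
      finally show ?thesis unfolding Q_def using m K n by (simp add: field_simps)
    qed
    have fy: "Q * m \<le> D * sum y (I k)" if "k < K" for k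
    proof -
      have "sum y {..<n} = (\<Sum>l<K. sum y (I l))" by (rule sum_over_blocks[OF bp])
      also have "\<dots> \<le> (\<Sum>l<K. D * sum y (I k))"
        unfolding D_def
        by (intro sum_mono block_flat[OF block_profile_transpose[OF bp] \<phi> \<sigma> approx_scaling_transpose[OF ap] M_def])
          (use that in auto)
      also have "\<dots> = K * (D * sum y (I k))" by simp
      finally show ?thesis unfolding Qy using m K n by (simp add: field_simps)
    qed
    have b_up: "mv n v y i \<le> \<sigma> * Q" if "i < n" for i
    proof -
      have "mv n v y i \<le> (\<Sum>j<n. \<sigma> / n * y j)"
        unfolding mv_def using bp' pos that by (intro sum_mono mult_right_mono) auto
      then show ?thesis unfolding Qy by (simp add: sum_distrib_left[symmetric] sum_divide_distrib[symmetric])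
    qed
    have b_low: "\<phi> / (K * D) * Q \<le> mv n v y i" if ik: "i \<in> I k" and k: "k < K" for i k
    proof -
      have il: "i < n" using Ik ik k by auto
      obtain l where l: "l < K" "z k l" by (rule indecomposable_row[OF fidz k])
      have "\<phi> / n * sum y (I l) = (\<Sum>j\<in>I l. \<phi> / n * y j)" by (rule sum_distrib_left)
      also have "\<dots> \<le> (\<Sum>j\<in>I l. v i j * y j)"
        using bp' ik k l pos Ik[OF l(1)] by (intro sum_mono mult_right_mono) auto
      also have "\<dots> \<le> mv n v y i"
        unfolding mv_def using bp' pos il Ik[OF l(1)] by (intro sum_mono2 mult_nonneg_nonneg) auto
      finally have "\<phi> / n * sum y (I l) \<le> mv n v y i" .
      moreover have "\<phi> / n * (Q * m / D) \<le> \<phi> / n * sum y (I l)"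
        using fy[OF l(1)] D \<phi> by (intro mult_left_mono) (auto simp: divide_le_eq mult.commute)
      moreover have "\<phi> / (K * D) * Q = \<phi> / n * (Q * m / D)" using m K by simp
      ultimately show ?thesis by linarith
    qed
    have b_low': "\<phi> / (K * D) * Q \<le> mv n v y i" if "i < n" for i
    proof -
      have "i \<in> (\<Union>k<K. I k)" using bp' that by auto
      then show ?thesis using b_low by blast
    qed
    have Q_up: "Q \<le> H"
    proof -
      have "\<exists>i\<in>I 0. Q / D \<le> x i"
      proof (rule ccontr)
        assume "\<not> (\<exists>i\<in>I 0. Q / D \<le> x i)"
        then have lt: "x i < Q / D" if "i \<in> I 0" for i using that by (meson not_le)
        have c0: "card (I 0) = m" using bp' K unfolding m_def by auto
        have fin: "finite (I 0)" by (rule finite_subset[OF Ik[OF K]]) simp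
        have "0 < card (I 0)" using c0 m(2) by simp
        then have "sum x (I 0) < real (card (I 0)) * (Q / D)"
          using lt by (intro sum_bounded_above_strict)
        then show False using fx[OF K] D m c0 by (simp add: field_simps)
      qed
      then obtain i where i: "i \<in> I 0" "Q / D \<le> x i" by blast
      have il: "i < n" using Ik[OF K] i by auto
      have b2: "\<phi> / (K * D) * Q \<le> mv n v y i" by (rule b_low[OF i(1) K])
      have "\<phi> / K * (Q / D)\<^sup>2 = Q / D * (\<phi> / (K * D) * Q)" by (simp add: power2_eq_square mult_ac)
      also have "\<dots> \<le> x i * mv n v y i"
        using b2 i(2) Q0 D \<phi> pos[OF il] by (intro mult_mono) auto
      also have "\<dots> \<le> 1" using p[OF il] by simp
      finally have "(Q / D)\<^sup>2 \<le> K / \<phi>" using K \<phi> by (simp add: le_divide_eq divide_le_eq mult.commute)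
      then have "Q / D \<le> sqrt (K / \<phi>)" by (rule real_le_rsqrt)
      then show ?thesis unfolding H_def using D by (simp add: divide_le_eq mult.commute)
    qed
    have Q_low: "L \<le> Q"
    proof -
      have "real n * (1 / 2) \<le> (\<Sum>i<n. x i * mv n v y i)"
        using sum_bounded_below[of "{..<n}" "1/2" "\<lambda>i. x i * mv n v y i"] p by simp
      also have "\<dots> \<le> (\<Sum>i<n. x i * (\<sigma> * Q))"
        using b_up pos by (intro sum_mono mult_left_mono) auto
      also have "\<dots> = sum x {..<n} * (\<sigma> * Q)" by (rule sum_distrib_right[symmetric])
      also have "sum x {..<n} = n * Q" unfolding Q_def using n by simp
      finally have "1 / (2 * \<sigma>) \<le> Q\<^sup>2" using n \<sigma> by (simp add: field_simps power2_eq_square)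
      then show ?thesis unfolding L_def using Q0 by (intro real_le_lsqrt) auto
    qed
    have b0: "0 < mv n v y i" using p(1)[OF i] pos[OF i]
      by (smt (verit) mult_nonneg_nonpos zero_less_divide_1_iff)
    \<comment> \<open>\<open>x i\<close> is about \<open>1 / mv n v y i\<close>, and \<open>mv n v y i\<close> lies between multiples of \<open>Q\<close>.\<close>
    have "c \<le> x i"
    proof -
      have "1 / 2 \<le> x i * (\<sigma> * H)"
        using p(1)[OF i] b_up[OF i] Q_up pos[OF i] \<sigma>
        by (meson order_trans mult_left_mono less_imp_le)
      then show ?thesis unfolding c_def using \<sigma> HL by (simp add: field_simps)
    qed
    moreover have "x i \<le> U"
    proof -
      have "\<phi> / (K * D) * L \<le> \<phi> / (K * D) * Q" using Q_low \<phi> D by (intro mult_left_mono) auto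
      then have "x i * (\<phi> / (K * D) * L) \<le> x i * mv n v y i"
        using b_low'[OF i] pos[OF i] by (intro mult_left_mono) auto
      also have "\<dots> \<le> 1" using p[OF i] by simp
      finally show ?thesis unfolding U_def using K D \<phi> HL by (simp add: field_simps)
    qed
    ultimately show ?thesis by simp
  qed
  show ?thesis
  proof (rule that[of c "max c U"])
    fix n z I v x y i
    assume a: "block_profile K \<phi> \<sigma> n z I v" "approx_scaling n v (1 / (4 * real K)) x y" "i < n"
    show "c \<le> x i \<and> x i \<le> max c U \<and> c \<le> y i \<and> y i \<le> max c U"
      using one_side[OF a] one_side[OF block_profile_transpose[OF a(1)] approx_scaling_transpose[OF a(2)] a(3)]
      by auto
  qed (use c in auto)
qed

section \<open>Uniqueness of exact scalings and its linearization\<close>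

lemma mv_swap: "(\<Sum>i<n. x i * mv n v y i) = (\<Sum>j<n. y j * mv n (flip v) x j)"
proof -
  have "(\<Sum>i<n. x i * mv n v y i) = (\<Sum>i<n. \<Sum>j<n. x i * v i j * y j)"
    by (simp add: mv_def sum_distrib_left mult_ac)
  also have "\<dots> = (\<Sum>j<n. \<Sum>i<n. x i * v i j * y j)" by (rule sum.swap)
  also have "\<dots> = (\<Sum>j<n. y j * mv n (flip v) x j)"
    by (simp add: mv_def flip_def sum_distrib_left mult_ac)
  finally show ?thesis .
qed

lemma mv_nonneg: "(\<And>j. j < n \<Longrightarrow> 0 \<le> v i j) \<Longrightarrow> (\<And>j. j < n \<Longrightarrow> 0 \<le> x j) \<Longrightarrow> 0 \<le> mv n v x i"
  unfolding mv_def by (intro sum_nonneg mult_nonneg_nonneg) auto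

lemma mv_member:
  assumes "\<And>j. j < n \<Longrightarrow> 0 \<le> v i j" "\<And>j. j < n \<Longrightarrow> 0 \<le> x j" "j < n"
  shows "v i j * x j \<le> mv n v x i"
  unfolding mv_def using assms by (intro member_le_sum) auto

text \<open>
  Both \<open>I\<close> times the complement of \<open>J\<close>, and the complement of \<open>I\<close> times \<open>J\<close>, are zero rectangles; their four sides
  have \<open>2 n\<close> elements together, so that one of the two rectangles would be too large unless it is degenerate.
\<close>

lemma indecomposable_closed:
  assumes z: "indecomposable n z" and I: "I \<subseteq> {..<n}" "I \<noteq> {}" and J: "J \<subseteq> {..<n}"
    and IJ: "\<And>i j. i \<in> I \<Longrightarrow> j < n \<Longrightarrow> z i j \<Longrightarrow> j \<in> J"
    and JI: "\<And>i j. i < n \<Longrightarrow> j \<in> J \<Longrightarrow> z i j \<Longrightarrow> i \<in> I"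
  shows "I = {..<n}" "J = {..<n}"
proof -
  have fin: "finite I" "finite J" using I J finite_subset by blast+
  obtain i where i: "i \<in> I" using I by auto
  obtain j where "j < n" "z i j" using indecomposable_row[OF z, of i] i I by blast
  then have ne: "J \<noteq> {}" using IJ i by auto
  have cI: "card ({..<n} - I) = n - card I" using I fin by (simp add: card_Diff_subset)
  have cJ: "card ({..<n} - J) = n - card J" using J fin by (simp add: card_Diff_subset)
  have cle: "card I \<le> n" "card J \<le> n" using I J card_mono[of "{..<n}"] by auto
  have "J = {..<n}"
  proof (rule ccontr)
    assume J': "J \<noteq> {..<n}"
    have no1: "\<not> n \<le> card I + card ({..<n} - J)"
    proof
      assume "n \<le> card I + card ({..<n} - J)"
      with indecomposableD[OF z, of I "{..<n} - J"] I J J' obtain i j where "i \<in> I" "j \<in> {..<n} - J" "z i j" by blast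
      then show False using IJ by auto
    qed
    have no2: "\<not> n \<le> card ({..<n} - I) + card J" if "I \<noteq> {..<n}"
    proof
      assume "n \<le> card ({..<n} - I) + card J"
      with indecomposableD[OF z, of "{..<n} - I" J] I J ne that obtain i j where "i \<in> {..<n} - I" "j \<in> J" "z i j" by blast
      then show False using JI by auto
    qed
    show False
    proof (cases "I = {..<n}")
      case True
      then show ?thesis using no1 by simp
    next
      case False
      then show ?thesis using no1 no2 cI cJ cle by linarith
    qed
  qed
  moreover have "I = {..<n}"
  proof -
    have "i \<in> I" if "i < n" for i
      using indecomposable_row[OF z that] JI[OF that] \<open>J = {..<n}\<close> by (metis lessThan_iff)
    then show ?thesis using I by auto
  qed
  ultimately show "I = {..<n}" "J = {..<n}" by auto
qed

text \<open>
  The maximum principle behind \<open>scaling_unique\<close> and \<open>scaling_kernel\<close>. There \<open>g\<close> measures the distance from a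
  maximum over rows and \<open>f\<close> the distance from a lower bound over columns. An index where one of them vanishes forces the other
  to vanish at all its neighbours in the support of \<open>S\<close>.
\<close>

lemma zero_propagates:
  fixes f g :: "nat \<Rightarrow> real"
  assumes z: "indecomposable n (\<lambda>i j. 0 < S i j)" and S: "\<And>i j. i < n \<Longrightarrow> j < n \<Longrightarrow> 0 \<le> S i j"
    and g: "\<And>i. i < n \<Longrightarrow> 0 \<le> g i" and f: "\<And>j. j < n \<Longrightarrow> 0 \<le> f j"
    and m: "m < n" "g m = 0"
    and gf: "\<And>i. i < n \<Longrightarrow> g i = 0 \<Longrightarrow> (\<Sum>j<n. S i j * f j) = 0"
    and fg: "\<And>j. j < n \<Longrightarrow> f j = 0 \<Longrightarrow> (\<Sum>i<n. S i j * g i) = 0"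
    and i: "i < n"
  shows "g i = 0 \<and> f i = 0"
proof -
  define I where "I = {i. i < n \<and> g i = 0}"
  define J where "J = {j. j < n \<and> f j = 0}"
  have 1: "j \<in> J" if "i \<in> I" "j < n" "0 < S i j" for i j
  proof -
    have i: "i < n" "g i = 0" using that by (auto simp: I_def)
    have "\<forall>j\<in>{..<n}. S i j * f j = 0"
      using gf[OF i] S f i by (subst (asm) sum_nonneg_eq_0_iff) auto
    then have "S i j * f j = 0" using that(2) by blast
    then show ?thesis using that unfolding J_def by simp
  qed
  have 2: "i \<in> I" if "i < n" "j \<in> J" "0 < S i j" for i j
  proof -
    have j: "j < n" "f j = 0" using that by (auto simp: J_def)
    have "\<forall>i\<in>{..<n}. S i j * g i = 0"
      using fg[OF j] S g j by (subst (asm) sum_nonneg_eq_0_iff) auto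
    then have "S i j * g i = 0" using that(1) by blast
    then show ?thesis using that unfolding I_def by simp
  qed
  have "I \<noteq> {}" "I \<subseteq> {..<n}" "J \<subseteq> {..<n}" using m by (auto simp: I_def J_def)
  then have "I = {..<n}" "J = {..<n}" using indecomposable_closed[OF z] 1 2 by metis+
  then show ?thesis using i unfolding I_def J_def by auto
qed

lemma attains_max:
  fixes g :: "nat \<Rightarrow> real"
  assumes "0 < n"
  obtains m where "m < n" "\<And>i. i < n \<Longrightarrow> g i \<le> g m"
proof -
  have "Max (g ` {..<n}) \<in> g ` {..<n}" using assms by (intro Max_in) auto
  then obtain m where m: "m < n" "g m = Max (g ` {..<n})" by auto
  have "g i \<le> g m" if "i < n" for i unfolding m(2) using that by (intro Max_ge) auto
  then show ?thesis using that m by blast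
qed

lemma exact_scaling:
  assumes "approx_scaling n v 0 x y" and i: "i < n"
  shows "0 < x i" "0 < y i" "x i * mv n v y i = 1" "y i * mv n (flip v) x i = 1"
    "(\<Sum>j<n. x i * v i j * y j) = 1" "(\<Sum>k<n. x k * v k i * y i) = 1"
proof -
  note ap = assms(1)[unfolded approx_scaling_def]
  show "0 < x i" "0 < y i" using ap i by auto
  show 1: "x i * mv n v y i = 1" using ap i by force
  show 2: "y i * mv n (flip v) x i = 1" using ap i by force
  show "(\<Sum>j<n. x i * v i j * y j) = 1"
    using 1 unfolding mv_def by (simp add: sum_distrib_left mult_ac)
  show "(\<Sum>k<n. x k * v k i * y i) = 1"
    using 2 unfolding mv_def flip_def by (simp add: sum_distrib_left mult_ac)
qed

lemma scaled_indecomposable: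
  assumes "indecomposable n (\<lambda>i j. 0 < v i j)" "approx_scaling n v 0 x y"
  shows "indecomposable n (\<lambda>i j. 0 < x i * v i j * y j)"
  unfolding indecomposable_def
proof (intro allI impI)
  fix I J assume IJ: "I \<subseteq> {..<n}" "J \<subseteq> {..<n}" "I \<noteq> {}" "J \<noteq> {}" "n \<le> card I + card J"
  from indecomposableD[OF assms(1) this] obtain i j where ij: "i \<in> I" "j \<in> J" "0 < v i j" .
  then have "0 < x i * v i j * y j"
    using exact_scaling(1,2)[OF assms(2)] IJ by (auto simp: subset_iff)
  then show "\<exists>i\<in>I. \<exists>j\<in>J. 0 < x i * v i j * y j" using ij by blast
qed

text \<open>
  The ratios \<open>u = x' / x\<close> and \<open>w = y' / y\<close> satisfy \<open>u i * (\<Sum>j. S i j * w j) = 1\<close> and the transposed identity, where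
  \<open>S\<close> is doubly stochastic. With \<open>U\<close> the maximum of \<open>u\<close> this gives \<open>w \<ge> 1 / U\<close>, and the maximum principle makes
  \<open>u\<close> and \<open>w\<close> constant. The normalization forces \<open>U = 1\<close>.
\<close>

lemma scaling_unique:
  assumes z: "indecomposable n (\<lambda>i j. 0 < v i j)" and v: "\<And>i j. i < n \<Longrightarrow> j < n \<Longrightarrow> 0 \<le> v i j"
    and xy: "approx_scaling n v 0 x y" and xy': "approx_scaling n v 0 x' y'"
    and i: "i < n"
  shows "x i = x' i \<and> y i = y' i"
proof -
  define S where "S = (\<lambda>i j. x i * v i j * y j)"
  define u where "u i = x' i / x i" for i
  define w where "w j = y' j / y j" for j
  note E = exact_scaling[OF xy] and E' = exact_scaling[OF xy']
  have S: "0 \<le> S i j" if "i < n" "j < n" for i j unfolding S_def using E(1,2) v that by (auto simp: less_imp_le)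
  have uw: "0 < u i" "0 < w i" if "i < n" for i unfolding u_def w_def using E(1,2) E'(1,2) that by auto
  have S': "x' i * v i j * y' j = S i j * u i * w j" if "i < n" "j < n" for i j
    unfolding S_def u_def w_def using E(1)[OF that(1)] E(2)[OF that(2)] by simp
  have row: "(\<Sum>j<n. S i j) = 1" and col: "(\<Sum>k<n. S k i) = 1" if "i < n" for i
    using E(5,6)[OF that] unfolding S_def by auto
  have row': "u i * (\<Sum>j<n. S i j * w j) = 1" if "i < n" for i
    using E'(5)[OF that] S' that by (simp add: sum_distrib_left mult_ac)
  have col': "w j * (\<Sum>i<n. S i j * u i) = 1" if "j < n" for j
    using E'(6)[OF that] S' that by (simp add: sum_distrib_left mult_ac)
  obtain m where m: "m < n" "\<And>i. i < n \<Longrightarrow> u i \<le> u m" using attains_max[of n u] i by auto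
  define U where "U = u m"
  have U: "0 < U" unfolding U_def using uw m by auto
  \<comment> \<open>A column average of \<open>u\<close> is at most \<open>U\<close>.\<close>
  have w_ge: "1 / U \<le> w j" if "j < n" for j
  proof -
    have "(\<Sum>i<n. S i j * u i) \<le> (\<Sum>i<n. S i j * U)"
      using S that m unfolding U_def by (intro sum_mono mult_left_mono) auto
    also have "\<dots> = U" using col[OF that] by (simp add: sum_distrib_right[symmetric])
    finally have "w j * (\<Sum>i<n. S i j * u i) \<le> w j * U" using uw[OF that] by (intro mult_left_mono) auto
    then show ?thesis using col'[OF that] U by (simp add: field_simps)
  qed
  have all: "U - u i = 0 \<and> w i - 1 / U = 0" if "i < n" for i
  proof (rule zero_propagates[where S = S and m = m])
    show "indecomposable n (\<lambda>i j. 0 < S i j)" unfolding S_def by (rule scaled_indecomposable[OF z xy])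
    show "(\<Sum>j<n. S i j * (w j - 1 / U)) = 0" if "i < n" "U - u i = 0" for i
    proof -
      have "(\<Sum>j<n. S i j * (w j - 1 / U)) = (\<Sum>j<n. S i j * w j) - (\<Sum>j<n. S i j) / U"
        by (simp add: algebra_simps sum_subtractf sum_divide_distrib)
      then show ?thesis using row'[OF that(1)] row[OF that(1)] that U by (simp add: field_simps)
    qed
    show "(\<Sum>i<n. S i j * (U - u i)) = 0" if "j < n" "w j - 1 / U = 0" for j
    proof -
      have "(\<Sum>i<n. S i j * (U - u i)) = (\<Sum>i<n. S i j) * U - (\<Sum>i<n. S i j * u i)"
        by (simp add: right_diff_distrib sum_subtractf sum_distrib_right[symmetric])
      moreover have "w j = 1 / U" using that by simp
      then have "(\<Sum>i<n. S i j * u i) = U" using col'[OF that(1)] U by simp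
      ultimately show ?thesis using col[OF that(1)] by simp
    qed
  qed (use S m w_ge that in \<open>auto simp: U_def\<close>)
  have x': "x' i = U * x i" and y': "y' i = y i / U" if "i < n" for i
    using all[OF that] E(1,2)[OF that] U unfolding u_def w_def by (auto simp: field_simps)
  have s: "sum x {..<n} = sum y {..<n}" "sum x' {..<n} = sum y' {..<n}"
    using xy xy' unfolding approx_scaling_def by auto
  have "sum x' {..<n} = U * sum x {..<n}" by (simp add: x' sum_distrib_left)
  moreover have "sum y' {..<n} = sum y {..<n} / U" by (simp add: y' sum_divide_distrib)
  moreover have "0 < sum x {..<n}" using E(1) i by (intro sum_pos) auto
  ultimately have "U * U = 1" using s U by (simp add: field_simps)
  then have "U\<^sup>2 = 1" by (simp add: power2_eq_square)
  then have "U = 1" using U by (simp add: power2_eq_1_iff)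
  then show ?thesis using x' y' i by simp
qed

text \<open>
  The kernel of the linearized scaling equations is spanned by \<open>(x, - y)\<close>, the direction of
  \<open>(c x, y / c)\<close>, which is transversal to the normalization. The proof is the additive version of \<open>scaling_unique\<close>.
\<close>

lemma scaling_kernel:
  assumes z: "indecomposable n (\<lambda>i j. 0 < v i j)" and v: "\<And>i j. i < n \<Longrightarrow> j < n \<Longrightarrow> 0 \<le> v i j"
    and xy: "approx_scaling n v 0 x y"
    and \<alpha>: "\<And>i. i < n \<Longrightarrow> \<alpha> i / (x i)\<^sup>2 + mv n v \<beta> i = 0"
    and \<beta>: "\<And>i. i < n \<Longrightarrow> \<beta> i / (y i)\<^sup>2 + mv n (flip v) \<alpha> i = 0"
    and sum: "sum \<alpha> {..<n} = sum \<beta> {..<n}" and i: "i < n"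
  shows "\<alpha> i = 0 \<and> \<beta> i = 0"
proof -
  define S where "S = (\<lambda>i j. x i * v i j * y j)"
  define f where "f i = \<alpha> i / x i" for i
  define g where "g i = \<beta> i / y i" for i
  note E = exact_scaling[OF xy]
  have S: "0 \<le> S i j" if "i < n" "j < n" for i j unfolding S_def using E(1,2) v that by (auto simp: less_imp_le)
  have row: "(\<Sum>j<n. S i j) = 1" and col: "(\<Sum>k<n. S k i) = 1" if "i < n" for i
    using E(5,6)[OF that] unfolding S_def by auto
  have row': "f i + (\<Sum>j<n. S i j * g j) = 0" if "i < n" for i
  proof -
    have "(\<Sum>j<n. S i j * g j) = x i * mv n v \<beta> i"
      unfolding mv_def sum_distrib_left
    proof (intro sum.cong refl)
      fix j assume "j \<in> {..<n}"
      then have "0 < y j" using E by auto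
      then show "S i j * g j = x i * (v i j * \<beta> j)" unfolding S_def g_def by (simp add: mult_ac)
    qed
    moreover have "x i * (\<alpha> i / (x i)\<^sup>2) = f i" unfolding f_def using E(1)[OF that] by (simp add: power2_eq_square)
    ultimately have "f i + (\<Sum>j<n. S i j * g j) = x i * (\<alpha> i / (x i)\<^sup>2 + mv n v \<beta> i)"
      by (simp add: distrib_left)
    then show ?thesis using \<alpha>[OF that] by simp
  qed
  have col': "g j + (\<Sum>i<n. S i j * f i) = 0" if "j < n" for j
  proof -
    have "(\<Sum>i<n. S i j * f i) = y j * mv n (flip v) \<alpha> j"
      unfolding mv_def flip_def sum_distrib_left
    proof (intro sum.cong refl)
      fix i assume "i \<in> {..<n}"
      then have "0 < x i" using E by auto
      then show "S i j * f i = y j * (v i j * \<alpha> i)" unfolding S_def f_def by (simp add: mult_ac)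
    qed
    moreover have "y j * (\<beta> j / (y j)\<^sup>2) = g j" unfolding g_def using E(2)[OF that] by (simp add: power2_eq_square)
    ultimately have "g j + (\<Sum>i<n. S i j * f i) = y j * (\<beta> j / (y j)\<^sup>2 + mv n (flip v) \<alpha> j)"
      by (simp add: distrib_left)
    then show ?thesis using \<beta>[OF that] by simp
  qed
  obtain m where m: "m < n" "\<And>i. i < n \<Longrightarrow> f i \<le> f m" using attains_max[of n f] i by auto
  define U where "U = f m"
  have g_ge: "0 \<le> g j + U" if "j < n" for j
  proof -
    have "(\<Sum>i<n. S i j * f i) \<le> (\<Sum>i<n. S i j * U)"
      using S that m unfolding U_def by (intro sum_mono mult_left_mono) auto
    also have "\<dots> = U" using col[OF that] by (simp add: sum_distrib_right[symmetric])
    finally show ?thesis using col'[OF that] by simp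
  qed
  have all: "U - f i = 0 \<and> g i + U = 0" if "i < n" for i
  proof (rule zero_propagates[where S = S and m = m])
    show "indecomposable n (\<lambda>i j. 0 < S i j)" unfolding S_def by (rule scaled_indecomposable[OF z xy])
    show "(\<Sum>j<n. S i j * (g j + U)) = 0" if "i < n" "U - f i = 0" for i
    proof -
      have "(\<Sum>j<n. S i j * (g j + U)) = (\<Sum>j<n. S i j * g j) + (\<Sum>j<n. S i j) * U"
        by (simp add: distrib_left sum.distrib sum_distrib_right[symmetric])
      then show ?thesis using row'[OF that(1)] row[OF that(1)] that by simp
    qed
    show "(\<Sum>i<n. S i j * (U - f i)) = 0" if "j < n" "g j + U = 0" for j
    proof -
      have "(\<Sum>i<n. S i j * (U - f i)) = (\<Sum>i<n. S i j) * U - (\<Sum>i<n. S i j * f i)"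
        by (simp add: right_diff_distrib sum_subtractf sum_distrib_right[symmetric])
      then show ?thesis using col'[OF that(1)] col[OF that(1)] that by simp
    qed
  qed (use S m g_ge that in \<open>auto simp: U_def\<close>)
  have ab: "\<alpha> i = U * x i" "\<beta> i = - U * y i" if "i < n" for i
    using all[OF that] E(1,2)[OF that] unfolding f_def g_def by (auto simp: field_simps)
  have s: "sum x {..<n} = sum y {..<n}" using xy unfolding approx_scaling_def by auto
  have "U * sum x {..<n} = - U * sum y {..<n}"
    using sum by (simp add: ab sum_distrib_left sum_negf)
  moreover have "0 < sum x {..<n}" using E(1) i by (intro sum_pos) auto
  ultimately have "U = 0" using s by (simp add: field_simps)
  then show ?thesis using ab i by simp
qed

section \<open>Convergence from boundedness and uniqueness of cluster points\<close>

lemma finite_bounded_subsequence: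
  fixes f :: "nat \<Rightarrow> 'b \<Rightarrow> real"
  assumes "finite A" "\<And>k i. i \<in> A \<Longrightarrow> \<bar>f k i\<bar> \<le> C"
  obtains \<rho> l where "strict_mono (\<rho> :: nat \<Rightarrow> nat)" "\<And>i. i \<in> A \<Longrightarrow> (\<lambda>k. f (\<rho> k) i) \<longlonglongrightarrow> l i"
proof -
  have "\<exists>\<rho> l. strict_mono (\<rho> :: nat \<Rightarrow> nat) \<and> (\<forall>i\<in>A. (\<lambda>k. f (\<rho> k) i) \<longlonglongrightarrow> l i)"
    using assms
  proof (induction A rule: finite_induct)
    case empty
    then show ?case using strict_mono_id by auto
  next
    case (insert a A)
    then obtain \<rho> l where \<rho>: "strict_mono (\<rho> :: nat \<Rightarrow> nat)" "\<forall>i\<in>A. (\<lambda>k. f (\<rho> k) i) \<longlonglongrightarrow> l i" by auto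
    have "bounded (range (\<lambda>k. f (\<rho> k) a))"
      unfolding bounded_iff using insert.prems by auto
    then obtain y \<rho>' where \<rho>': "strict_mono (\<rho>' :: nat \<Rightarrow> nat)" "((\<lambda>k. f (\<rho> k) a) \<circ> \<rho>') \<longlonglongrightarrow> y"
      using bounded_imp_convergent_subsequence by blast
    have "(\<lambda>k. f ((\<rho> \<circ> \<rho>') k) i) \<longlonglongrightarrow> (l(a := y)) i" if "i \<in> insert a A" for i
    proof (cases "i = a")
      case True
      then show ?thesis using \<rho>'(2) by (simp add: o_def)
    next
      case False
      then have "(\<lambda>k. f (\<rho> k) i) \<longlonglongrightarrow> l i" using \<rho> that by auto
      from LIMSEQ_subseq_LIMSEQ[OF this \<rho>'(1)] show ?thesis using False by (simp add: o_def)
    qed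
    moreover have "strict_mono (\<rho> \<circ> \<rho>')" using \<rho>(1) \<rho>'(1) by (rule strict_mono_o)
    ultimately show ?case by blast
  qed
  then show ?thesis using that by blast
qed

text \<open>
  The predicate \<open>P\<close> is a system of equations that all cluster points satisfy and that has at most one solution. The
  lemma also supplies the existence of a solution. It serves for the limits of \<open>q\<close> and \<open>r\<close> and for the
  derivative of \<open>q\<close>.
\<close>

lemma unique_cluster_imp_tendsto:
  fixes f :: "real \<Rightarrow> 'b \<Rightarrow> real"
  assumes A: "finite A" and nontriv: "at a within S \<noteq> bot"
    and bdd: "\<And>x i. x \<in> S - {a} \<Longrightarrow> i \<in> A \<Longrightarrow> \<bar>f x i\<bar> \<le> C"
    and cluster: "\<And>X l. (\<And>k. X k \<in> S - {a}) \<Longrightarrow> X \<longlonglongrightarrow> a \<Longrightarrow>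
        (\<And>i. i \<in> A \<Longrightarrow> (\<lambda>k. f (X k) i) \<longlonglongrightarrow> l i) \<Longrightarrow> P l"
    and unique: "\<And>l l' i. P l \<Longrightarrow> P l' \<Longrightarrow> i \<in> A \<Longrightarrow> l i = l' i"
  obtains l where "P l" "\<And>i. i \<in> A \<Longrightarrow> ((\<lambda>x. f x i) \<longlongrightarrow> l i) (at a within S)"
proof -
  have sub: "\<exists>\<rho> l. strict_mono (\<rho> :: nat \<Rightarrow> nat) \<and> P l \<and> (\<forall>i\<in>A. (\<lambda>k. f (X (\<rho> k)) i) \<longlonglongrightarrow> l i)"
    if X: "\<And>k. X k \<in> S - {a}" "X \<longlonglongrightarrow> a" for X
  proof -
    obtain \<rho> l where \<rho>: "strict_mono (\<rho> :: nat \<Rightarrow> nat)" "\<And>i. i \<in> A \<Longrightarrow> (\<lambda>k. f (X (\<rho> k)) i) \<longlonglongrightarrow> l i"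
      using finite_bounded_subsequence[OF A, of "\<lambda>k. f (X k)" C] bdd X(1) by blast
    have "P l"
      by (rule cluster[of "X \<circ> \<rho>"]) (use X \<rho> LIMSEQ_subseq_LIMSEQ[OF X(2) \<rho>(1)] in \<open>auto simp: o_def\<close>)
    then show ?thesis using \<rho> by blast
  qed
  have "a islimpt S" using nontriv by (simp add: trivial_limit_within)
  then obtain X0 where "\<forall>k. X0 k \<in> S - {a}" "X0 \<longlonglongrightarrow> a"
    unfolding islimpt_sequential by auto
  with sub obtain l where l: "P l" by blast
  have "((\<lambda>x. f x i) \<longlongrightarrow> l i) (at a within S)" if i: "i \<in> A" for i
    unfolding tendsto_at_iff_sequentially
  proof (intro allI impI)
    fix X assume X: "\<forall>k. X k \<in> S - {a}" "X \<longlonglongrightarrow> a"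
    show "((\<lambda>x. f x i) \<circ> X) \<longlonglongrightarrow> l i"
    proof (rule ccontr)
      assume "\<not> ?thesis"
      then obtain e where e: "0 < e" "\<not> (\<forall>\<^sub>F k in sequentially. dist (f (X k) i) (l i) < e)"
        unfolding tendsto_iff by auto
      define B where "B = {k. e \<le> dist (f (X k) i) (l i)}"
      have "infinite B"
        using e(2) unfolding B_def eventually_cofinite[symmetric] cofinite_eq_sequentially[symmetric]
        by (simp add: eventually_cofinite not_less)
      then obtain r where r: "strict_mono (r :: nat \<Rightarrow> nat)" "\<forall>k. r k \<in> B" using infinite_enumerate by blast
      have "\<And>k. (X \<circ> r) k \<in> S - {a}" "(X \<circ> r) \<longlonglongrightarrow> a"
        using X LIMSEQ_subseq_LIMSEQ[OF X(2) r(1)] by (auto simp: o_def)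
      from sub[OF this] obtain \<rho> l' where \<rho>: "strict_mono (\<rho> :: nat \<Rightarrow> nat)" "P l'"
        "\<forall>i\<in>A. (\<lambda>k. f ((X \<circ> r) (\<rho> k)) i) \<longlonglongrightarrow> l' i" by blast
      have "l' i = l i" using unique \<rho>(2) l i by blast
      then have "(\<lambda>k. f (X (r (\<rho> k))) i) \<longlonglongrightarrow> l i" using \<rho>(3) i by auto
      then have "\<forall>\<^sub>F k in sequentially. dist (f (X (r (\<rho> k))) i) (l i) < e"
        using e(1) by (auto simp: tendsto_iff)
      then obtain k where "dist (f (X (r (\<rho> k))) i) (l i) < e"
        by (auto simp: eventually_sequentially)
      then show False using r(2) unfolding B_def by (metis mem_Collect_eq not_less)
    qed
  qed
  then show ?thesis using that l by blast
qed

lemma scaling_limit: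
  fixes q q' :: "real \<Rightarrow> nat \<Rightarrow> real"
  assumes z: "indecomposable n (\<lambda>i j. 0 < v i j)" and v: "\<And>i j. i < n \<Longrightarrow> j < n \<Longrightarrow> 0 \<le> v i j"
    and nontriv: "at a within S \<noteq> bot" and c: "0 < c"
    and bd: "\<And>s i. s \<in> S \<Longrightarrow> i < n \<Longrightarrow> c \<le> q s i \<and> q s i \<le> U \<and> c \<le> q' s i \<and> q' s i \<le> U"
    and lim: "\<And>i. i < n \<Longrightarrow> ((\<lambda>s. q s i * mv n v (q' s) i) \<longlongrightarrow> 1) (at a within S)"
    and lim': "\<And>i. i < n \<Longrightarrow> ((\<lambda>s. q' s i * mv n (flip v) (q s) i) \<longlongrightarrow> 1) (at a within S)"
    and sum: "\<And>s. s \<in> S \<Longrightarrow> sum (q s) {..<n} = sum (q' s) {..<n}"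
  obtains Q Q' where "approx_scaling n v 0 Q Q'"
    "\<And>i. i < n \<Longrightarrow> ((\<lambda>s. q s i) \<longlongrightarrow> Q i) (at a within S)"
    "\<And>i. i < n \<Longrightarrow> ((\<lambda>s. q' s i) \<longlongrightarrow> Q' i) (at a within S)"
proof -
  define A where "A = Inl ` {..<n} \<union> Inr ` {..<n}"
  define f where "f s = case_sum (q s) (q' s)" for s
  define P where "P l = approx_scaling n v 0 (\<lambda>i. l (Inl i)) (\<lambda>i. l (Inr i))" for l
  have A: "finite A" "\<And>i. i < n \<Longrightarrow> Inl i \<in> A" "\<And>i. i < n \<Longrightarrow> Inr i \<in> A" unfolding A_def by auto
  have "\<exists>l. P l \<and> (\<forall>i\<in>A. ((\<lambda>x. f x i) \<longlongrightarrow> l i) (at a within S))"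
  proof (rule unique_cluster_imp_tendsto[OF A(1) nontriv, of f U P])
    show "\<bar>f x i\<bar> \<le> U" if xi: "x \<in> S - {a}" "i \<in> A" for x i
    proof -
      have "\<bar>q x j\<bar> \<le> U" "\<bar>q' x j\<bar> \<le> U" if "j < n" for j
        using bd[of x j] xi that c by auto
      then show ?thesis using xi unfolding A_def f_def by auto
    qed
    show "l i = l' i" if "P l" "P l'" "i \<in> A" for l l' i
      using that scaling_unique[OF z v that(1,2)[unfolded P_def]] unfolding A_def by auto
    show "P l" if X: "\<And>k. X k \<in> S - {a}" "X \<longlonglongrightarrow> a"
      and L: "\<And>i. i \<in> A \<Longrightarrow> (\<lambda>k. f (X k) i) \<longlonglongrightarrow> l i" for X l
    proof -
      have L1: "(\<lambda>k. q (X k) i) \<longlonglongrightarrow> l (Inl i)" and L2: "(\<lambda>k. q' (X k) i) \<longlonglongrightarrow> l (Inr i)"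
        if "i < n" for i
        using L[OF A(2)[OF that]] L[OF A(3)[OF that]] unfolding f_def by auto
      have F: "filterlim X (at a within S) sequentially"
        using X by (auto simp: filterlim_at eventually_sequentially)
      have M1: "(\<lambda>k. q (X k) i * mv n v (q' (X k)) i) \<longlonglongrightarrow> l (Inl i) * mv n v (\<lambda>i. l (Inr i)) i" if "i < n" for i
        unfolding mv_def by (intro tendsto_intros L1 L2 that) auto
      have M2: "(\<lambda>k. q' (X k) i * mv n (flip v) (q (X k)) i) \<longlonglongrightarrow> l (Inr i) * mv n (flip v) (\<lambda>i. l (Inl i)) i" if "i < n" for i
        unfolding mv_def by (intro tendsto_intros L1 L2 that) auto
      have one: "l (Inl i) * mv n v (\<lambda>i. l (Inr i)) i = 1" if "i < n" for i
        using LIMSEQ_unique[OF M1[OF that] filterlim_compose[OF lim[OF that] F]] by simp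
      have one': "l (Inr i) * mv n (flip v) (\<lambda>i. l (Inl i)) i = 1" if "i < n" for i
        using LIMSEQ_unique[OF M2[OF that] filterlim_compose[OF lim'[OF that] F]] by simp
      have "c \<le> l (Inl i)" "c \<le> l (Inr i)" if "i < n" for i
        using LIMSEQ_le_const[OF L1[OF that]] LIMSEQ_le_const[OF L2[OF that]] bd X that by blast+
      then have pos: "0 < l (Inl i)" "0 < l (Inr i)" if "i < n" for i using c that by force+
      have "(\<lambda>k. sum (q (X k)) {..<n}) \<longlonglongrightarrow> (\<Sum>i<n. l (Inl i))"
        by (intro tendsto_intros L1) auto
      moreover have "(\<lambda>k. sum (q' (X k)) {..<n}) \<longlonglongrightarrow> (\<Sum>i<n. l (Inr i))"
        by (intro tendsto_intros L2) auto
      moreover have "sum (q (X k)) {..<n} = sum (q' (X k)) {..<n}" for k using sum X by auto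
      ultimately have "(\<Sum>i<n. l (Inl i)) = (\<Sum>i<n. l (Inr i))" using LIMSEQ_unique by auto
      then show ?thesis unfolding P_def approx_scaling_def using one one' pos by auto
    qed
  qed blast
  then obtain l where l: "P l" "\<And>i. i \<in> A \<Longrightarrow> ((\<lambda>x. f x i) \<longlongrightarrow> l i) (at a within S)" by blast
  show ?thesis
    by (rule that[OF l(1)[unfolded P_def]]) (use l(2)[OF A(2)] l(2)[OF A(3)] in \<open>auto simp: f_def\<close>)
qed

section \<open>Solutions are approximate scalings\<close>

text \<open>
  Positive solutions of the Master Equations in terms of \<open>u = s\<^sup>2\<close>, with the denominators cleared.
\<close>

definition master_sol ::
    "nat \<Rightarrow> (nat \<Rightarrow> nat \<Rightarrow> real) \<Rightarrow> real \<Rightarrow> (nat \<Rightarrow> real) \<Rightarrow> (nat \<Rightarrow> real) \<Rightarrow> bool" where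
  "master_sol n v u q q' \<longleftrightarrow>
     (\<forall>i<n. 0 < q i \<and> 0 < q' i \<and>
        q i * (u + mv n v q' i * mv n (flip v) q i) = mv n (flip v) q i \<and>
        q' i * (u + mv n v q' i * mv n (flip v) q i) = mv n v q' i) \<and>
     sum q {..<n} = sum q' {..<n}"

lemma master_sol_transpose: "master_sol n v u q q' \<Longrightarrow> master_sol n (flip v) u q' q"
  unfolding master_sol_def by (auto simp: mult.commute)

lemma master_sol_facts:
  assumes ms: "master_sol n v u q q'" and v: "\<forall>i<n. \<forall>j<n. 0 \<le> v i j" and u: "0 < u" and i: "i < n"
  shows "0 < q i" "0 < q' i" "0 < mv n v q' i" "0 < mv n (flip v) q i"
    "q i * mv n v q' i = q' i * mv n (flip v) q i" "q i * mv n v q' i \<le> 1"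
    "u * q' i = mv n v q' i * (1 - q i * mv n v q' i)"
    "1 / q i = u / mv n (flip v) q i + mv n v q' i"
    "1 / q' i = u / mv n v q' i + mv n (flip v) q i"
proof -
  define a where "a = mv n (flip v) q i"
  define b where "b = mv n v q' i"
  have e: "0 < q i" "0 < q' i" "q i * (u + b * a) = a" "q' i * (u + b * a) = b"
    using ms i unfolding master_sol_def a_def b_def by auto
  have nonneg: "0 \<le> q j" "0 \<le> q' j" if "j < n" for j using ms that unfolding master_sol_def by (auto intro: less_imp_le)
  have ab0: "0 \<le> a" "0 \<le> b" unfolding a_def b_def using nonneg v i
    by (auto intro!: mv_nonneg simp: flip_def)
  have pos: "0 < u + b * a" using ab0 u by (intro add_pos_nonneg) auto
  have ab: "0 < a" "0 < b" using e pos by (metis mult_pos_pos)+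
  show "0 < q i" "0 < q' i" by (fact e)+
  show "0 < mv n v q' i" "0 < mv n (flip v) q i" using ab unfolding a_def b_def by auto
  have q: "q i = a / (u + b * a)" "q' i = b / (u + b * a)" using e pos by (auto simp: eq_divide_eq)
  show "q i * mv n v q' i = q' i * mv n (flip v) q i" unfolding q a_def[symmetric] b_def[symmetric] by simp
  show "q i * mv n v q' i \<le> 1" unfolding q b_def[symmetric] using pos u by (simp add: divide_le_eq mult.commute)
  show "u * q' i = mv n v q' i * (1 - q i * mv n v q' i)"
    unfolding q b_def[symmetric] using pos by (simp add: field_simps)
  show "1 / q i = u / mv n (flip v) q i + mv n v q' i"
    unfolding q a_def[symmetric] b_def[symmetric] using pos ab by (simp add: field_simps)
  show "1 / q' i = u / mv n v q' i + mv n (flip v) q i"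
    unfolding q a_def[symmetric] b_def[symmetric] using pos ab by (simp add: field_simps)
qed

lemma scaled_row_col_sums:
  "(\<Sum>j<n. x i * v i j * y j) = x i * mv n v y i"
  "(\<Sum>i<n. x i * v i j * y j) = y j * mv n (flip v) x j"
  unfolding mv_def flip_def by (simp_all add: sum_distrib_left mult_ac)

text \<open>
  Why a nonzero solution cannot stay away from the scaling problem when \<open>u\<close> is small. The
  gap argument is run with \<open>g = 1 / b\<close> and \<open>h = q'\<close>, where \<open>b = mv n v q'\<close>. The sums of row \<open>k\<close> and of column \<open>k\<close> are both
  \<open>p k = q k * b k\<close>, and \<open>1 - p k = u * q' k / b k\<close>. So a column with \<open>q' k \<le> C / \<theta>\<close> that is far from full has
  \<open>b k\<close> of order \<open>u / \<theta>\<close>, which is less than \<open>1 / \<theta>\<close>; its row then belongs to \<open>I\<close>, as the second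
  alternative of \<open>indecomposable_no_gap\<close> demands. Hence all entries of \<open>b\<close> are comparable. Since \<open>q'\<close> is
  bounded by a multiple of the entries of \<open>b\<close>, the identity for \<open>1 - p k\<close> gives the claim.
\<close>

lemma master_near_scaling:
  assumes z: "indecomposable n (\<lambda>i j. 0 < v i j)" and n: "0 < n" and B: "0 < B" and \<beta>: "0 < \<beta>"
    and v: "\<And>i j. i < n \<Longrightarrow> j < n \<Longrightarrow> 0 \<le> v i j \<and> v i j \<le> B"
    and v\<beta>: "\<And>i j. i < n \<Longrightarrow> j < n \<Longrightarrow> 0 < v i j \<Longrightarrow> \<beta> \<le> v i j"
  obtains L where "0 < L"
    "\<And>u q q' i. 0 < u \<Longrightarrow> u * L \<le> 1 \<Longrightarrow> master_sol n v u q q' \<Longrightarrow> i < n \<Longrightarrow> 1 - L * u \<le> q i * mv n v q' i"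
proof -
  define C where "C = B + 1 / \<beta>"
  define M where "M = 4 * (real n)\<^sup>2 * C\<^sup>2 + 1"
  define L where "L = M ^ n / \<beta> + 4 * n * C"
  have C: "0 < C" "B \<le> C" "1 / \<beta> \<le> C" unfolding C_def using B \<beta> by (auto intro: add_pos_pos)
  have M: "1 \<le> M" unfolding M_def by simp
  have Mn: "0 < M ^ n" using M by simp
  have L: "0 < L" "M ^ n / \<beta> \<le> L" "4 * n * C \<le> L" unfolding L_def using Mn \<beta> C
    by (auto intro: add_pos_nonneg)
  have "1 - L * u \<le> q j * mv n v q' j"
    if u: "0 < u" "u * L \<le> 1" and ms: "master_sol n v u q q'" and j: "j < n" for u q q' j
  proof -
    have v0: "\<forall>i<n. \<forall>j<n. 0 \<le> v i j" using v by blast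
    note F = master_sol_facts[OF ms v0 u(1)]
    define b where "b = mv n v q'"
    define g where "g i = 1 / b i" for i
    have b: "0 < b i" "q i * b i \<le> 1" if "i < n" for i using F(3,6)[OF that] unfolding b_def by auto
    have q_le: "q i \<le> g i" if "i < n" for i
      using b[OF that] unfolding g_def by (simp add: le_divide_eq)
    have q'_le: "\<beta> * q' k \<le> b i" if "i < n" "k < n" "0 < v i k" for i k
    proof -
      have "\<beta> * q' k \<le> v i k * q' k" using v\<beta> that F(2)[OF that(2)] by (intro mult_right_mono) auto
      also have "\<dots> \<le> b i" unfolding b_def using that v F(2) by (intro mv_member) (auto simp: less_imp_le)
      finally show ?thesis .
    qed
    obtain m where m: "m < n" "\<And>i. i < n \<Longrightarrow> g i \<le> g m" using attains_max[OF n, of g] by auto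
    have fl: "g m \<le> M ^ n * g i" if i: "i < n" for i
    proof (rule indecomposable_flat[where z = "\<lambda>i j. 0 < v i j" and C = C and h = q' and T = "\<lambda>i j. q i * v i j * q' j"])
      show "indecomposable n (\<lambda>i j. 0 < v i j)" by (fact z)
      show "4 * (real n)\<^sup>2 * C\<^sup>2 \<le> M" unfolding M_def by simp
      show "0 < g i" if "i < n" for i unfolding g_def using b that by simp
      show "0 \<le> q i * v i k * q' k" if "i < n" "k < n" for i k
        using F(1)[OF that(1)] F(2)[OF that(2)] v[OF that] by simp
      show "q i * v i k * q' k \<le> C * g i * q' k" if "i < n" "k < n" for i k
      proof -
        have "q i * v i k \<le> g i * C"
          using q_le[OF that(1)] v[OF that] C F(1)[OF that(1)] b(1)[OF that(1)]
          by (intro mult_mono) (auto simp: g_def)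
        then have "q i * v i k * q' k \<le> g i * C * q' k"
          using F(2)[OF that(2)] by (intro mult_right_mono) auto
        then show ?thesis by (simp add: mult_ac)
      qed
      show "g i * q' k \<le> C" if "i < n" "k < n" "0 < v i k" for i k
      proof -
        have "g i * q' k \<le> 1 / \<beta>" using q'_le[OF that] b[OF that(1)] \<beta> unfolding g_def
          by (simp add: field_simps)
        then show ?thesis using C by simp
      qed
      show "(\<Sum>k<n. q i * v i k * q' k) \<le> 1" if "i < n" for i
        unfolding scaled_row_col_sums using F(6)[OF that] .
      show "1 - 1 / (4 * real n) \<le> (\<Sum>i<n. q i * v i k * q' k) \<or>
         \<theta> \<le> g k \<and> (\<Sum>i<n. q k * v k i * q' i) \<le> (\<Sum>i<n. q i * v i k * q' k)"
        if k: "k < n" "g m / M ^ n \<le> \<theta>" "q' k \<le> C / \<theta>" for k \<theta>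
      proof -
        have "0 < g m / M ^ n" unfolding g_def using Mn b m by simp
        then have \<theta>: "0 < \<theta>" using k by linarith
        show ?thesis
        proof (cases "\<theta> \<le> g k")
          case True
          then show ?thesis unfolding scaled_row_col_sums using F(5)[OF k(1)] by simp
        next
          case False
          have "u * q' k = b k * (1 - q k * b k)" using F(7)[OF k(1)] unfolding b_def .
          then have "1 - q k * b k = u * (q' k * g k)" using b[OF k(1)] unfolding g_def by (simp add: field_simps)
          also have "\<dots> \<le> u * (C / \<theta> * \<theta>)"
            using False k u F(2)[OF k(1)] b(1)[OF k(1)] C \<theta> by (intro mult_left_mono mult_mono) (auto simp: g_def)
          also have "\<dots> = u * C" using \<theta> by simp
          also have "\<dots> \<le> 1 / (4 * n)"
          proof -
            have "u * (4 * n * C) \<le> u * L" using L(3) u by (intro mult_left_mono) auto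
            then have "u * (4 * n * C) \<le> 1" using u by linarith
            then have "4 * n * (u * C) \<le> 1" by (simp add: mult_ac)
            then show ?thesis using n by (simp add: le_divide_eq mult.commute)
          qed
          finally show ?thesis unfolding scaled_row_col_sums b_def using F(5)[OF k(1)] by simp
        qed
      qed
    qed (use C M F m i in auto)
    obtain k where k: "k < n" "0 < v k j" using indecomposable_row[OF indecomposable_transpose[OF z] j] unfolding flip_def by blast
    have "\<beta> * q' j \<le> b k" by (rule q'_le[OF k(1) j k(2)])
    also have "\<dots> \<le> M ^ n * b j"
    proof -
      have "g j \<le> g m" "g m \<le> M ^ n * g k" using m(2)[OF j] fl[OF k(1)] by auto
      then have "1 / b j \<le> M ^ n / b k" unfolding g_def by simp
      then show ?thesis using b(1)[OF j] b(1)[OF k(1)] by (simp add: field_simps)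
    qed
    finally have q': "q' j \<le> M ^ n / \<beta> * b j" using \<beta> by (simp add: field_simps)
    have "b j * (1 - q j * b j) = u * q' j" using F(7)[OF j] unfolding b_def by simp
    also have "\<dots> \<le> u * (M ^ n / \<beta> * b j)" using q' u by (intro mult_left_mono) auto
    also have "\<dots> \<le> u * (L * b j)" using L u b(1)[OF j] by (intro mult_left_mono mult_right_mono) auto
    also have "\<dots> = b j * (L * u)" by simp
    finally have "1 - q j * b j \<le> L * u" using b(1)[OF j] by simp
    then show ?thesis unfolding b_def by simp
  qed
  then show ?thesis using that L(1) by blast
qed

definition regularized_sol ::
    "nat \<Rightarrow> (nat \<Rightarrow> nat \<Rightarrow> real) \<Rightarrow> real \<Rightarrow> (nat \<Rightarrow> real) \<Rightarrow> (nat \<Rightarrow> real) \<Rightarrow> bool" where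
  "regularized_sol n v t r r' \<longleftrightarrow>
     (\<forall>i<n. 0 < r i \<and> 0 < r' i \<and> r i * (mv n v r' i + t) = 1 \<and> r' i * (mv n (flip v) r i + t) = 1)"

lemma regularized_sol_transpose: "regularized_sol n v t r r' \<Longrightarrow> regularized_sol n (flip v) t r' r"
  unfolding regularized_sol_def by auto

text \<open>
  For \<open>t > 0\<close> the normalization is a consequence of the regularized equations: summing them gives \<open>n\<close> on both sides.
\<close>

lemma regularized_sol_sum:
  assumes "regularized_sol n v t r r'" "0 < t"
  shows "sum r {..<n} = sum r' {..<n}"
proof -
  have "(\<Sum>i<n. r i * mv n v r' i) + t * sum r {..<n} = (\<Sum>i<n. r i * (mv n v r' i + t))"
    by (simp add: distrib_left sum.distrib sum_distrib_left mult.commute)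
  also have "\<dots> = real n" using assms unfolding regularized_sol_def by simp
  also have "\<dots> = (\<Sum>i<n. r' i * (mv n (flip v) r i + t))" using assms unfolding regularized_sol_def by simp
  also have "\<dots> = (\<Sum>i<n. r' i * mv n (flip v) r i) + t * sum r' {..<n}"
    by (simp add: distrib_left sum.distrib sum_distrib_left mult.commute)
  finally show ?thesis using assms(2) mv_swap[of r n v r'] by simp
qed

text \<open>
  The column sums are \<open>1 - t * r' k\<close>. The gap argument is run with \<open>g = r\<close> and \<open>h = r'\<close>; it needs them to be close to 1
  only for \<open>r' k \<le> C / \<theta>\<close>, with \<open>\<theta>\<close> within a constant factor of the largest entry of \<open>r\<close>. As that entry is bounded below
  by \<open>\<gamma>\<close>, this holds for small \<open>t\<close>. So all entries of \<open>r\<close> are bounded below, and those of \<open>r'\<close> are bounded above. The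
  same bound for \<open>r\<close> follows by transposition.
\<close>

lemma regularized_bounded_above:
  assumes z: "indecomposable n (\<lambda>i j. 0 < v i j)" and n: "0 < n" and B: "0 < B" and \<beta>: "0 < \<beta>"
    and v: "\<And>i j. i < n \<Longrightarrow> j < n \<Longrightarrow> 0 \<le> v i j \<and> v i j \<le> B"
    and v\<beta>: "\<And>i j. i < n \<Longrightarrow> j < n \<Longrightarrow> 0 < v i j \<Longrightarrow> \<beta> \<le> v i j"
  obtains L where "0 < L"
    "\<And>t r r' i. 0 < t \<Longrightarrow> t * L \<le> 1 \<Longrightarrow> regularized_sol n v t r r' \<Longrightarrow> i < n \<Longrightarrow> r' i \<le> L"
proof -
  define C where "C = B + 1 / \<beta>"
  define M where "M = 4 * (real n)\<^sup>2 * C\<^sup>2 + 1"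
  define \<gamma> where "\<gamma> = 1 / (B * n + 1)"
  define L where "L = 1 + 4 * n * (C * M ^ n / \<gamma>) + M ^ n / (\<beta> * \<gamma>)"
  have C: "0 < C" "B \<le> C" "1 / \<beta> \<le> C" unfolding C_def using B \<beta> by (auto intro: add_pos_pos)
  have M: "1 \<le> M" unfolding M_def by simp
  have Mn: "0 < M ^ n" using M by simp
  have Bn: "0 < B * n + 1" using B by (intro add_nonneg_pos) auto
  have \<gamma>: "0 < \<gamma>" "\<gamma> \<le> 1" unfolding \<gamma>_def using Bn B by auto
  have terms: "0 < 4 * n * (C * M ^ n / \<gamma>)" "0 < M ^ n / (\<beta> * \<gamma>)"
    using n C Mn \<gamma> \<beta> by auto
  then have L: "1 \<le> L" "4 * n * (C * M ^ n / \<gamma>) \<le> L" "M ^ n / (\<beta> * \<gamma>) \<le> L"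
    unfolding L_def by linarith+
  have "r' j \<le> L"
    if t: "0 < t" "t * L \<le> 1" and rs: "regularized_sol n v t r r'" and j: "j < n" for t r r' j
  proof -
    have R: "0 < r i" "0 < r' i" "r i * (mv n v r' i + t) = 1" "r' i * (mv n (flip v) r i + t) = 1"
      if "i < n" for i using rs that unfolding regularized_sol_def by auto
    have row: "r i * mv n v r' i = 1 - t * r i" and col: "r' i * mv n (flip v) r i = 1 - t * r' i"
      if "i < n" for i using R(3,4)[OF that] by (simp_all add: algebra_simps)
    have "t * 1 \<le> t * L" using t L(1) by (intro mult_left_mono) auto
    then have t1: "t \<le> 1" using t by linarith
    have prod_le: "\<beta> * (r i * r' k) \<le> 1" if "i < n" "k < n" "0 < v i k" for i k
    proof -
      have "\<beta> * (r i * r' k) \<le> v i k * (r i * r' k)"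
        using v\<beta>[OF that] R(1)[OF that(1)] R(2)[OF that(2)] by (intro mult_right_mono) auto
      also have "\<dots> = r i * (v i k * r' k)" by simp
      also have "\<dots> \<le> r i * mv n v r' i"
        using that v R(2) R(1)[OF that(1)] by (intro mult_left_mono mv_member) (auto simp: less_imp_le)
      also have "\<dots> \<le> 1" using row[OF that(1)] t R(1)[OF that(1)] by simp
      finally show ?thesis .
    qed
    obtain m where m: "m < n" "\<And>i. i < n \<Longrightarrow> r i \<le> r m" using attains_max[OF n, of r] by auto
    have rm: "\<gamma> \<le> r m"
    proof (rule ccontr)
      assume "\<not> ?thesis"
      then have lt: "r m < \<gamma>" by simp
      have "mv n v r' m \<le> (\<Sum>k<n. B * r' k)"
        unfolding mv_def using v R(2) m by (intro sum_mono mult_right_mono) (auto simp: less_imp_le)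
      also have "\<dots> = B * sum r {..<n}" using regularized_sol_sum[OF rs t(1)] by (simp add: sum_distrib_left)
      also have "\<dots> \<le> B * (n * r m)" using sum_bounded_above[of "{..<n}" r "r m"] m B
        by (intro mult_left_mono) auto
      also have "\<dots> \<le> B * (real n * 1)" using lt \<gamma> B by (intro mult_left_mono) auto
      finally have "mv n v r' m + t \<le> B * n + 1" using t1 by simp
      then have "r m * (mv n v r' m + t) \<le> r m * (B * n + 1)" using R(1)[OF m(1)] by (intro mult_left_mono) auto
      also have "\<dots> < \<gamma> * (B * n + 1)" using lt Bn by (intro mult_strict_right_mono) auto
      also have "\<dots> = 1" unfolding \<gamma>_def using Bn by simp
      finally show False using R(3)[OF m(1)] by simp
    qed
    have fl: "r m \<le> M ^ n * r i" if i: "i < n" for i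
    proof (rule indecomposable_flat[where z = "\<lambda>i j. 0 < v i j" and C = C and h = r' and T = "\<lambda>i j. r i * v i j * r' j"])
      show "indecomposable n (\<lambda>i j. 0 < v i j)" by (fact z)
      show "4 * (real n)\<^sup>2 * C\<^sup>2 \<le> M" unfolding M_def by simp
      show "0 \<le> r i * v i k * r' k" if "i < n" "k < n" for i k
        using R(1)[OF that(1)] R(2)[OF that(2)] v[OF that] by simp
      show "r i * v i k * r' k \<le> C * r i * r' k" if "i < n" "k < n" for i k
        using v[OF that] C R(1)[OF that(1)] R(2)[OF that(2)]
        by (subst mult.commute[of C]) (intro mult_right_mono mult_left_mono, auto)
      show "r i * r' k \<le> C" if "i < n" "k < n" "0 < v i k" for i k
      proof -
        have "r i * r' k \<le> 1 / \<beta>" using prod_le[OF that] \<beta> by (simp add: field_simps)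
        then show ?thesis using C by simp
      qed
      show "(\<Sum>k<n. r i * v i k * r' k) \<le> 1" if "i < n" for i
        unfolding scaled_row_col_sums using row[OF that] t R(1)[OF that] by simp
      show "1 - 1 / (4 * real n) \<le> (\<Sum>i<n. r i * v i k * r' k) \<or>
         \<theta> \<le> r k \<and> (\<Sum>i<n. r k * v k i * r' i) \<le> (\<Sum>i<n. r i * v i k * r' k)"
        if k: "k < n" "r m / M ^ n \<le> \<theta>" "r' k \<le> C / \<theta>" for k \<theta>
      proof -
        have "\<gamma> / M ^ n \<le> r m / M ^ n" using rm Mn by (intro divide_right_mono) auto
        then have \<theta>: "\<gamma> / M ^ n \<le> \<theta>" using k by linarith
        have "r' k \<le> C / \<theta>" by (fact k)
        also have "\<dots> \<le> C / (\<gamma> / M ^ n)"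
          using \<theta> C \<gamma> Mn by (intro frac_le) auto
        finally have "t * r' k \<le> t * (C * M ^ n / \<gamma>)" using t by (intro mult_left_mono) auto
        also have "\<dots> \<le> 1 / (4 * n)"
        proof -
          have "t * (4 * n * (C * M ^ n / \<gamma>)) \<le> t * L" using L(2) t by (intro mult_left_mono) auto
          then have "t * (4 * n * (C * M ^ n / \<gamma>)) \<le> 1" using t by linarith
          then have "4 * n * (t * (C * M ^ n / \<gamma>)) \<le> 1" by (simp add: mult_ac)
          then show ?thesis using n by (simp add: le_divide_eq mult.commute)
        qed
        finally show ?thesis unfolding scaled_row_col_sums using col[OF k(1)] by simp
      qed
    qed (use C M R m i in auto)
    obtain k where k: "k < n" "0 < v k j" using indecomposable_row[OF indecomposable_transpose[OF z] j] unfolding flip_def by blast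
    have "\<gamma> \<le> M ^ n * r k" using rm fl[OF k(1)] by simp
    then have "\<gamma> * (\<beta> * r' j) \<le> M ^ n * r k * (\<beta> * r' j)"
      using \<beta> R(2)[OF j] by (intro mult_right_mono) auto
    also have "\<dots> = M ^ n * (\<beta> * (r k * r' j))" by simp
    also have "\<dots> \<le> M ^ n * 1" using prod_le[OF k(1) j k(2)] Mn by (intro mult_left_mono) auto
    finally have "r' j \<le> M ^ n / (\<beta> * \<gamma>)" using \<beta> \<gamma> by (simp add: field_simps)
    then show ?thesis using L by simp
  qed
  then show ?thesis using that[of L] L(1) by simp
qed

section \<open>Stability of the linearized equations\<close>

lemma mv_diff: "mv n v (\<lambda>i. x i - y i) i = mv n v x i - mv n v y i"
  unfolding mv_def by (simp add: right_diff_distrib sum_subtractf)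

lemma mv_scale: "mv n v (\<lambda>i. x i / c) i = mv n v x i / c"
  unfolding mv_def by (simp add: sum_divide_distrib)

lemma mv_abs_le:
  assumes "\<And>j. j < n \<Longrightarrow> \<bar>x j\<bar> \<le> m" "i < n" "0 \<le> m"
  shows "\<bar>mv n v x i\<bar> \<le> (\<Sum>i<n. \<Sum>j<n. \<bar>v i j\<bar>) * m"
proof -
  have "\<bar>mv n v x i\<bar> \<le> (\<Sum>j<n. \<bar>v i j\<bar> * m)"
    unfolding mv_def using assms
    by (intro order_trans[OF sum_abs] sum_mono) (auto simp: abs_mult intro: mult_left_mono)
  also have "\<dots> = (\<Sum>j<n. \<bar>v i j\<bar>) * m" by (simp add: sum_distrib_right)
  also have "\<dots> \<le> (\<Sum>i<n. \<Sum>j<n. \<bar>v i j\<bar>) * m"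
    using assms by (intro mult_right_mono member_le_sum) (auto intro: sum_nonneg)
  finally show ?thesis .
qed

text \<open>
  Injectivity on a finite-dimensional space gives a lower bound, by compactness of the unit sphere.
\<close>

lemma scaling_operator_bounded_below:
  assumes z: "indecomposable n (\<lambda>i j. 0 < v i j)" and n: "0 < n" and v: "\<And>i j. i < n \<Longrightarrow> j < n \<Longrightarrow> 0 \<le> v i j"
    and xy: "approx_scaling n v 0 x y"
  obtains C where "0 < C"
    "\<And>\<alpha> \<beta> \<gamma> i. (\<And>i. i < n \<Longrightarrow> \<bar>\<alpha> i / (x i)\<^sup>2 + mv n v \<beta> i\<bar> \<le> \<gamma>) \<Longrightarrow>
       (\<And>i. i < n \<Longrightarrow> \<bar>\<beta> i / (y i)\<^sup>2 + mv n (flip v) \<alpha> i\<bar> \<le> \<gamma>) \<Longrightarrow>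
       sum \<alpha> {..<n} = sum \<beta> {..<n} \<Longrightarrow> i < n \<Longrightarrow> \<bar>\<alpha> i\<bar> \<le> C * \<gamma> \<and> \<bar>\<beta> i\<bar> \<le> C * \<gamma>"
proof -
  define R where "R \<alpha> \<beta> \<gamma> \<longleftrightarrow> (\<forall>i<n. \<bar>\<alpha> i / (x i)\<^sup>2 + mv n v \<beta> i\<bar> \<le> \<gamma> \<and>
      \<bar>\<beta> i / (y i)\<^sup>2 + mv n (flip v) \<alpha> i\<bar> \<le> \<gamma>) \<and> sum \<alpha> {..<n} = sum \<beta> {..<n}" for \<alpha> \<beta> \<gamma>
  have "\<exists>k::nat. \<forall>\<alpha> \<beta> \<gamma>. R \<alpha> \<beta> \<gamma> \<longrightarrow> (\<forall>i<n. \<bar>\<alpha> i\<bar> \<le> real (Suc k) * \<gamma> \<and> \<bar>\<beta> i\<bar> \<le> real (Suc k) * \<gamma>)"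
  proof (rule ccontr)
    assume neg: "\<not> ?thesis"
    have "\<exists>\<alpha> \<beta>. R \<alpha> \<beta> (1 / real (Suc k)) \<and> (\<Sum>i<n. \<bar>\<alpha> i\<bar>) + (\<Sum>i<n. \<bar>\<beta> i\<bar>) = 1" for k
    proof -
      obtain \<alpha> \<beta> \<gamma> i where R: "R \<alpha> \<beta> \<gamma>" and i: "i < n"
        and big: "real (Suc k) * \<gamma> < \<bar>\<alpha> i\<bar> \<or> real (Suc k) * \<gamma> < \<bar>\<beta> i\<bar>"
        using neg by (meson not_le)
      \<comment> \<open>Violations of the estimate with factor \<open>Suc k\<close>, normalized, have residuals at most \<open>1 / Suc k\<close>.\<close>
      define N where "N = (\<Sum>i<n. \<bar>\<alpha> i\<bar>) + (\<Sum>i<n. \<bar>\<beta> i\<bar>)"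
      have "\<bar>\<alpha> i / (x i)\<^sup>2 + mv n v \<beta> i\<bar> \<le> \<gamma>" using R i unfolding R_def by blast
      then have \<gamma>: "0 \<le> \<gamma>" by linarith
      have "\<bar>\<alpha> i\<bar> \<le> (\<Sum>i<n. \<bar>\<alpha> i\<bar>)" "\<bar>\<beta> i\<bar> \<le> (\<Sum>i<n. \<bar>\<beta> i\<bar>)"
        using member_le_sum[of i "{..<n}" "\<lambda>i. \<bar>\<alpha> i\<bar>"] member_le_sum[of i "{..<n}" "\<lambda>i. \<bar>\<beta> i\<bar>"] i by auto
      moreover have "0 \<le> (\<Sum>i<n. \<bar>\<alpha> i\<bar>)" "0 \<le> (\<Sum>i<n. \<bar>\<beta> i\<bar>)" by (auto intro: sum_nonneg)
      ultimately have N: "real (Suc k) * \<gamma> < N" unfolding N_def using big by linarith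
      then have N0: "0 < N" using \<gamma> by (metis le_less_trans mult_nonneg_nonneg of_nat_0_le_iff)
      have \<gamma>N: "\<gamma> / N \<le> 1 / real (Suc k)" using N N0 by (simp add: field_simps)
      have "R (\<lambda>i. \<alpha> i / N) (\<lambda>i. \<beta> i / N) (1 / real (Suc k))"
        unfolding R_def
      proof (intro conjI allI impI)
        fix i assume i: "i < n"
        have "\<alpha> i / N / (x i)\<^sup>2 + mv n v (\<lambda>i. \<beta> i / N) i = (\<alpha> i / (x i)\<^sup>2 + mv n v \<beta> i) / N"
          unfolding mv_scale by (simp add: add_divide_distrib)
        then have "\<bar>\<alpha> i / N / (x i)\<^sup>2 + mv n v (\<lambda>i. \<beta> i / N) i\<bar> = \<bar>\<alpha> i / (x i)\<^sup>2 + mv n v \<beta> i\<bar> / N"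
          using N0 by simp
        also have "\<dots> \<le> \<gamma> / N" using R i N0 unfolding R_def by (intro divide_right_mono) auto
        finally show "\<bar>\<alpha> i / N / (x i)\<^sup>2 + mv n v (\<lambda>i. \<beta> i / N) i\<bar> \<le> 1 / real (Suc k)" using \<gamma>N by linarith
        have "\<beta> i / N / (y i)\<^sup>2 + mv n (flip v) (\<lambda>i. \<alpha> i / N) i = (\<beta> i / (y i)\<^sup>2 + mv n (flip v) \<alpha> i) / N"
          unfolding mv_scale by (simp add: add_divide_distrib)
        then have "\<bar>\<beta> i / N / (y i)\<^sup>2 + mv n (flip v) (\<lambda>i. \<alpha> i / N) i\<bar> = \<bar>\<beta> i / (y i)\<^sup>2 + mv n (flip v) \<alpha> i\<bar> / N"
          using N0 by simp
        also have "\<dots> \<le> \<gamma> / N" using R i N0 unfolding R_def by (intro divide_right_mono) auto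
        finally show "\<bar>\<beta> i / N / (y i)\<^sup>2 + mv n (flip v) (\<lambda>i. \<alpha> i / N) i\<bar> \<le> 1 / real (Suc k)" using \<gamma>N by linarith
      next
        show "(\<Sum>i<n. \<alpha> i / N) = (\<Sum>i<n. \<beta> i / N)"
          using R unfolding R_def by (simp add: sum_divide_distrib[symmetric])
      qed
      moreover have "(\<Sum>i<n. \<bar>\<alpha> i / N\<bar>) + (\<Sum>i<n. \<bar>\<beta> i / N\<bar>) = N / N"
        using N0 unfolding N_def by (simp add: sum_divide_distrib[symmetric] add_divide_distrib[symmetric])
      ultimately show ?thesis using N0 by fastforce
    qed
    then obtain \<alpha> \<beta> where R: "\<And>k. R (\<alpha> k) (\<beta> k) (1 / real (Suc k))"
      and norm: "\<And>k. (\<Sum>i<n. \<bar>\<alpha> k i\<bar>) + (\<Sum>i<n. \<bar>\<beta> k i\<bar>) = 1" by metis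
    define A where "A = Inl ` {..<n} \<union> Inr ` {..<n}"
    define f where "f k = case_sum (\<alpha> k) (\<beta> k)" for k
    have A: "finite A" "\<And>i. i < n \<Longrightarrow> Inl i \<in> A" "\<And>i. i < n \<Longrightarrow> Inr i \<in> A" unfolding A_def by auto
    have f_le: "\<bar>f k i\<bar> \<le> 1" if "i \<in> A" for k i
    proof -
      have "\<bar>\<alpha> k j\<bar> \<le> 1" "\<bar>\<beta> k j\<bar> \<le> 1" if "j < n" for j
      proof -
        have "\<bar>\<alpha> k j\<bar> \<le> (\<Sum>i<n. \<bar>\<alpha> k i\<bar>)" "\<bar>\<beta> k j\<bar> \<le> (\<Sum>i<n. \<bar>\<beta> k i\<bar>)"
          using member_le_sum[of j "{..<n}" "\<lambda>i. \<bar>\<alpha> k i\<bar>"] member_le_sum[of j "{..<n}" "\<lambda>i. \<bar>\<beta> k i\<bar>"] that by auto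
        moreover have "0 \<le> (\<Sum>i<n. \<bar>\<alpha> k i\<bar>)" "0 \<le> (\<Sum>i<n. \<bar>\<beta> k i\<bar>)" by (auto intro: sum_nonneg)
        ultimately show "\<bar>\<alpha> k j\<bar> \<le> 1" "\<bar>\<beta> k j\<bar> \<le> 1" using norm[of k] by linarith+
      qed
      then show ?thesis using that unfolding A_def f_def by auto
    qed
    obtain \<rho> l where \<rho>: "strict_mono (\<rho> :: nat \<Rightarrow> nat)" and l: "\<And>i. i \<in> A \<Longrightarrow> (\<lambda>k. f (\<rho> k) i) \<longlonglongrightarrow> l i"
      using finite_bounded_subsequence[OF A(1), of f 1] f_le by blast
    define \<alpha>0 where "\<alpha>0 i = l (Inl i)" for i
    define \<beta>0 where "\<beta>0 i = l (Inr i)" for i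
    have L: "(\<lambda>k. \<alpha> (\<rho> k) i) \<longlonglongrightarrow> \<alpha>0 i" "(\<lambda>k. \<beta> (\<rho> k) i) \<longlonglongrightarrow> \<beta>0 i" if "i < n" for i
      using l[OF A(2)[OF that]] l[OF A(3)[OF that]] unfolding f_def \<alpha>0_def \<beta>0_def by auto
    have "(\<lambda>k. inverse (real (Suc k))) \<longlonglongrightarrow> 0" by (rule LIMSEQ_inverse_real_of_nat)
    from LIMSEQ_subseq_LIMSEQ[OF this \<rho>] have inv0: "(\<lambda>k. 1 / real (Suc (\<rho> k))) \<longlonglongrightarrow> 0"
      by (simp add: o_def divide_inverse)
    have x0: "0 < x i" "0 < y i" if "i < n" for i using exact_scaling(1,2)[OF xy that] by auto
    have e1: "\<alpha>0 i / (x i)\<^sup>2 + mv n v \<beta>0 i = 0" if i: "i < n" for i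
    proof -
      have "(\<lambda>k. \<alpha> (\<rho> k) i / (x i)\<^sup>2 + mv n v (\<beta> (\<rho> k)) i) \<longlonglongrightarrow> \<alpha>0 i / (x i)\<^sup>2 + mv n v \<beta>0 i"
        unfolding mv_def using x0[OF i] by (intro tendsto_intros L i) auto
      moreover have "(\<lambda>k. \<alpha> (\<rho> k) i / (x i)\<^sup>2 + mv n v (\<beta> (\<rho> k)) i) \<longlonglongrightarrow> 0"
        by (rule Lim_null_comparison[OF _ inv0]) (use R i in \<open>auto simp: R_def simp del: of_nat_Suc\<close>)
      ultimately show ?thesis using LIMSEQ_unique by blast
    qed
    have e2: "\<beta>0 i / (y i)\<^sup>2 + mv n (flip v) \<alpha>0 i = 0" if i: "i < n" for i
    proof -
      have "(\<lambda>k. \<beta> (\<rho> k) i / (y i)\<^sup>2 + mv n (flip v) (\<alpha> (\<rho> k)) i) \<longlonglongrightarrow> \<beta>0 i / (y i)\<^sup>2 + mv n (flip v) \<alpha>0 i"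
        unfolding mv_def using x0[OF i] by (intro tendsto_intros L i) auto
      moreover have "(\<lambda>k. \<beta> (\<rho> k) i / (y i)\<^sup>2 + mv n (flip v) (\<alpha> (\<rho> k)) i) \<longlonglongrightarrow> 0"
        by (rule Lim_null_comparison[OF _ inv0]) (use R i in \<open>auto simp: R_def simp del: of_nat_Suc\<close>)
      ultimately show ?thesis using LIMSEQ_unique by blast
    qed
    have "(\<lambda>k. sum (\<alpha> (\<rho> k)) {..<n}) \<longlonglongrightarrow> sum \<alpha>0 {..<n}" by (intro tendsto_intros L) auto
    moreover have "(\<lambda>k. sum (\<beta> (\<rho> k)) {..<n}) \<longlonglongrightarrow> sum \<beta>0 {..<n}" by (intro tendsto_intros L) auto
    moreover have "sum (\<alpha> (\<rho> k)) {..<n} = sum (\<beta> (\<rho> k)) {..<n}" for k using R unfolding R_def by blast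
    ultimately have s: "sum \<alpha>0 {..<n} = sum \<beta>0 {..<n}" using LIMSEQ_unique by auto
    have zero: "\<alpha>0 i = 0 \<and> \<beta>0 i = 0" if "i < n" for i
      by (rule scaling_kernel[OF z v xy e1 e2 s that])
    have "(\<lambda>k. (\<Sum>i<n. \<bar>\<alpha> (\<rho> k) i\<bar>) + (\<Sum>i<n. \<bar>\<beta> (\<rho> k) i\<bar>)) \<longlonglongrightarrow> (\<Sum>i<n. \<bar>\<alpha>0 i\<bar>) + (\<Sum>i<n. \<bar>\<beta>0 i\<bar>)"
      by (intro tendsto_intros L) auto
    then have "(\<lambda>k::nat. 1::real) \<longlonglongrightarrow> 0" unfolding norm using zero by simp
    then show False using LIMSEQ_unique[of "\<lambda>k::nat. 1::real" 0 1] by auto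
  qed
  then obtain k where k: "\<forall>\<alpha> \<beta> \<gamma>. R \<alpha> \<beta> \<gamma> \<longrightarrow> (\<forall>i<n. \<bar>\<alpha> i\<bar> \<le> real (Suc k) * \<gamma> \<and> \<bar>\<beta> i\<bar> \<le> real (Suc k) * \<gamma>)" by blast
  show ?thesis
  proof (rule that[of "real (Suc k)"])
    fix \<alpha> \<beta> \<gamma> i
    assume "\<And>i. i < n \<Longrightarrow> \<bar>\<alpha> i / (x i)\<^sup>2 + mv n v \<beta> i\<bar> \<le> \<gamma>"
      "\<And>i. i < n \<Longrightarrow> \<bar>\<beta> i / (y i)\<^sup>2 + mv n (flip v) \<alpha> i\<bar> \<le> \<gamma>"
      "sum \<alpha> {..<n} = sum \<beta> {..<n}" and i: "i < n"
    then have "R \<alpha> \<beta> \<gamma>" unfolding R_def by blast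
    then show "\<bar>\<alpha> i\<bar> \<le> real (Suc k) * \<gamma> \<and> \<bar>\<beta> i\<bar> \<le> real (Suc k) * \<gamma>" using k i by blast
  qed simp
qed

text \<open>
  The lower bound for the linearization at the exact scaling persists when its diagonal entries change a little and
  each equation receives a small multiple of the matrix term of the other one. The terms with \<open>e\<close> and \<open>e'\<close> come from \<open>u / a\<close> and
  \<open>u / b\<close> in the Master Equations.
\<close>

lemma linear_stability:
  assumes z: "indecomposable n (\<lambda>i j. 0 < v i j)" and n: "0 < n" and v: "\<And>i j. i < n \<Longrightarrow> j < n \<Longrightarrow> 0 \<le> v i j"
    and xy: "approx_scaling n v 0 x y"
  obtains \<eta> C where "0 < \<eta>" "0 < C"
    "\<And>d d' e e' \<alpha> \<beta> \<gamma> i.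
       (\<And>i. i < n \<Longrightarrow> \<bar>d i - 1 / (x i)\<^sup>2\<bar> \<le> \<eta> \<and> \<bar>d' i - 1 / (y i)\<^sup>2\<bar> \<le> \<eta> \<and> \<bar>e i\<bar> \<le> \<eta> \<and> \<bar>e' i\<bar> \<le> \<eta>) \<Longrightarrow>
       (\<And>i. i < n \<Longrightarrow> \<bar>d i * \<alpha> i + mv n v \<beta> i - e i * mv n (flip v) \<alpha> i\<bar> \<le> \<gamma>) \<Longrightarrow>
       (\<And>i. i < n \<Longrightarrow> \<bar>d' i * \<beta> i + mv n (flip v) \<alpha> i - e' i * mv n v \<beta> i\<bar> \<le> \<gamma>) \<Longrightarrow>
       sum \<alpha> {..<n} = sum \<beta> {..<n} \<Longrightarrow> i < n \<Longrightarrow> \<bar>\<alpha> i\<bar> \<le> C * \<gamma> \<and> \<bar>\<beta> i\<bar> \<le> C * \<gamma>"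
proof -
  obtain C where C: "0 < C" and below:
    "\<And>\<alpha> \<beta> \<gamma> i. (\<And>i. i < n \<Longrightarrow> \<bar>\<alpha> i / (x i)\<^sup>2 + mv n v \<beta> i\<bar> \<le> \<gamma>) \<Longrightarrow>
       (\<And>i. i < n \<Longrightarrow> \<bar>\<beta> i / (y i)\<^sup>2 + mv n (flip v) \<alpha> i\<bar> \<le> \<gamma>) \<Longrightarrow>
       sum \<alpha> {..<n} = sum \<beta> {..<n} \<Longrightarrow> i < n \<Longrightarrow> \<bar>\<alpha> i\<bar> \<le> C * \<gamma> \<and> \<bar>\<beta> i\<bar> \<le> C * \<gamma>"
    using scaling_operator_bounded_below[OF z n v xy] by blast
  define B where "B = (\<Sum>i<n. \<Sum>j<n. \<bar>v i j\<bar>)"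
  define B' where "B' = (\<Sum>i<n. \<Sum>j<n. \<bar>flip v i j\<bar>)"
  have B: "0 \<le> B" "0 \<le> B'" unfolding B_def B'_def by (auto intro: sum_nonneg)
  \<comment> \<open>So small that the perturbation absorbs at most half of the lower bound.\<close>
  define \<eta> where "\<eta> = 1 / (2 * C * (1 + B + B'))"
  have BB: "0 < 1 + B + B'" using B by simp
  have \<eta>: "0 < \<eta>" unfolding \<eta>_def using C BB by simp
  have C\<eta>: "C * (\<eta> * (1 + B + B')) = 1 / 2" unfolding \<eta>_def using C BB by simp
  show ?thesis
  proof (rule that[of \<eta> "2 * C"])
    show "0 < \<eta>" "0 < 2 * C" using \<eta> C by auto
    fix d d' e e' \<alpha> \<beta> \<gamma> i
    assume co: "\<And>i. i < n \<Longrightarrow> \<bar>d i - 1 / (x i)\<^sup>2\<bar> \<le> \<eta> \<and> \<bar>d' i - 1 / (y i)\<^sup>2\<bar> \<le> \<eta> \<and> \<bar>e i\<bar> \<le> \<eta> \<and> \<bar>e' i\<bar> \<le> \<eta>"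
      and r1: "\<And>i. i < n \<Longrightarrow> \<bar>d i * \<alpha> i + mv n v \<beta> i - e i * mv n (flip v) \<alpha> i\<bar> \<le> \<gamma>"
      and r2: "\<And>i. i < n \<Longrightarrow> \<bar>d' i * \<beta> i + mv n (flip v) \<alpha> i - e' i * mv n v \<beta> i\<bar> \<le> \<gamma>"
      and s: "sum \<alpha> {..<n} = sum \<beta> {..<n}" and i: "i < n"
    obtain p where p: "p < n" "\<And>i. i < n \<Longrightarrow> max \<bar>\<alpha> i\<bar> \<bar>\<beta> i\<bar> \<le> max \<bar>\<alpha> p\<bar> \<bar>\<beta> p\<bar>"
      using attains_max[OF n, of "\<lambda>i. max \<bar>\<alpha> i\<bar> \<bar>\<beta> i\<bar>"] by blast
    define m where "m = max \<bar>\<alpha> p\<bar> \<bar>\<beta> p\<bar>"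
    have m: "0 \<le> m" "\<And>i. i < n \<Longrightarrow> \<bar>\<alpha> i\<bar> \<le> m" "\<And>i. i < n \<Longrightarrow> \<bar>\<beta> i\<bar> \<le> m" unfolding m_def using p(2) by fastforce+
    define \<gamma>' where "\<gamma>' = \<gamma> + \<eta> * (1 + B + B') * m"
    have t1: "\<bar>\<alpha> i / (x i)\<^sup>2 + mv n v \<beta> i\<bar> \<le> \<gamma>'" if "i < n" for i
    proof -
      have "\<alpha> i / (x i)\<^sup>2 + mv n v \<beta> i =
        (d i * \<alpha> i + mv n v \<beta> i - e i * mv n (flip v) \<alpha> i) - (d i - 1 / (x i)\<^sup>2) * \<alpha> i + e i * mv n (flip v) \<alpha> i"
        by (simp add: algebra_simps)
      moreover have "\<bar>(d i - 1 / (x i)\<^sup>2) * \<alpha> i\<bar> \<le> \<eta> * m"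
        unfolding abs_mult using co[OF that] m(2)[OF that] \<eta> by (intro mult_mono) auto
      moreover have "\<bar>e i * mv n (flip v) \<alpha> i\<bar> \<le> \<eta> * (B' * m)"
        unfolding abs_mult using co[OF that] mv_abs_le[where v = "flip v", OF m(2) that m(1)] \<eta> B'_def by (intro mult_mono) auto
      moreover have "0 \<le> \<eta> * (B * m)" using \<eta> B m by simp
      ultimately show ?thesis unfolding \<gamma>'_def using r1[OF that] by (simp add: distrib_left distrib_right)
    qed
    have t2: "\<bar>\<beta> i / (y i)\<^sup>2 + mv n (flip v) \<alpha> i\<bar> \<le> \<gamma>'" if "i < n" for i
    proof -
      have "\<beta> i / (y i)\<^sup>2 + mv n (flip v) \<alpha> i =
        (d' i * \<beta> i + mv n (flip v) \<alpha> i - e' i * mv n v \<beta> i) - (d' i - 1 / (y i)\<^sup>2) * \<beta> i + e' i * mv n v \<beta> i"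
        by (simp add: algebra_simps)
      moreover have "\<bar>(d' i - 1 / (y i)\<^sup>2) * \<beta> i\<bar> \<le> \<eta> * m"
        unfolding abs_mult using co[OF that] m(3)[OF that] \<eta> by (intro mult_mono) auto
      moreover have "\<bar>e' i * mv n v \<beta> i\<bar> \<le> \<eta> * (B * m)"
        unfolding abs_mult using co[OF that] mv_abs_le[where v = v, OF m(3) that m(1)] \<eta> B_def by (intro mult_mono) auto
      moreover have "0 \<le> \<eta> * (B' * m)" using \<eta> B m by simp
      ultimately show ?thesis unfolding \<gamma>'_def using r2[OF that] by (simp add: distrib_left distrib_right)
    qed
    have "m \<le> C * \<gamma>'" using below[OF t1 t2 s p(1)] unfolding m_def by auto
    also have "\<dots> = C * \<gamma> + C * (\<eta> * (1 + B + B')) * m" unfolding \<gamma>'_def by (simp add: distrib_left)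
    also have "\<dots> = C * \<gamma> + m / 2" unfolding C\<eta> by simp
    finally have "m \<le> 2 * C * \<gamma>" by simp
    then show "\<bar>\<alpha> i\<bar> \<le> 2 * C * \<gamma> \<and> \<bar>\<beta> i\<bar> \<le> 2 * C * \<gamma>" using m(2,3)[OF i] by simp
  qed
qed

text \<open>
  In the form \<open>1 / q = u / a + b\<close>, the difference of the equations at two parameters is linear in the difference of
  the two solutions, without remainder: its coefficients contain both solutions. The second equation follows by transposition.
\<close>

lemma master_sol_secant:
  assumes q: "master_sol n v u q q'" and p: "master_sol n v w p p'"
    and v: "\<forall>i<n. \<forall>j<n. 0 \<le> v i j" and u: "0 < u" and w: "0 < w" and i: "i < n"
  shows "1 / (q i * p i) * (p i - q i) + mv n v (\<lambda>j. p' j - q' j) i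
      - u / (mv n (flip v) q i * mv n (flip v) p i) * mv n (flip v) (\<lambda>j. p j - q j) i
      = - (w - u) / mv n (flip v) p i"
proof -
  note Q = master_sol_facts[OF q v u i] and P = master_sol_facts[OF p v w i]
  have "1 / (q i * p i) * (p i - q i) = 1 / q i - 1 / p i" using Q(1) P(1) by (simp add: field_simps)
  moreover have "u / (mv n (flip v) q i * mv n (flip v) p i) * (mv n (flip v) p i - mv n (flip v) q i)
      = u / mv n (flip v) q i - u / mv n (flip v) p i" using Q(4) P(4) by (simp add: field_simps)
  moreover have "- (w - u) / mv n (flip v) p i = u / mv n (flip v) p i - w / mv n (flip v) p i"
    by (simp add: diff_divide_distrib)
  ultimately show ?thesis unfolding mv_diff Q(8) P(8) by simp
qed

section \<open>Differentiability of the solutions near zero\<close>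

lemma mv_tendsto:
  assumes "\<And>j. j < n \<Longrightarrow> ((\<lambda>t. f t j) \<longlongrightarrow> g j) F"
  shows "((\<lambda>t. mv n v (f t) i) \<longlongrightarrow> mv n v g i) F"
  unfolding mv_def by (intro tendsto_intros assms) auto

lemma quotient_form: "c * (x / h) + m / h - e * (w / h) = (c * x + m - e * w) / h" for h :: real
  by (simp add: add_divide_distrib diff_divide_distrib)

lemma abs_quotient_le:
  fixes a w G :: real
  assumes "1 / a \<le> G" "0 < a" "0 \<le> w"
  shows "\<bar>- w / a\<bar> \<le> G * w"
  using mult_right_mono[OF assms(1,3)] assms(2,3) by simp

text \<open>
  No uniqueness of solutions at \<open>s > 0\<close> is presupposed: \<open>linear_stability\<close> applies to any two parameters
  that are close to 0, and bounds the difference quotients by a multiple of \<open>s + t\<close>. This yields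
  continuity. A cluster point of the difference quotients at \<open>s\<close> solves the linear system whose
  coefficients are those at the pair \<open>(s, s)\<close>; it is unique by the same stability estimate.
\<close>

lemma master_differentiable:
  fixes q q' :: "real \<Rightarrow> nat \<Rightarrow> real"
  assumes z: "indecomposable n (\<lambda>i j. 0 < v i j)" and n: "0 < n" and v: "\<forall>i<n. \<forall>j<n. 0 \<le> v i j"
    and xy: "approx_scaling n v 0 x y" and s1: "0 < s1"
    and ms: "\<And>s. 0 < s \<Longrightarrow> s < s1 \<Longrightarrow> master_sol n v (s\<^sup>2) (q s) (q' s)"
    and lim: "\<And>i. i < n \<Longrightarrow> ((\<lambda>s. q s i) \<longlongrightarrow> x i) (at_right 0)"
    and lim': "\<And>i. i < n \<Longrightarrow> ((\<lambda>s. q' s i) \<longlongrightarrow> y i) (at_right 0)"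
  obtains s0 L where "0 < s0" "s0 \<le> s1"
    "\<And>s i. 0 < s \<Longrightarrow> s < s0 \<Longrightarrow> i < n \<Longrightarrow>
       (\<exists>D. ((\<lambda>s. q s i) has_real_derivative D) (at s) \<and> \<bar>D\<bar> \<le> L * s) \<and>
       (\<exists>D. ((\<lambda>s. q' s i) has_real_derivative D) (at s) \<and> \<bar>D\<bar> \<le> L * s)"
proof -
  have v': "\<And>i j. i < n \<Longrightarrow> j < n \<Longrightarrow> 0 \<le> v i j" using v by blast
  obtain \<eta> C where \<eta>: "0 < \<eta>" and C: "0 < C" and stab:
    "\<And>d d' e e' \<alpha> \<beta> \<gamma> i.
       (\<And>i. i < n \<Longrightarrow> \<bar>d i - 1 / (x i)\<^sup>2\<bar> \<le> \<eta> \<and> \<bar>d' i - 1 / (y i)\<^sup>2\<bar> \<le> \<eta> \<and> \<bar>e i\<bar> \<le> \<eta> \<and> \<bar>e' i\<bar> \<le> \<eta>) \<Longrightarrow>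
       (\<And>i. i < n \<Longrightarrow> \<bar>d i * \<alpha> i + mv n v \<beta> i - e i * mv n (flip v) \<alpha> i\<bar> \<le> \<gamma>) \<Longrightarrow>
       (\<And>i. i < n \<Longrightarrow> \<bar>d' i * \<beta> i + mv n (flip v) \<alpha> i - e' i * mv n v \<beta> i\<bar> \<le> \<gamma>) \<Longrightarrow>
       sum \<alpha> {..<n} = sum \<beta> {..<n} \<Longrightarrow> i < n \<Longrightarrow> \<bar>\<alpha> i\<bar> \<le> C * \<gamma> \<and> \<bar>\<beta> i\<bar> \<le> C * \<gamma>"
    using linear_stability[OF z n v' xy] by blast
  note E = exact_scaling[OF xy]
  define a where "a s = mv n (flip v) (q s)" for s
  define b where "b s = mv n v (q' s)" for s
  have lim_a: "((\<lambda>s. a s i) \<longlongrightarrow> 1 / y i) (at_right 0)" if i: "i < n" for i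
  proof -
    have "mv n (flip v) x i = 1 / y i" using E(2,4)[OF i] by (simp add: field_simps)
    then show ?thesis unfolding a_def using mv_tendsto[of n q x "at_right 0" "flip v" i] lim by simp
  qed
  have lim_b: "((\<lambda>s. b s i) \<longlongrightarrow> 1 / x i) (at_right 0)" if i: "i < n" for i
  proof -
    have "mv n v y i = 1 / x i" using E(1,3)[OF i] by (simp add: field_simps)
    then show ?thesis unfolding b_def using mv_tendsto[of n q' y "at_right 0" v i] lim' by simp
  qed
  \<comment> \<open>A bound for \<open>1 / a\<close> and \<open>1 / b\<close>, whose limits are \<open>y\<close> and \<open>x\<close>.\<close>
  define G where "G = (\<Sum>i<n. x i + y i) + 1"
  define good where "good = (\<lambda>(s, t). \<forall>i\<in>{..<n}.
     \<bar>1 / (q s i * q t i) - 1 / (x i)\<^sup>2\<bar> < \<eta> \<and> \<bar>1 / (q' s i * q' t i) - 1 / (y i)\<^sup>2\<bar> < \<eta> \<and>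
     \<bar>s\<^sup>2 / (a s i * a t i)\<bar> < \<eta> \<and> \<bar>s\<^sup>2 / (b s i * b t i)\<bar> < \<eta> \<and>
     1 / a t i < G \<and> 1 / b t i < G)"
  \<comment> \<open>The filter on pairs makes the coefficients close to those at the exact scaling for all
    pairs \<open>(s, t)\<close> in one neighbourhood of 0.\<close>
  have "eventually good (at_right 0 \<times>\<^sub>F at_right 0)"
    unfolding good_def split_beta
  proof (intro eventually_ball_finite ballI)
    fix i assume "i \<in> {..<n}"
    then have i: "i < n" by simp
    let ?F = "at_right (0::real) \<times>\<^sub>F at_right (0::real)"
    have fst0: "filterlim fst (at_right 0) ?F" and snd0: "filterlim snd (at_right 0) ?F"
      by (rule filterlim_fst filterlim_snd)+
    have x0: "x i \<noteq> 0" "y i \<noteq> 0" using E(1,2)[OF i] by auto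
    note L1 = filterlim_compose[OF lim[OF i] fst0] filterlim_compose[OF lim[OF i] snd0]
      filterlim_compose[OF lim'[OF i] fst0] filterlim_compose[OF lim'[OF i] snd0]
      filterlim_compose[OF lim_a[OF i] fst0] filterlim_compose[OF lim_a[OF i] snd0]
      filterlim_compose[OF lim_b[OF i] fst0] filterlim_compose[OF lim_b[OF i] snd0]
    have "((\<lambda>s::real. s) \<longlongrightarrow> 0) (at_right 0)" by (rule tendsto_ident_at)
    from filterlim_compose[OF this fst0] have f0: "(fst \<longlongrightarrow> 0) ?F" by simp
    have T1: "((\<lambda>p. 1 / (q (fst p) i * q (snd p) i)) \<longlongrightarrow> 1 / (x i * x i)) ?F"
      using x0 by (intro tendsto_intros L1) auto
    have T2: "((\<lambda>p. 1 / (q' (fst p) i * q' (snd p) i)) \<longlongrightarrow> 1 / (y i * y i)) ?F"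
      using x0 by (intro tendsto_intros L1) auto
    have T3: "((\<lambda>p. (fst p)\<^sup>2 / (a (fst p) i * a (snd p) i)) \<longlongrightarrow> 0\<^sup>2 / (1 / y i * (1 / y i))) ?F"
      using x0 by (intro tendsto_intros L1 f0) auto
    have T4: "((\<lambda>p. (fst p)\<^sup>2 / (b (fst p) i * b (snd p) i)) \<longlongrightarrow> 0\<^sup>2 / (1 / x i * (1 / x i))) ?F"
      using x0 by (intro tendsto_intros L1 f0) auto
    have T5: "((\<lambda>p. 1 / a (snd p) i) \<longlongrightarrow> 1 / (1 / y i)) ?F"
      using x0 by (intro tendsto_intros L1) auto
    have T6: "((\<lambda>p. 1 / b (snd p) i) \<longlongrightarrow> 1 / (1 / x i)) ?F"
      using x0 by (intro tendsto_intros L1) auto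
    have "x i + y i \<le> (\<Sum>i<n. x i + y i)"
      using E(1,2) i by (intro member_le_sum) (auto intro: less_imp_le add_nonneg_nonneg)
    then have G: "1 / (1 / y i) < G" "1 / (1 / x i) < G" unfolding G_def using E(1,2)[OF i] by auto
    have dist: "\<forall>\<^sub>F p in ?F. \<bar>f p - l\<bar> < \<eta>" if "(f \<longlongrightarrow> l) ?F" for f l
      using tendstoD[OF that \<eta>] by (simp add: dist_real_def)
    show "\<forall>\<^sub>F p in ?F.
      \<bar>1 / (q (fst p) i * q (snd p) i) - 1 / (x i)\<^sup>2\<bar> < \<eta> \<and> \<bar>1 / (q' (fst p) i * q' (snd p) i) - 1 / (y i)\<^sup>2\<bar> < \<eta> \<and>
      \<bar>(fst p)\<^sup>2 / (a (fst p) i * a (snd p) i)\<bar> < \<eta> \<and> \<bar>(fst p)\<^sup>2 / (b (fst p) i * b (snd p) i)\<bar> < \<eta> \<and>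
      1 / a (snd p) i < G \<and> 1 / b (snd p) i < G"
      using dist[OF T1] dist[OF T2] dist[OF T3] dist[OF T4] order_tendstoD(2)[OF T5 G(1)] order_tendstoD(2)[OF T6 G(2)]
      by eventually_elim (simp add: power2_eq_square)
  qed simp
  then obtain Q where Q: "eventually Q (at_right 0)" "\<And>s t. Q s \<Longrightarrow> Q t \<Longrightarrow> good (s, t)"
    unfolding eventually_prod_same by blast
  then obtain s2 where s2: "0 < s2" "\<And>s. 0 < s \<Longrightarrow> s < s2 \<Longrightarrow> Q s"
    unfolding eventually_at_right_field by auto
  define s0 where "s0 = min s1 s2"
  have s0: "0 < s0" "s0 \<le> s1" "s0 \<le> s2" unfolding s0_def using s1 s2 by auto
  have good: "\<bar>1 / (q s i * q t i) - 1 / (x i)\<^sup>2\<bar> \<le> \<eta> \<and> \<bar>1 / (q' s i * q' t i) - 1 / (y i)\<^sup>2\<bar> \<le> \<eta> \<and>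
     \<bar>s\<^sup>2 / (a s i * a t i)\<bar> \<le> \<eta> \<and> \<bar>s\<^sup>2 / (b s i * b t i)\<bar> \<le> \<eta>"
    and good_ab: "1 / a t i \<le> G" "1 / b t i \<le> G"
    if "0 < s" "s < s0" "0 < t" "t < s0" "i < n" for s t i
  proof -
    have "good (s, t)" using that s0 by (intro Q(2) s2) auto
    then show "\<bar>1 / (q s i * q t i) - 1 / (x i)\<^sup>2\<bar> \<le> \<eta> \<and> \<bar>1 / (q' s i * q' t i) - 1 / (y i)\<^sup>2\<bar> \<le> \<eta> \<and>
     \<bar>s\<^sup>2 / (a s i * a t i)\<bar> \<le> \<eta> \<and> \<bar>s\<^sup>2 / (b s i * b t i)\<bar> \<le> \<eta>" "1 / a t i \<le> G" "1 / b t i \<le> G"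
      unfolding good_def using that(5) by (auto intro: less_imp_le)
  qed
  have M: "master_sol n v (s\<^sup>2) (q s) (q' s)" if "0 < s" "s < s0" for s using ms that s0 by auto
  have pos: "0 < q s i" "0 < q' s i" "0 < a s i" "0 < b s i" if "0 < s" "s < s0" "i < n" for s i
    using master_sol_facts(1-4)[OF M[OF that(1,2)] v _ that(3)] that unfolding a_def b_def by auto
  have sums: "sum (q s) {..<n} = sum (q' s) {..<n}" if "0 < s" "s < s0" for s
    using M[OF that] unfolding master_sol_def by blast
  have sec: "1 / (q s i * q t i) * (q t i - q s i) + mv n v (\<lambda>j. q' t j - q' s j) i
      - s\<^sup>2 / (a s i * a t i) * mv n (flip v) (\<lambda>j. q t j - q s j) i = - (t\<^sup>2 - s\<^sup>2) / a t i"
    and sec': "1 / (q' s i * q' t i) * (q' t i - q' s i) + mv n (flip v) (\<lambda>j. q t j - q s j) i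
      - s\<^sup>2 / (b s i * b t i) * mv n v (\<lambda>j. q' t j - q' s j) i = - (t\<^sup>2 - s\<^sup>2) / b t i"
    if "0 < s" "s < s0" "0 < t" "t < s0" "i < n" for s t i
  proof -
    have s2: "0 < s\<^sup>2" "0 < t\<^sup>2" using that by auto
    have vt: "\<forall>i<n. \<forall>j<n. 0 \<le> flip v i j" using v by (simp add: flip_def)
    show "1 / (q s i * q t i) * (q t i - q s i) + mv n v (\<lambda>j. q' t j - q' s j) i
      - s\<^sup>2 / (a s i * a t i) * mv n (flip v) (\<lambda>j. q t j - q s j) i = - (t\<^sup>2 - s\<^sup>2) / a t i"
      using master_sol_secant[OF M[OF that(1,2)] M[OF that(3,4)] v s2 that(5)] unfolding a_def .
    show "1 / (q' s i * q' t i) * (q' t i - q' s i) + mv n (flip v) (\<lambda>j. q t j - q s j) i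
      - s\<^sup>2 / (b s i * b t i) * mv n v (\<lambda>j. q' t j - q' s j) i = - (t\<^sup>2 - s\<^sup>2) / b t i"
      using master_sol_secant[OF master_sol_transpose[OF M[OF that(1,2)]] master_sol_transpose[OF M[OF that(3,4)]] vt s2 that(5)]
      unfolding b_def flip_flip .
  qed
  have dq: "1 / (q s i * q t i) * ((q t i - q s i) / (t - s)) + mv n v (\<lambda>j. (q' t j - q' s j) / (t - s)) i
      - s\<^sup>2 / (a s i * a t i) * mv n (flip v) (\<lambda>j. (q t j - q s j) / (t - s)) i = - (t + s) / a t i"
    and dq': "1 / (q' s i * q' t i) * ((q' t i - q' s i) / (t - s)) + mv n (flip v) (\<lambda>j. (q t j - q s j) / (t - s)) i
      - s\<^sup>2 / (b s i * b t i) * mv n v (\<lambda>j. (q' t j - q' s j) / (t - s)) i = - (t + s) / b t i"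
    if st: "0 < s" "s < s0" "0 < t" "t < s0" "t \<noteq> s" "i < n" for s t i
  proof -
    have "- (t\<^sup>2 - s\<^sup>2) = - (t + s) * (t - s)" by (simp add: power2_eq_square algebra_simps)
    then have sq: "- (t\<^sup>2 - s\<^sup>2) / c / (t - s) = - (t + s) / c" for c using st by simp
    show "1 / (q s i * q t i) * ((q t i - q s i) / (t - s)) + mv n v (\<lambda>j. (q' t j - q' s j) / (t - s)) i
      - s\<^sup>2 / (a s i * a t i) * mv n (flip v) (\<lambda>j. (q t j - q s j) / (t - s)) i = - (t + s) / a t i"
      unfolding mv_scale quotient_form sec[OF st(1-4,6)] by (rule sq)
    show "1 / (q' s i * q' t i) * ((q' t i - q' s i) / (t - s)) + mv n (flip v) (\<lambda>j. (q t j - q s j) / (t - s)) i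
      - s\<^sup>2 / (b s i * b t i) * mv n v (\<lambda>j. (q' t j - q' s j) / (t - s)) i = - (t + s) / b t i"
      unfolding mv_scale quotient_form sec'[OF st(1-4,6)] by (rule sq)
  qed
  have quotient_le: "\<bar>(q t i - q s i) / (t - s)\<bar> \<le> C * (G * (t + s)) \<and> \<bar>(q' t i - q' s i) / (t - s)\<bar> \<le> C * (G * (t + s))"
    if st: "0 < s" "s < s0" "0 < t" "t < s0" "t \<noteq> s" and i: "i < n" for s t i
  proof (rule stab[where d = "\<lambda>i. 1 / (q s i * q t i)" and d' = "\<lambda>i. 1 / (q' s i * q' t i)"
        and e = "\<lambda>i. s\<^sup>2 / (a s i * a t i)" and e' = "\<lambda>i. s\<^sup>2 / (b s i * b t i)"])
    fix i assume i: "i < n"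
    show "\<bar>1 / (q s i * q t i) - 1 / (x i)\<^sup>2\<bar> \<le> \<eta> \<and> \<bar>1 / (q' s i * q' t i) - 1 / (y i)\<^sup>2\<bar> \<le> \<eta> \<and>
      \<bar>s\<^sup>2 / (a s i * a t i)\<bar> \<le> \<eta> \<and> \<bar>s\<^sup>2 / (b s i * b t i)\<bar> \<le> \<eta>"
      by (rule good[OF st(1-4) i])
    show "\<bar>1 / (q s i * q t i) * ((q t i - q s i) / (t - s)) + mv n v (\<lambda>j. (q' t j - q' s j) / (t - s)) i
      - s\<^sup>2 / (a s i * a t i) * mv n (flip v) (\<lambda>j. (q t j - q s j) / (t - s)) i\<bar> \<le> G * (t + s)"
      unfolding dq[OF st i] using st by (intro abs_quotient_le good_ab(1)[OF st(1-4) i] pos(3)[OF st(3,4) i]) auto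
    show "\<bar>1 / (q' s i * q' t i) * ((q' t i - q' s i) / (t - s)) + mv n (flip v) (\<lambda>j. (q t j - q s j) / (t - s)) i
      - s\<^sup>2 / (b s i * b t i) * mv n v (\<lambda>j. (q' t j - q' s j) / (t - s)) i\<bar> \<le> G * (t + s)"
      unfolding dq'[OF st i] using st by (intro abs_quotient_le good_ab(2)[OF st(1-4) i] pos(4)[OF st(3,4) i]) auto
  next
    show "(\<Sum>i<n. (q t i - q s i) / (t - s)) = (\<Sum>i<n. (q' t i - q' s i) / (t - s))"
      using sums st by (simp add: sum_divide_distrib[symmetric] sum_subtractf)
  qed (fact i)
  have "0 < x i + y i" if "i < n" for i using E(1,2)[OF that] by simp
  then have G: "0 < G" unfolding G_def by (intro add_nonneg_pos sum_nonneg) (auto intro: less_imp_le)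
  have cont: "((\<lambda>t. q t i) \<longlongrightarrow> q s i) (at s) \<and> ((\<lambda>t. q' t i) \<longlongrightarrow> q' s i) (at s)"
    if s: "0 < s" "s < s0" and i: "i < n" for s i
  proof -
    have near: "\<forall>\<^sub>F t in at s. t \<in> {0<..<s0} - {s}"
      using s by (intro eventually_at_in_open) auto
    have T: "((\<lambda>t. C * (G * (2 * s0)) * \<bar>t - s\<bar>) \<longlongrightarrow> C * (G * (2 * s0)) * \<bar>s - s\<bar>) (at s)"
      by (intro tendsto_intros)
    have bound: "\<bar>f t i - f s i\<bar> \<le> C * (G * (2 * s0)) * \<bar>t - s\<bar>"
      if "\<bar>(f t i - f s i) / (t - s)\<bar> \<le> C * (G * (t + s))" "t \<in> {0<..<s0} - {s}" for f :: "real \<Rightarrow> nat \<Rightarrow> real" and t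
    proof -
      have "C * (G * (t + s)) \<le> C * (G * (2 * s0))" using C G s that by (intro mult_left_mono) auto
      then have "\<bar>f t i - f s i\<bar> / \<bar>t - s\<bar> \<le> C * (G * (2 * s0))" using that by (simp add: abs_divide)
      then show ?thesis using that by (simp add: divide_le_eq split: if_splits)
    qed
    have "((\<lambda>t. q t i - q s i) \<longlongrightarrow> 0) (at s)"
      by (rule Lim_null_comparison[OF eventually_mono[OF near] T[simplified]])
        (use quotient_le[OF s] i bound[of q] in auto)
    moreover have "((\<lambda>t. q' t i - q' s i) \<longlongrightarrow> 0) (at s)"
      by (rule Lim_null_comparison[OF eventually_mono[OF near] T[simplified]])
        (use quotient_le[OF s] i bound[of q'] in auto)
    ultimately show ?thesis by (simp add: LIM_zero_iff)
  qed
  define L where "L = C * (G * 2)"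
  have main: "(\<exists>D. ((\<lambda>s. q s i) has_real_derivative D) (at s) \<and> \<bar>D\<bar> \<le> L * s) \<and>
       (\<exists>D. ((\<lambda>s. q' s i) has_real_derivative D) (at s) \<and> \<bar>D\<bar> \<le> L * s)"
    if s: "0 < s" "s < s0" and i: "i < n" for s i
  proof -
    define A where "A = Inl ` {..<n} \<union> Inr ` {..<n}"
    define f where "f t = case_sum (\<lambda>i. (q t i - q s i) / (t - s)) (\<lambda>i. (q' t i - q' s i) / (t - s))" for t
    have A: "finite A" "\<And>i. i < n \<Longrightarrow> Inl i \<in> A" "\<And>i. i < n \<Longrightarrow> Inr i \<in> A" unfolding A_def by auto
    define P where "P l \<longleftrightarrow> (\<forall>i<n.
       1 / (q s i * q s i) * l (Inl i) + mv n v (\<lambda>j. l (Inr j)) i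
         - s\<^sup>2 / (a s i * a s i) * mv n (flip v) (\<lambda>j. l (Inl j)) i = - (2 * s) / a s i \<and>
       1 / (q' s i * q' s i) * l (Inr i) + mv n (flip v) (\<lambda>j. l (Inl j)) i
         - s\<^sup>2 / (b s i * b s i) * mv n v (\<lambda>j. l (Inr j)) i = - (2 * s) / b s i) \<and>
       (\<Sum>i<n. l (Inl i)) = (\<Sum>i<n. l (Inr i))" for l :: "nat + nat \<Rightarrow> real"
    have at_s: "at s within {0<..<s0} = at s" using s by (intro at_within_open) auto
    have "\<exists>l. P l \<and> (\<forall>i\<in>A. ((\<lambda>t. f t i) \<longlongrightarrow> l i) (at s within {0<..<s0}))"
    proof (rule unique_cluster_imp_tendsto[where P = P and C = "C * (G * (2 * s0))"])
      show "finite A" by (fact A)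
      show "at s within {0<..<s0} \<noteq> bot" unfolding at_s by simp
      show "\<bar>f t i\<bar> \<le> C * (G * (2 * s0))" if ti: "t \<in> {0<..<s0} - {s}" "i \<in> A" for t i
      proof -
        have "C * (G * (t + s)) \<le> C * (G * (2 * s0))" using C G s ti by (intro mult_left_mono) auto
        then have "\<bar>(q t j - q s j) / (t - s)\<bar> \<le> C * (G * (2 * s0)) \<and> \<bar>(q' t j - q' s j) / (t - s)\<bar> \<le> C * (G * (2 * s0))"
          if "j < n" for j using quotient_le[OF s, of t j] ti that by auto
        then show ?thesis using ti(2) unfolding A_def f_def by auto
      qed
      show "P l" if X: "\<And>k. X k \<in> {0<..<s0} - {s}" "X \<longlonglongrightarrow> s"
        and l: "\<And>i. i \<in> A \<Longrightarrow> (\<lambda>k. f (X k) i) \<longlonglongrightarrow> l i" for X l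
      proof -
        have F: "filterlim X (at s) sequentially" using X by (auto simp: filterlim_at)
        have L1: "(\<lambda>k. (q (X k) i - q s i) / (X k - s)) \<longlonglongrightarrow> l (Inl i)"
          and L2: "(\<lambda>k. (q' (X k) i - q' s i) / (X k - s)) \<longlonglongrightarrow> l (Inr i)" if "i < n" for i
          using l[OF A(2)[OF that]] l[OF A(3)[OF that]] unfolding f_def by auto
        have Lq: "(\<lambda>k. q (X k) i) \<longlonglongrightarrow> q s i" and Lq': "(\<lambda>k. q' (X k) i) \<longlonglongrightarrow> q' s i" if "i < n" for i
          using filterlim_compose[OF conjunct1[OF cont[OF s that]] F]
            filterlim_compose[OF conjunct2[OF cont[OF s that]] F] by auto
        have La: "(\<lambda>k. a (X k) i) \<longlonglongrightarrow> a s i" and Lb: "(\<lambda>k. b (X k) i) \<longlonglongrightarrow> b s i" for i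
          unfolding a_def b_def by (intro mv_tendsto Lq Lq'; assumption)+
        note ML1 = mv_tendsto[of n "\<lambda>k j. (q (X k) j - q s j) / (X k - s)" "\<lambda>j. l (Inl j)" sequentially, OF L1]
        note ML2 = mv_tendsto[of n "\<lambda>k j. (q' (X k) j - q' s j) / (X k - s)" "\<lambda>j. l (Inr j)" sequentially, OF L2]
        have Xs: "0 < X k" "X k < s0" "X k \<noteq> s" for k using X(1)[of k] by auto
        have e1: "1 / (q s i * q s i) * l (Inl i) + mv n v (\<lambda>j. l (Inr j)) i
         - s\<^sup>2 / (a s i * a s i) * mv n (flip v) (\<lambda>j. l (Inl j)) i = - (2 * s) / a s i" if i: "i < n" for i
        proof -
          have "(\<lambda>k. - (X k + s) / a (X k) i) \<longlonglongrightarrow>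
             1 / (q s i * q s i) * l (Inl i) + mv n v (\<lambda>j. l (Inr j)) i
               - s\<^sup>2 / (a s i * a s i) * mv n (flip v) (\<lambda>j. l (Inl j)) i"
            unfolding dq[OF s Xs i, symmetric] using pos[OF s i] by (intro tendsto_intros L1 Lq La ML1 ML2 i) auto
          moreover have "(\<lambda>k. - (X k + s) / a (X k) i) \<longlonglongrightarrow> - (s + s) / a s i"
            using pos[OF s i] by (intro tendsto_intros X(2) La) auto
          ultimately show ?thesis using LIMSEQ_unique by fastforce
        qed
        have e2: "1 / (q' s i * q' s i) * l (Inr i) + mv n (flip v) (\<lambda>j. l (Inl j)) i
         - s\<^sup>2 / (b s i * b s i) * mv n v (\<lambda>j. l (Inr j)) i = - (2 * s) / b s i" if i: "i < n" for i
        proof -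
          have "(\<lambda>k. - (X k + s) / b (X k) i) \<longlonglongrightarrow>
             1 / (q' s i * q' s i) * l (Inr i) + mv n (flip v) (\<lambda>j. l (Inl j)) i
               - s\<^sup>2 / (b s i * b s i) * mv n v (\<lambda>j. l (Inr j)) i"
            unfolding dq'[OF s Xs i, symmetric] using pos[OF s i] by (intro tendsto_intros L2 Lq' Lb ML1 ML2 i) auto
          moreover have "(\<lambda>k. - (X k + s) / b (X k) i) \<longlonglongrightarrow> - (s + s) / b s i"
            using pos[OF s i] by (intro tendsto_intros X(2) Lb) auto
          ultimately show ?thesis using LIMSEQ_unique by fastforce
        qed
        have "(\<lambda>k. \<Sum>i<n. (q (X k) i - q s i) / (X k - s)) \<longlonglongrightarrow> (\<Sum>i<n. l (Inl i))"
          by (intro tendsto_intros L1) auto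
        moreover have "(\<lambda>k. \<Sum>i<n. (q' (X k) i - q' s i) / (X k - s)) \<longlonglongrightarrow> (\<Sum>i<n. l (Inr i))"
          by (intro tendsto_intros L2) auto
        moreover have "(\<Sum>i<n. (q (X k) i - q s i) / (X k - s)) = (\<Sum>i<n. (q' (X k) i - q' s i) / (X k - s))" for k
          using sums[OF s] sums[OF Xs(1,2)[of k]] by (simp add: sum_divide_distrib[symmetric] sum_subtractf)
        ultimately have "(\<Sum>i<n. l (Inl i)) = (\<Sum>i<n. l (Inr i))" using LIMSEQ_unique by auto
        then show ?thesis unfolding P_def using e1 e2 by blast
      qed
      show "l i = l' i" if l: "P l" "P l'" "i \<in> A" for l l' i
      proof -
        have "\<bar>l (Inl j) - l' (Inl j)\<bar> \<le> C * 0 \<and> \<bar>l (Inr j) - l' (Inr j)\<bar> \<le> C * 0" if "j < n" for j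
        proof (rule stab[where d = "\<lambda>i. 1 / (q s i * q s i)" and d' = "\<lambda>i. 1 / (q' s i * q' s i)"
              and e = "\<lambda>i. s\<^sup>2 / (a s i * a s i)" and e' = "\<lambda>i. s\<^sup>2 / (b s i * b s i)"])
          fix i assume i: "i < n"
          show "\<bar>1 / (q s i * q s i) - 1 / (x i)\<^sup>2\<bar> \<le> \<eta> \<and> \<bar>1 / (q' s i * q' s i) - 1 / (y i)\<^sup>2\<bar> \<le> \<eta> \<and>
            \<bar>s\<^sup>2 / (a s i * a s i)\<bar> \<le> \<eta> \<and> \<bar>s\<^sup>2 / (b s i * b s i)\<bar> \<le> \<eta>"
            by (rule good[OF s s i])
          note P1 = l(1)[unfolded P_def, THEN conjunct1, rule_format, OF i]
            and P2 = l(2)[unfolded P_def, THEN conjunct1, rule_format, OF i]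
          show "\<bar>1 / (q s i * q s i) * (l (Inl i) - l' (Inl i)) + mv n v (\<lambda>j. l (Inr j) - l' (Inr j)) i
            - s\<^sup>2 / (a s i * a s i) * mv n (flip v) (\<lambda>j. l (Inl j) - l' (Inl j)) i\<bar> \<le> 0"
            using P1[THEN conjunct1] P2[THEN conjunct1] unfolding mv_diff right_diff_distrib by linarith
          show "\<bar>1 / (q' s i * q' s i) * (l (Inr i) - l' (Inr i)) + mv n (flip v) (\<lambda>j. l (Inl j) - l' (Inl j)) i
            - s\<^sup>2 / (b s i * b s i) * mv n v (\<lambda>j. l (Inr j) - l' (Inr j)) i\<bar> \<le> 0"
            using P1[THEN conjunct2] P2[THEN conjunct2] unfolding mv_diff right_diff_distrib by linarith
        next
          show "(\<Sum>i<n. l (Inl i) - l' (Inl i)) = (\<Sum>i<n. l (Inr i) - l' (Inr i))"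
            using l(1,2) unfolding P_def sum_subtractf by simp
        qed (fact that)
        then show ?thesis using l(3) unfolding A_def by auto
      qed
    qed blast
    then obtain l where l: "P l" "\<And>i. i \<in> A \<Longrightarrow> ((\<lambda>t. f t i) \<longlongrightarrow> l i) (at s)" unfolding at_s by blast
    have "\<bar>l (Inl i)\<bar> \<le> C * (G * (2 * s)) \<and> \<bar>l (Inr i)\<bar> \<le> C * (G * (2 * s))"
    proof (rule stab[where d = "\<lambda>i. 1 / (q s i * q s i)" and d' = "\<lambda>i. 1 / (q' s i * q' s i)"
          and e = "\<lambda>i. s\<^sup>2 / (a s i * a s i)" and e' = "\<lambda>i. s\<^sup>2 / (b s i * b s i)"])
      fix i assume i: "i < n"
      show "\<bar>1 / (q s i * q s i) - 1 / (x i)\<^sup>2\<bar> \<le> \<eta> \<and> \<bar>1 / (q' s i * q' s i) - 1 / (y i)\<^sup>2\<bar> \<le> \<eta> \<and>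
        \<bar>s\<^sup>2 / (a s i * a s i)\<bar> \<le> \<eta> \<and> \<bar>s\<^sup>2 / (b s i * b s i)\<bar> \<le> \<eta>"
        by (rule good[OF s s i])
      note P1 = l(1)[unfolded P_def, THEN conjunct1, rule_format, OF i]
      show "\<bar>1 / (q s i * q s i) * l (Inl i) + mv n v (\<lambda>j. l (Inr j)) i
        - s\<^sup>2 / (a s i * a s i) * mv n (flip v) (\<lambda>j. l (Inl j)) i\<bar> \<le> G * (2 * s)"
        unfolding P1[THEN conjunct1]
        using s by (intro abs_quotient_le good_ab(1)[OF s s i] pos(3)[OF s i]) auto
      show "\<bar>1 / (q' s i * q' s i) * l (Inr i) + mv n (flip v) (\<lambda>j. l (Inl j)) i
        - s\<^sup>2 / (b s i * b s i) * mv n v (\<lambda>j. l (Inr j)) i\<bar> \<le> G * (2 * s)"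
        unfolding P1[THEN conjunct2]
        using s by (intro abs_quotient_le good_ab(2)[OF s s i] pos(4)[OF s i]) auto
    next
      show "(\<Sum>i<n. l (Inl i)) = (\<Sum>i<n. l (Inr i))" using l(1) unfolding P_def by blast
    qed (fact i)
    then have "\<bar>l (Inl i)\<bar> \<le> L * s" "\<bar>l (Inr i)\<bar> \<le> L * s" unfolding L_def by (simp_all add: mult_ac)
    moreover have "((\<lambda>s. q s i) has_real_derivative l (Inl i)) (at s)"
      "((\<lambda>s. q' s i) has_real_derivative l (Inr i)) (at s)"
      unfolding has_field_derivative_iff using l(2)[OF A(2)[OF i]] l(2)[OF A(3)[OF i]] unfolding f_def by auto
    ultimately show ?thesis by blast
  qed
  show ?thesis by (rule that[OF s0(1,2) main])
qed

section \<open>From matrices to entries\<close>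

text \<open>
  If the spectral radius were zero, the powers of every multiple of \<open>V\<close> would be bounded. But the row sums of the \<open>k\<close>-th
  power of \<open>(2 / c) V\<close>, where \<open>c\<close> is the least row sum of \<open>V\<close>, are at least \<open>2 ^ k\<close>.
\<close>

lemma spectral_radius_pos:
  fixes V :: "real mat"
  assumes V: "V \<in> carrier_mat n n" and n: "0 < n"
    and nonneg: "\<And>i j. i < n \<Longrightarrow> j < n \<Longrightarrow> 0 \<le> V $$ (i, j)"
    and rows: "\<And>i. i < n \<Longrightarrow> 0 < (\<Sum>j<n. V $$ (i, j))"
  shows "0 < rho V"
proof (rule ccontr)
  assume "\<not> 0 < rho V"
  then have r0: "rho V \<le> 0" by simp
  define c where "c = Min ((\<lambda>i. \<Sum>j<n. V $$ (i, j)) ` {..<n})"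
  have c0: "0 < c" unfolding c_def using rows n by (subst Min_gr_iff) auto
  have c_le: "c \<le> (\<Sum>j<n. V $$ (i, j))" if "i < n" for i
    unfolding c_def using that by (intro Min_le) auto
  define B where "B = (2 / c) \<cdot>\<^sub>m V"
  have B: "B \<in> carrier_mat n n" unfolding B_def using V by simp
  have Bij: "B $$ (i, j) = 2 / c * V $$ (i, j)" if "i < n" "j < n" for i j
    unfolding B_def using V that by simp
  define Vc where "Vc = map_mat complex_of_real V"
  define Bc where "Bc = map_mat complex_of_real B"
  have Vc: "Vc \<in> carrier_mat n n" and Bc: "Bc \<in> carrier_mat n n" unfolding Vc_def Bc_def using V B by auto
  have BV: "Bc = complex_of_real (2 / c) \<cdot>\<^sub>m Vc" unfolding Bc_def Vc_def B_def by (intro eq_matI) auto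
  have ev: "e = 0" if e: "e \<in> spectrum Bc" for e
  proof -
    obtain x where x: "x \<in> carrier_vec n" "x \<noteq> 0\<^sub>v n" "Bc *\<^sub>v x = e \<cdot>\<^sub>v x"
      using e Bc unfolding spectrum_def eigenvalue_def eigenvector_def by auto
    have "Vc *\<^sub>v x = complex_of_real (c / 2) \<cdot>\<^sub>v (Bc *\<^sub>v x)"
      by (rule eq_vecI) (use x(1) Vc c0 in \<open>auto simp: BV scalar_prod_def sum_distrib_left\<close>)
    also have "\<dots> = (complex_of_real (c / 2) * e) \<cdot>\<^sub>v x" unfolding x(3) by (simp add: smult_smult_assoc)
    finally have "complex_of_real (c / 2) * e \<in> spectrum Vc"
      using x Vc unfolding spectrum_def eigenvalue_def eigenvector_def by auto
    then have "norm (complex_of_real (c / 2) * e) \<le> rho V"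
      unfolding rho_def Vc_def[symmetric] by (rule spectral_radius_mem_max(2)[OF Vc n imageI])
    then have "norm (complex_of_real (c / 2) * e) = 0" using r0 by (metis norm_le_zero_iff norm_zero order_trans)
    then show ?thesis using c0 by simp
  qed
  have "spectral_radius Bc = 0" using spectral_radius_mem_max(1)[OF Bc n] ev by auto
  then obtain M where M: "\<And>k. norm_bound (Bc ^\<^sub>m k) M"
    using spectral_radius_jnf_norm_bound_less_1_upper_triangular[OF Bc] by auto
  have pow: "Bc ^\<^sub>m k = map_mat complex_of_real (B ^\<^sub>m k)" for k
    unfolding Bc_def by (rule of_real_hom.mat_hom_pow[OF B, symmetric])
  have grow: "(\<forall>i<n. \<forall>j<n. 0 \<le> (B ^\<^sub>m k) $$ (i, j)) \<and> (\<forall>i<n. 2 ^ k \<le> (\<Sum>j<n. (B ^\<^sub>m k) $$ (i, j)))" for k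
  proof (induction k)
    case 0
    then show ?case using B by (auto simp: one_mat_def)
  next
    case (Suc k)
    have e: "(B ^\<^sub>m Suc k) $$ (i, j) = (\<Sum>l<n. (B ^\<^sub>m k) $$ (i, l) * B $$ (l, j))" if "i < n" "j < n" for i j
      using B pow_carrier_mat[OF B, of k] that
      by (simp add: scalar_prod_def lessThan_atLeast0)
    have Bn: "0 \<le> B $$ (i, j)" if "i < n" "j < n" for i j using Bij nonneg that c0 by simp
    have two: "2 \<le> (\<Sum>j<n. B $$ (l, j))" if "l < n" for l
    proof -
      have "2 / c * c \<le> 2 / c * (\<Sum>j<n. V $$ (l, j))" using c_le[OF that] c0 by (intro mult_left_mono) auto
      then show ?thesis using Bij that c0 by (simp add: sum_distrib_left)
    qed
    have "2 ^ Suc k \<le> (\<Sum>j<n. (B ^\<^sub>m Suc k) $$ (i, j))" if i: "i < n" for i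
    proof -
      have "2 ^ Suc k \<le> (\<Sum>l<n. (B ^\<^sub>m k) $$ (i, l)) * 2" using Suc i by simp
      also have "\<dots> \<le> (\<Sum>l<n. (B ^\<^sub>m k) $$ (i, l) * (\<Sum>j<n. B $$ (l, j)))"
        unfolding sum_distrib_right using Suc i two by (intro sum_mono mult_left_mono) auto
      also have "\<dots> = (\<Sum>j<n. (B ^\<^sub>m Suc k) $$ (i, j))"
        unfolding sum_distrib_left by (subst sum.swap) (use i e in simp)
      finally show ?thesis .
    qed
    moreover have "0 \<le> (B ^\<^sub>m Suc k) $$ (i, j)" if "i < n" "j < n" for i j
      unfolding e[OF that] using Suc Bn that by (intro sum_nonneg mult_nonneg_nonneg) auto
    ultimately show ?case by blast
  qed
  obtain k where k: "n * M < 2 ^ k" using real_arch_pow[of 2 "n * M"] by auto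
  have "2 ^ k \<le> (\<Sum>j<n. (B ^\<^sub>m k) $$ (0, j))" using grow n by blast
  also have "\<dots> \<le> (\<Sum>j<n. M)"
  proof (rule sum_mono)
    fix j assume "j \<in> {..<n}"
    then have "norm ((Bc ^\<^sub>m k) $$ (0, j)) \<le> M"
      using M[of k] n carrier_matD[OF pow_carrier_mat[OF Bc, of k]] unfolding norm_bound_def
      by (metis lessThan_iff)
    moreover have "(Bc ^\<^sub>m k) $$ (0, j) = complex_of_real ((B ^\<^sub>m k) $$ (0, j))"
      unfolding pow using \<open>j \<in> {..<n}\<close> n carrier_matD[OF pow_carrier_mat[OF B, of k]]
      by (metis index_map_mat(1) lessThan_iff)
    ultimately show "(B ^\<^sub>m k) $$ (0, j) \<le> M" by simp
  qed
  finally show False using k by simp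
qed

text \<open>
  Otherwise the zero entries and the positive entries of \<open>x\<close> would be the sides of a zero rectangle with \<open>n\<close> elements.
\<close>

lemma invariant_positive:
  assumes z: "indecomposable n (\<lambda>i j. 0 < v i j)" and v: "\<And>i j. i < n \<Longrightarrow> j < n \<Longrightarrow> 0 \<le> v i j"
    and x: "\<And>i. i < n \<Longrightarrow> 0 \<le> x i" and pos: "\<And>i. i < n \<Longrightarrow> 0 < mv n v x i \<Longrightarrow> 0 < x i"
    and k: "k < n" "0 < x k" and i: "i < n"
  shows "0 < x i"
proof (rule ccontr)
  assume neg: "\<not> 0 < x i"
  define J where "J = {i. i < n \<and> 0 < x i}"
  define I where "I = {i. i < n \<and> \<not> 0 < x i}"
  have "{..<n} = I \<union> J" "I \<inter> J = {}" unfolding I_def J_def by auto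
  then have "n = card I + card J" by (metis I_def J_def card_Un_disjoint card_lessThan finite_Collect_conjI finite_Collect_less_nat)
  then have card: "n \<le> card I + card J" by simp
  have ne: "I \<subseteq> {..<n}" "J \<subseteq> {..<n}" "I \<noteq> {}" "J \<noteq> {}" using i neg k unfolding I_def J_def by auto
  from indecomposableD[OF z ne card] obtain p j where pj: "p \<in> I" "j \<in> J" "0 < v p j" .
  have "0 < v p j * x j" using pj unfolding J_def by simp
  also have "\<dots> \<le> mv n v x p" using pj x v unfolding I_def J_def by (intro mv_member) auto
  finally show False using pos[of p] pj unfolding I_def by auto
qed

lemma at_right_Ioo: "0 < d \<Longrightarrow> at (0::real) within {0<..<d} = at_right 0"
  by (rule at_within_nhd[where S = "{..<d}"]) auto

lemma mult_mat_vec_eq_mv: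
  assumes "V \<in> carrier_mat n n" "x \<in> carrier_vec n" "i < n"
  shows "(V *\<^sub>v x) $ i = mv n (\<lambda>i j. V $$ (i, j)) (\<lambda>j. x $ j) i"
    "(V\<^sup>T *\<^sub>v x) $ i = mv n (flip (\<lambda>i j. V $$ (i, j))) (\<lambda>j. x $ j) i"
  using assms by (auto simp: mv_def flip_def scalar_prod_def lessThan_atLeast0)

lemma regularized_solution_positive:
  assumes V: "V \<in> carrier_mat n n" and nonneg: "\<And>i j. i < n \<Longrightarrow> j < n \<Longrightarrow> 0 \<le> V $$ (i, j)"
    and t: "0 < t" and rs: "regularized_master_solution n V 0 t r r'"
  shows "regularized_sol n (\<lambda>i j. V $$ (i, j)) t (\<lambda>i. r $ i) (\<lambda>i. r' $ i)"
proof -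
  note rs = rs[unfolded regularized_master_solution_def]
  have c: "r \<in> carrier_vec n" "r' \<in> carrier_vec n" using rs by auto
  note mv = mult_mat_vec_eq_mv[OF V]
  show ?thesis
    unfolding regularized_sol_def
  proof (intro allI impI)
    fix i assume i: "i < n"
    define a where "a = (V\<^sup>T *\<^sub>v r) $ i"
    define b where "b = (V *\<^sub>v r') $ i"
    have nn: "0 \<le> a" "0 \<le> b" unfolding a_def b_def mv(1)[OF c(2) i] mv(2)[OF c(1) i]
      using nonneg rs i by (auto intro!: mv_nonneg simp: flip_def less_imp_le)
    have "r $ i = (a + t) / (0\<^sup>2 + (b + t) * (a + t))" "r' $ i = (b + t) / (0\<^sup>2 + (b + t) * (a + t))"
      using rs i unfolding a_def b_def by blast+
    then have "r $ i * (b + t) = 1" "r' $ i * (a + t) = 1" using nn t by auto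
    then show "0 < r $ i \<and> 0 < r' $ i \<and> r $ i * (mv n (\<lambda>i j. V $$ (i, j)) (\<lambda>i. r' $ i) i + t) = 1 \<and>
      r' $ i * (mv n (flip (\<lambda>i j. V $$ (i, j))) (\<lambda>i. r $ i) i + t) = 1"
      using rs i unfolding a_def b_def mv(1)[OF c(2) i] mv(2)[OF c(1) i] by blast
  qed
qed

lemma master_solution_positive:
  assumes V: "V \<in> carrier_mat n n" and nonneg: "\<And>i j. i < n \<Longrightarrow> j < n \<Longrightarrow> 0 \<le> V $$ (i, j)"
    and z: "indecomposable n (\<lambda>i j. 0 < V $$ (i, j))" and s: "0 < s"
    and q: "master_solution n V s q q'" and nz: "\<not> (q = 0\<^sub>v n \<and> q' = 0\<^sub>v n)"
  shows "master_sol n (\<lambda>i j. V $$ (i, j)) (s\<^sup>2) (\<lambda>i. q $ i) (\<lambda>i. q' $ i)"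
proof -
  note q = q[unfolded master_solution_def]
  have c: "q \<in> carrier_vec n" "q' \<in> carrier_vec n" using q by auto
  have qn: "0 \<le> q $ i" "0 \<le> q' $ i" if "i < n" for i using q that by auto
  define v where "v = (\<lambda>i j. V $$ (i, j))"
  define a where "a = mv n (flip v) (\<lambda>i. q $ i)"
  define b where "b = mv n v (\<lambda>i. q' $ i)"
  have ab: "(V\<^sup>T *\<^sub>v q) $ i = a i" "(V *\<^sub>v q') $ i = b i" if "i < n" for i
    unfolding a_def b_def v_def using mult_mat_vec_eq_mv[OF V _ that] c by auto
  have nn: "0 \<le> a i" "0 \<le> b i" if "i < n" for i
    unfolding a_def b_def v_def using nonneg q that by (auto intro!: mv_nonneg simp: flip_def)
  have den: "0 < s\<^sup>2 + b i * a i" if "i < n" for i using nn[OF that] s by (intro add_pos_nonneg) auto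
  have e: "q $ i = a i / (s\<^sup>2 + b i * a i)" "q' $ i = b i / (s\<^sup>2 + b i * a i)" if "i < n" for i
    using q that ab[OF that] by metis+
  have sums: "(\<Sum>i<n. q $ i) = (\<Sum>i<n. q' $ i)" using q by blast
  have zero_iff: "(\<Sum>i<n. x $ i) = 0 \<longleftrightarrow> x = 0\<^sub>v n"
    if "x \<in> carrier_vec n" "\<And>i. i < n \<Longrightarrow> 0 \<le> x $ i" for x :: "real vec"
    using that by (subst sum_nonneg_eq_0_iff) auto
  have ex: "\<exists>k<n. 0 < x $ k" if "x \<in> carrier_vec n" "\<And>i. i < n \<Longrightarrow> 0 \<le> x $ i" "x \<noteq> 0\<^sub>v n" for x :: "real vec"
  proof (rule ccontr)
    assume "\<not> ?thesis"
    then have "x $ k = 0" if "k < n" for k using \<open>\<And>i. i < n \<Longrightarrow> 0 \<le> x $ i\<close>[OF that] that by force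
    then show False using that by auto
  qed
  have "q \<noteq> 0\<^sub>v n" "q' \<noteq> 0\<^sub>v n" using zero_iff[OF c(1)] zero_iff[OF c(2)] sums nz q by auto
  then obtain k k' where k: "k < n" "0 < q $ k" "k' < n" "0 < q' $ k'" using ex c q by meson
  have q0: "0 < q $ i" if "i < n" for i
  proof (rule invariant_positive[where v = "flip v" and x = "\<lambda>i. q $ i" and k = k])
    show "indecomposable n (\<lambda>i j. 0 < flip v i j)" using indecomposable_transpose[OF z] by (simp add: flip_def v_def)
    show "0 < q $ i" if "i < n" "0 < mv n (flip v) (\<lambda>i. q $ i) i" for i
      using that den[OF that(1)] unfolding e(1)[OF that(1)] a_def by simp
  qed (use nonneg qn k that in \<open>auto simp: flip_def v_def\<close>)
  have q'0: "0 < q' $ i" if "i < n" for i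
  proof (rule invariant_positive[where v = v and x = "\<lambda>i. q' $ i" and k = k'])
    show "indecomposable n (\<lambda>i j. 0 < v i j)" using z by (simp add: v_def)
    show "0 < q' $ i" if "i < n" "0 < mv n v (\<lambda>i. q' $ i) i" for i
      using that den[OF that(1)] unfolding e(2)[OF that(1)] b_def by simp
  qed (use nonneg qn k that in \<open>auto simp: v_def\<close>)
  have "q $ i * (s\<^sup>2 + b i * a i) = a i" "q' $ i * (s\<^sup>2 + b i * a i) = b i" if "i < n" for i
    using e[OF that] den[OF that] by (simp_all add: field_simps)
  then show ?thesis unfolding master_sol_def using q0 q'0 sums unfolding a_def b_def v_def by blast
qed


section \<open>The density at the origin and the limits for fixed dimension\<close>

lemma radial_cdf_eq:
  assumes V: "V \<in> carrier_mat n n" and nonneg: "\<forall>i<n. \<forall>j<n. 0 \<le> V $$ (i, j)" and n: "0 < n"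
    and c: "q s \<in> carrier_vec n" "q' s \<in> carrier_vec n" and s: "0 < s"
    and ms: "master_sol n (\<lambda>i j. V $$ (i, j)) (s\<^sup>2) (\<lambda>i. q s $ i) (\<lambda>i. q' s $ i)"
  shows "radial_cdf n V q q' s
    = (\<Sum>i<n. s\<^sup>2 * (q' s $ i / mv n (\<lambda>i j. V $$ (i, j)) (\<lambda>i. q' s $ i) i)) / n"
proof -
  define v where "v = (\<lambda>i j. V $$ (i, j))"
  have s2: "0 < s\<^sup>2" using s by simp
  note F = master_sol_facts[OF ms nonneg s2, folded v_def]
  have "q s \<bullet> (V *\<^sub>v q' s) = (\<Sum>i<n. q s $ i * (V *\<^sub>v q' s) $ i)"
    using V c by (simp add: scalar_prod_def lessThan_atLeast0)
  also have "\<dots> = (\<Sum>i<n. q s $ i * mv n v (\<lambda>i. q' s $ i) i)"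
    unfolding v_def by (intro sum.cong refl) (simp add: mult_mat_vec_eq_mv(1)[OF V c(2)])
  also have "\<dots> = (\<Sum>i<n. 1 - s\<^sup>2 * (q' s $ i / mv n v (\<lambda>i. q' s $ i) i))"
  proof (intro sum.cong refl)
    fix i assume "i \<in> {..<n}"
    then have i: "i < n" by simp
    show "q s $ i * mv n v (\<lambda>i. q' s $ i) i = 1 - s\<^sup>2 * (q' s $ i / mv n v (\<lambda>i. q' s $ i) i)"
      using F(3,7)[OF i] by (simp add: field_simps)
  qed
  also have "\<dots> = n - (\<Sum>i<n. s\<^sup>2 * (q' s $ i / mv n v (\<lambda>i. q' s $ i) i))" by (simp add: sum_subtractf)
  finally show ?thesis unfolding radial_cdf_def v_def[symmetric] using n by (simp add: field_simps)
qed

text \<open>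
  With \<open>b = mv n v q'\<close>, \<open>F s\<close> is the mean of \<open>s\<^sup>2 * (q' i / b i)\<close>. Dividing its derivative by \<open>2 \<pi> s\<close> leaves \<open>1 / \<pi>\<close>
  times the mean of \<open>q' i / b i\<close>, which tends to \<open>x i * y i\<close> because \<open>b i\<close> tends to \<open>1 / x i\<close>, and a term
  with the derivative of \<open>q' i / b i\<close> times \<open>s\<close>, which vanishes in the limit.
\<close>

lemma density_limit:
  assumes V: "V \<in> carrier_mat n n" and nonneg: "\<forall>i<n. \<forall>j<n. 0 \<le> V $$ (i, j)" and n: "0 < n"
    and z: "indecomposable n (\<lambda>i j. 0 < V $$ (i, j))"
    and rho: "0 < rho V" and s1: "0 < s1"
    and c: "\<And>s. 0 < s \<Longrightarrow> s < s1 \<Longrightarrow> q s \<in> carrier_vec n \<and> q' s \<in> carrier_vec n"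
    and ms: "\<And>s. 0 < s \<Longrightarrow> s < s1 \<Longrightarrow> master_sol n (\<lambda>i j. V $$ (i, j)) (s\<^sup>2) (\<lambda>i. q s $ i) (\<lambda>i. q' s $ i)"
    and xy: "approx_scaling n (\<lambda>i j. V $$ (i, j)) 0 x y"
    and lim: "\<And>i. i < n \<Longrightarrow> ((\<lambda>s. q s $ i) \<longlongrightarrow> x i) (at_right 0)"
    and lim': "\<And>i. i < n \<Longrightarrow> ((\<lambda>s. q' s $ i) \<longlongrightarrow> y i) (at_right 0)"
  shows "(radial_cdf n V q q' \<longlongrightarrow> 0) (at_right 0)"
    "(mu_density n V q q' \<longlongrightarrow> 1 / (pi * n) * (\<Sum>i<n. x i * y i)) (at 0)"
proof -
  define v where "v = (\<lambda>i j. V $$ (i, j))"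
  define b where "b s = mv n v (\<lambda>i. q' s $ i)" for s
  define F where "F s = (\<Sum>i<n. s\<^sup>2 * (q' s $ i / b s i)) / n" for s
  note E = exact_scaling[OF xy, folded v_def]
  have F: "radial_cdf n V q q' s = F s" if "0 < s" "s < s1" for s
    unfolding F_def b_def v_def using radial_cdf_eq[where q = q and q' = q', OF V nonneg n conjunct1[OF c[OF that]] conjunct2[OF c[OF that]] that(1) ms[OF that]] .
  have lim_b: "((\<lambda>s. b s i) \<longlongrightarrow> 1 / x i) (at_right 0)" if i: "i < n" for i
  proof -
    have "mv n v y i = 1 / x i" using E(1,3)[OF i] by (simp add: field_simps)
    then show ?thesis unfolding b_def
      using mv_tendsto[of n "\<lambda>s i. q' s $ i" y "at_right 0" v i] lim' by simp
  qed
  have x0: "x i \<noteq> 0" if "i < n" for i using E(1)[OF that] by simp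
  have s_lim: "((\<lambda>s::real. s) \<longlongrightarrow> 0) (at_right 0)" by (rule tendsto_ident_at)
  have near: "\<forall>\<^sub>F s in at_right 0. 0 < s \<and> s < d" if "0 < d" for d :: real
    using that by (auto simp: eventually_at_right_field intro: exI[of _ d])
  have "(F \<longlongrightarrow> (\<Sum>i<n. 0\<^sup>2 * (y i / (1 / x i))) / n) (at_right 0)"
    unfolding F_def using x0 n by (intro tendsto_intros lim' lim_b s_lim) auto
  then have "(F \<longlongrightarrow> 0) (at_right 0)" by simp
  then show "(radial_cdf n V q q' \<longlongrightarrow> 0) (at_right 0)"
    by (rule Lim_transform_eventually) (use near[OF s1] F in \<open>auto elim: eventually_mono\<close>)
  obtain s0 L where s0: "0 < s0" "s0 \<le> s1" and der:
    "\<And>s i. 0 < s \<Longrightarrow> s < s0 \<Longrightarrow> i < n \<Longrightarrow>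
       (\<exists>D. ((\<lambda>s. q s $ i) has_real_derivative D) (at s) \<and> \<bar>D\<bar> \<le> L * s) \<and>
       (\<exists>D. ((\<lambda>s. q' s $ i) has_real_derivative D) (at s) \<and> \<bar>D\<bar> \<le> L * s)"
    using master_differentiable[OF z n nonneg xy s1 ms lim lim'] by blast
  \<comment> \<open>A choice of derivatives, so that their limit at 0 can be taken.\<close>
  define D where "D s i = (SOME D. ((\<lambda>s. q' s $ i) has_real_derivative D) (at s) \<and> \<bar>D\<bar> \<le> L * s)" for s i
  have D: "((\<lambda>s. q' s $ i) has_real_derivative D s i) (at s)" "\<bar>D s i\<bar> \<le> L * s"
    if "0 < s" "s < s0" "i < n" for s i
    using someI_ex[OF conjunct2[OF der[OF that]]] unfolding D_def by auto
  have D0: "((\<lambda>s. D s i) \<longlongrightarrow> 0) (at_right 0)" if i: "i < n" for i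
  proof (rule Lim_null_comparison)
    show "\<forall>\<^sub>F s in at_right 0. norm (D s i) \<le> L * s"
      using near[OF s0(1)] by eventually_elim (use D(2) i in auto)
    have "((\<lambda>s. L * s) \<longlongrightarrow> L * 0) (at_right 0)" by (intro tendsto_intros s_lim)
    then show "((\<lambda>s. L * s) \<longlongrightarrow> 0) (at_right 0)" by simp
  qed
  \<comment> \<open>\<open>H s i\<close> is the derivative of \<open>q' s $ i / b s i\<close>, and \<open>F'\<close> that of \<open>F\<close>.\<close>
  define H where "H s i = (D s i * b s i - q' s $ i * mv n v (D s) i) / (b s i * b s i)" for s i
  define F' where "F' s = (\<Sum>i<n. 2 * s * (q' s $ i / b s i) + s\<^sup>2 * H s i) / n" for s
  have derF: "(F has_real_derivative F' s) (at s)" if s: "0 < s" "s < s0" for s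
  proof -
    have "b s i \<noteq> 0" if i: "i < n" for i
      using master_sol_facts(3)[OF ms nonneg _ i, of s] s s0 unfolding b_def v_def by simp
    note b0 = this
    have Db: "((\<lambda>s. b s i) has_real_derivative mv n v (D s) i) (at s)" for i
      unfolding b_def mv_def by (intro DERIV_sum DERIV_cmult D(1)[OF s]) auto
    have sq: "((\<lambda>s. s\<^sup>2) has_real_derivative 2 * s) (at s)" by (auto intro!: derivative_eq_intros)
    have "((\<lambda>s. q' s $ i / b s i) has_real_derivative H s i) (at s)" if i: "i < n" for i
      unfolding H_def by (rule DERIV_divide[OF D(1)[OF s i] Db b0[OF i]])
    then have "((\<lambda>s. s\<^sup>2 * (q' s $ i / b s i)) has_real_derivative 2 * s * (q' s $ i / b s i) + s\<^sup>2 * H s i) (at s)" if "i < n" for i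
      by (rule DERIV_cong[OF DERIV_mult[OF sq]]) (use that in auto)
    then show ?thesis unfolding F_def F'_def by (intro DERIV_cdivide DERIV_sum) auto
  qed
  have deriv: "deriv (radial_cdf n V q q') s = F' s" if s: "0 < s" "s < s0" for s
  proof (rule DERIV_imp_deriv, rule has_field_derivative_transform_within_open[OF derF[OF s]])
    show "open {0<..<s0}" "s \<in> {0<..<s0}" using s by auto
    show "F t = radial_cdf n V q q' t" if "t \<in> {0<..<s0}" for t using F[of t] that s0 by simp
  qed
  have H0: "((\<lambda>s. s * H s i) \<longlongrightarrow> 0) (at_right 0)" if i: "i < n" for i
  proof -
    have "((\<lambda>s. mv n v (D s) i) \<longlongrightarrow> mv n v (\<lambda>i. 0) i) (at_right 0)" by (intro mv_tendsto D0)
    then have mvD: "((\<lambda>s. mv n v (D s) i) \<longlongrightarrow> 0) (at_right 0)" by (simp add: mv_def)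
    have "((\<lambda>s. s * H s i) \<longlongrightarrow> 0 * ((0 * (1 / x i) - y i * 0) / (1 / x i * (1 / x i)))) (at_right 0)"
      unfolding H_def using x0[OF i] by (intro tendsto_intros s_lim D0 lim_b lim' mvD i) auto
    then show ?thesis by simp
  qed
  have "((\<lambda>s. 1 / (pi * n) * (\<Sum>i<n. q' s $ i / b s i + s * H s i / 2)) \<longlongrightarrow>
     1 / (pi * n) * (\<Sum>i<n. y i / (1 / x i) + 0 / 2)) (at_right 0)"
    using x0 by (intro tendsto_intros H0 lim' lim_b) auto
  moreover have "(\<Sum>i<n. y i / (1 / x i) + 0 / 2) = (\<Sum>i<n. x i * y i)" by (simp add: mult.commute)
  ultimately have T: "((\<lambda>s. 1 / (pi * n) * (\<Sum>i<n. q' s $ i / b s i + s * H s i / 2)) \<longlongrightarrow>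
     1 / (pi * n) * (\<Sum>i<n. x i * y i)) (at_right 0)" by simp
  have cm: "filterlim cmod (at_right 0) (at 0)"
    unfolding filterlim_at using tendsto_norm_zero[OF tendsto_ident_at[of "0::complex" UNIV]]
    by (auto simp: eventually_at_filter)
  show "(mu_density n V q q' \<longlongrightarrow> 1 / (pi * n) * (\<Sum>i<n. x i * y i)) (at 0)"
  proof (rule Lim_transform_eventually[OF filterlim_compose[OF T cm]])
    define d where "d = min s0 (sqrt (rho V))"
    have "0 < d" unfolding d_def using s0 rho by simp
    have "\<forall>\<^sub>F w in at 0. 0 < cmod w \<and> cmod w < d"
      using cm near[OF \<open>0 < d\<close>] unfolding filterlim_iff by blast
    then show "\<forall>\<^sub>F w in at 0. 1 / (pi * n) * (\<Sum>i<n. q' (cmod w) $ i / b (cmod w) i + cmod w * H (cmod w) i / 2)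
        = mu_density n V q q' w"
    proof eventually_elim
      case (elim w)
      define s where "s = cmod w"
      have s: "0 < s" "s < s0" "s \<noteq> sqrt (rho V)" using elim unfolding s_def d_def by auto
      have "F' s = 2 * s * ((\<Sum>i<n. q' s $ i / b s i + s * H s i / 2) / n)"
        unfolding F'_def by (simp add: sum_distrib_left distrib_left power2_eq_square mult_ac)
      then have "1 / (2 * pi * s) * F' s = 1 / (pi * n) * (\<Sum>i<n. q' s $ i / b s i + s * H s i / 2)"
        using s by simp
      then show ?case unfolding mu_density_def s_def[symmetric] using s deriv[OF s(1,2)] by simp
    qed
  qed
qed

lemma min_positive_entry:
  fixes n :: nat
  obtains \<beta> :: real where "0 < \<beta>" "\<And>i j. i < n \<Longrightarrow> j < n \<Longrightarrow> 0 < v i j \<Longrightarrow> \<beta> \<le> v i j"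
proof -
  define E where "E = (\<lambda>(i, j). v i j) ` ({..<n} \<times> {..<n})"
  \<comment> \<open>The element 1 is there because the set of positive entries may be empty.\<close>
  define W where "W = insert 1 {w \<in> E. 0 < w}"
  have "finite E" unfolding E_def by (intro finite_imageI finite_cartesian_product finite_lessThan)
  then have fin: "finite W" unfolding W_def by simp
  have "0 < Min W" using fin unfolding W_def by (subst Min_gr_iff) auto
  moreover have "Min W \<le> v i j" if "i < n" "j < n" "0 < v i j" for i j
    using fin that unfolding W_def E_def by (intro Min_le) auto
  ultimately show ?thesis using that by blast
qed

text \<open>
  For small \<open>s\<close> and \<open>t\<close> both \<open>(q, q')\<close> and \<open>(r, r')\<close> are approximate scalings with the \<open>\<epsilon>\<close> required for the a priori
  bounds, and their row and column sums tend to 1. So both converge to an exact scaling, and there is only one.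
\<close>

lemma fixed_dimension:
  assumes bp: "block_profile K \<phi> \<sigma> n z I (\<lambda>i j. V $$ (i, j))" and K: "0 < K" and \<phi>: "0 < \<phi>" and \<sigma>: "0 < \<sigma>"
    and V: "V \<in> carrier_mat n n"
    and r: "is_r n V r r'" and q: "is_q n V q q'" and \<mu>: "is_mu n V q q' M"
  obtains x y where "approx_scaling n (\<lambda>i j. V $$ (i, j)) 0 x y"
    "\<And>i. i < n \<Longrightarrow> ((\<lambda>t. r 0 t $ i) \<longlongrightarrow> x i) (at_right 0)"
    "\<And>i. i < n \<Longrightarrow> ((\<lambda>t. r' 0 t $ i) \<longlongrightarrow> y i) (at_right 0)"
    "\<And>i. i < n \<Longrightarrow> ((\<lambda>s. q s $ i) \<longlongrightarrow> x i) (at_right 0)"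
    "\<And>i. i < n \<Longrightarrow> ((\<lambda>s. q' s $ i) \<longlongrightarrow> y i) (at_right 0)"
    "measure M {0} = 0"
    "(mu_density n V q q' \<longlongrightarrow> 1 / (pi * n) * (\<Sum>i<n. x i * y i)) (at 0)"
proof -
  define v where "v = (\<lambda>i j. V $$ (i, j))"
  have n: "0 < n" using bp unfolding block_profile_def by blast
  have vb: "0 \<le> v i j \<and> v i j \<le> \<sigma> / n" if "i < n" "j < n" for i j
    using bp that unfolding block_profile_def v_def by blast
  have v0: "\<And>i j. i < n \<Longrightarrow> j < n \<Longrightarrow> 0 \<le> v i j" using vb by blast
  have nonneg: "\<And>i j. i < n \<Longrightarrow> j < n \<Longrightarrow> 0 \<le> V $$ (i, j)" using v0 unfolding v_def .
  have z: "indecomposable n (\<lambda>i j. 0 < v i j)" using block_profile_indecomposable[OF bp \<phi>] unfolding v_def .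
  have zt: "indecomposable n (\<lambda>i j. 0 < flip v i j)" using indecomposable_transpose[OF z] by (simp add: flip_def)
  have \<sigma>n: "0 < \<sigma> / n" using \<sigma> n by simp
  obtain \<beta> where \<beta>: "0 < \<beta>" "\<And>i j. i < n \<Longrightarrow> j < n \<Longrightarrow> 0 < v i j \<Longrightarrow> \<beta> \<le> v i j"
    using min_positive_entry[of n v] by blast
  \<comment> \<open>The tolerance of \<open>approx_scaling_bounds\<close>.\<close>
  define \<epsilon> where "\<epsilon> = 1 / (4 * real K)"
  have \<epsilon>: "0 < \<epsilon>" "\<epsilon> \<le> 1" unfolding \<epsilon>_def using K by auto
  obtain c U where c: "0 < c" and bounds: "\<And>x y i. approx_scaling n v \<epsilon> x y \<Longrightarrow> i < n \<Longrightarrow>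
      c \<le> x i \<and> x i \<le> U \<and> c \<le> y i \<and> y i \<le> U"
    using approx_scaling_bounds[OF K \<phi> \<sigma>] bp unfolding v_def \<epsilon>_def by metis
  have s_lim: "((\<lambda>s::real. s) \<longlongrightarrow> 0) (at_right 0)" by (rule tendsto_ident_at)
  have near: "\<forall>\<^sub>F s in at_right 0. 0 < s \<and> s < d" if "0 < d" for d :: real
    using that by (auto simp: eventually_at_right_field intro: exI[of _ d])

  obtain L1 where L1: "0 < L1"
    "\<And>t r r' i. 0 < t \<Longrightarrow> t * L1 \<le> 1 \<Longrightarrow> regularized_sol n v t r r' \<Longrightarrow> i < n \<Longrightarrow> r' i \<le> L1"
    using regularized_bounded_above[OF z n \<sigma>n \<beta>(1) vb \<beta>(2)] by blast
  have vbt: "\<And>i j. i < n \<Longrightarrow> j < n \<Longrightarrow> 0 \<le> flip v i j \<and> flip v i j \<le> \<sigma> / n" using vb by (simp add: flip_def)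
  have \<beta>t: "\<And>i j. i < n \<Longrightarrow> j < n \<Longrightarrow> 0 < flip v i j \<Longrightarrow> \<beta> \<le> flip v i j" using \<beta>(2) by (simp add: flip_def)
  obtain L2 where L2: "0 < L2"
    "\<And>t r r' i. 0 < t \<Longrightarrow> t * L2 \<le> 1 \<Longrightarrow> regularized_sol n (flip v) t r r' \<Longrightarrow> i < n \<Longrightarrow> r' i \<le> L2"
    using regularized_bounded_above[OF zt n \<sigma>n \<beta>(1) vbt \<beta>t] by blast
  \<comment> \<open>For \<open>t < t1\<close> the deficits \<open>t * r\<close> and \<open>t * r'\<close> are at most \<open>\<epsilon>\<close>.\<close>
  define t1 where "t1 = \<epsilon> / (L1 + L2)"
  have t1: "0 < t1" unfolding t1_def using \<epsilon> L1 L2 by simp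
  define R where "R t i = r 0 t $ i" for t i
  define R' where "R' t i = r' 0 t $ i" for t i
  have rs: "regularized_sol n v t (R t) (R' t)" if "0 < t" for t
    unfolding v_def R_def R'_def using r that unfolding is_r_def
    by (intro regularized_solution_positive[OF V nonneg that]) auto
  have tL: "t * L1 \<le> \<epsilon>" "t * L2 \<le> \<epsilon>" if "0 < t" "t < t1" for t
  proof -
    have "t * (L1 + L2) \<le> \<epsilon>" using that L1 L2 unfolding t1_def by (simp add: field_simps)
    moreover have "0 \<le> t * L1" "0 \<le> t * L2" using that L1 L2 by auto
    ultimately show "t * L1 \<le> \<epsilon>" "t * L2 \<le> \<epsilon>" unfolding distrib_left by linarith+
  qed
  have Rle: "R t i \<le> L2" "R' t i \<le> L1" if "0 < t" "t < t1" "i < n" for t i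
    using L1(2)[OF that(1) _ rs[OF that(1)] that(3)] L2(2)[OF that(1) _ regularized_sol_transpose[OF rs[OF that(1)]] that(3)]
      tL[OF that(1,2)] \<epsilon> by auto
  have Rp: "R t i * mv n v (R' t) i = 1 - t * R t i" "R' t i * mv n (flip v) (R t) i = 1 - t * R' t i"
    "0 < R t i" "0 < R' t i"
    if "0 < t" "i < n" for t i
    using rs[OF that(1)] that(2) unfolding regularized_sol_def by (auto simp: algebra_simps)
  have tR: "t * R t i \<le> t * L2" "t * R' t i \<le> t * L1" if "0 < t" "t < t1" "i < n" for t i
    using Rle[OF that] that by auto
  have Rap: "approx_scaling n v \<epsilon> (R t) (R' t)" if t: "0 < t" "t < t1" for t
    unfolding approx_scaling_def
  proof (intro conjI allI impI)
    fix i assume i: "i < n"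
    show "0 < R t i" "0 < R' t i" using Rp[OF t(1) i] by auto
    have "0 \<le> t * R t i" "0 \<le> t * R' t i" using Rp[OF t(1) i] t by auto
    then show "1 - \<epsilon> \<le> R t i * mv n v (R' t) i" "R t i * mv n v (R' t) i \<le> 1"
      "1 - \<epsilon> \<le> R' t i * mv n (flip v) (R t) i" "R' t i * mv n (flip v) (R t) i \<le> 1"
      unfolding Rp(1,2)[OF t(1) i] using tR[OF t i] tL[OF t] by linarith+
  qed (rule regularized_sol_sum[OF rs[OF t(1)] t(1)])
  have tendsto_one: "(f \<longlongrightarrow> 1) (at_right 0)"
    if "0 < d" "\<And>s. 0 < s \<Longrightarrow> s < d \<Longrightarrow> 1 - s * C \<le> f s \<and> f s \<le> 1" for f :: "real \<Rightarrow> real" and C d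
  proof (rule tendsto_sandwich)
    show "\<forall>\<^sub>F s in at_right 0. 1 - s * C \<le> f s" "\<forall>\<^sub>F s in at_right 0. f s \<le> 1"
      using near[OF that(1)] by (eventually_elim, use that(2) in auto)+
    have "((\<lambda>s. 1 - s * C) \<longlongrightarrow> 1 - 0 * C) (at_right 0)" by (intro tendsto_intros s_lim)
    then show "((\<lambda>s. 1 - s * C) \<longlongrightarrow> 1) (at_right 0)" by simp
  qed simp
  have nt: "at (0::real) within {0<..<d} \<noteq> bot" if "0 < d" for d
    unfolding at_right_Ioo[OF that] by simp
  have "\<exists>x y. approx_scaling n v 0 x y \<and> (\<forall>i<n. ((\<lambda>t. R t i) \<longlongrightarrow> x i) (at_right 0)) \<and>
    (\<forall>i<n. ((\<lambda>t. R' t i) \<longlongrightarrow> y i) (at_right 0))"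
  proof (rule scaling_limit[OF z v0 nt[OF t1] c, of R U R'], unfold at_right_Ioo[OF t1])
    show "((\<lambda>t. R t i * mv n v (R' t) i) \<longlongrightarrow> 1) (at_right 0)" if i: "i < n" for i
    proof (rule tendsto_one[OF t1, where C = L2])
      fix t assume t: "0 < t" "t < t1"
      then have "0 \<le> t * R t i" using Rp[OF t(1) i] by simp
      then show "1 - t * L2 \<le> R t i * mv n v (R' t) i \<and> R t i * mv n v (R' t) i \<le> 1"
        unfolding Rp(1)[OF t(1) i] using tR[OF t i] by simp
    qed
    show "((\<lambda>t. R' t i * mv n (flip v) (R t) i) \<longlongrightarrow> 1) (at_right 0)" if i: "i < n" for i
    proof (rule tendsto_one[OF t1, where C = L1])
      fix t assume t: "0 < t" "t < t1"
      then have "0 \<le> t * R' t i" using Rp[OF t(1) i] by simp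
      then show "1 - t * L1 \<le> R' t i * mv n (flip v) (R t) i \<and> R' t i * mv n (flip v) (R t) i \<le> 1"
        unfolding Rp(2)[OF t(1) i] using tR[OF t i] by simp
    qed
    show "sum (R t) {..<n} = sum (R' t) {..<n}" if "t \<in> {0<..<t1}" for t
      using regularized_sol_sum[OF rs] that by simp
    show "c \<le> R t i \<and> R t i \<le> U \<and> c \<le> R' t i \<and> R' t i \<le> U" if "t \<in> {0<..<t1}" "i < n" for t i
      using bounds[OF Rap] that by simp
  qed blast+
  then obtain x y where xy: "approx_scaling n v 0 x y"
    and Rx: "\<And>i. i < n \<Longrightarrow> ((\<lambda>t. R t i) \<longlongrightarrow> x i) (at_right 0)"
    and Ry: "\<And>i. i < n \<Longrightarrow> ((\<lambda>t. R' t i) \<longlongrightarrow> y i) (at_right 0)" by blast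

  obtain L where L: "0 < L"
    "\<And>u q q' i. 0 < u \<Longrightarrow> u * L \<le> 1 \<Longrightarrow> master_sol n v u q q' \<Longrightarrow> i < n \<Longrightarrow> 1 - L * u \<le> q i * mv n v q' i"
    using master_near_scaling[OF z n \<sigma>n \<beta>(1) vb \<beta>(2)] by blast
  have rho: "0 < rho V"
  proof (rule spectral_radius_pos[OF V n nonneg])
    fix i assume i: "i < n"
    obtain j where j: "j < n" "0 < v i j" using indecomposable_row[OF z i] by blast
    then have "v i j \<le> (\<Sum>j<n. v i j)" using v0 i by (intro member_le_sum) auto
    then show "0 < (\<Sum>j<n. V $$ (i, j))" using j unfolding v_def by simp
  qed
  \<comment> \<open>Below \<open>sqrt (rho V)\<close> the given solution is nonzero; \<open>s \<le> 1\<close> allows to replace \<open>s\<^sup>2\<close> by \<open>s\<close>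
    in the deficit.\<close>
  define s1 where "s1 = min 1 (min (sqrt (rho V)) (\<epsilon> / L))"
  have s1: "0 < s1" unfolding s1_def using rho \<epsilon> L by simp
  define S where "S s i = q s $ i" for s i
  define S' where "S' s i = q' s $ i" for s i
  have qs: "master_solution n V s (q s) (q' s)" "\<not> (q s = 0\<^sub>v n \<and> q' s = 0\<^sub>v n)" if "0 < s" "s < s1" for s
    using q that unfolding is_q_def s1_def by auto
  have qc: "q s \<in> carrier_vec n \<and> q' s \<in> carrier_vec n" if "0 < s" "s < s1" for s
    using qs(1)[OF that] unfolding master_solution_def by blast
  have ms: "master_sol n v (s\<^sup>2) (S s) (S' s)" if "0 < s" "s < s1" for s
    unfolding v_def S_def S'_def by (rule master_solution_positive[OF V nonneg z[unfolded v_def] that(1) qs[OF that]])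
  have v0': "\<forall>i<n. \<forall>j<n. 0 \<le> v i j" using v0 by blast
  have sL: "1 - s * L \<le> S s i * mv n v (S' s) i" "S s i * mv n v (S' s) i \<le> 1"
    "S' s i * mv n (flip v) (S s) i = S s i * mv n v (S' s) i" "s * L \<le> \<epsilon>"
    if s: "0 < s" "s < s1" and i: "i < n" for s i
  proof -
    have s2: "0 < s\<^sup>2" "s\<^sup>2 \<le> s" using s unfolding s1_def by (auto simp: power2_eq_square mult_le_cancel_left1)
    have "s < \<epsilon> / L" using s unfolding s1_def by simp
    then show sl: "s * L \<le> \<epsilon>" using L(1) by (simp add: field_simps)
    have le: "s\<^sup>2 * L \<le> s * L" using s2 L(1) by (intro mult_right_mono) auto
    have "1 - L * s\<^sup>2 \<le> S s i * mv n v (S' s) i"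
      using L(2)[OF s2(1) _ ms[OF s] i] le sl \<epsilon> by linarith
    then show "1 - s * L \<le> S s i * mv n v (S' s) i" using le by (simp add: mult.commute)
    show "S s i * mv n v (S' s) i \<le> 1" "S' s i * mv n (flip v) (S s) i = S s i * mv n v (S' s) i"
      using master_sol_facts(5,6)[OF ms[OF s] v0' s2(1) i] by auto
  qed
  have Ssum: "sum (S s) {..<n} = sum (S' s) {..<n}" if "0 < s" "s < s1" for s
    using ms[OF that] unfolding master_sol_def by blast
  have Sap: "approx_scaling n v \<epsilon> (S s) (S' s)" if s: "0 < s" "s < s1" for s
    unfolding approx_scaling_def
  proof (intro conjI allI impI)
    fix i assume i: "i < n"
    show "0 < S s i" "0 < S' s i" using ms[OF s] i unfolding master_sol_def by blast+
    show "1 - \<epsilon> \<le> S s i * mv n v (S' s) i" "S s i * mv n v (S' s) i \<le> 1"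
      "1 - \<epsilon> \<le> S' s i * mv n (flip v) (S s) i" "S' s i * mv n (flip v) (S s) i \<le> 1"
      using sL[OF s i] by linarith+
  qed (rule Ssum[OF s])
  have "\<exists>x y. approx_scaling n v 0 x y \<and> (\<forall>i<n. ((\<lambda>s. S s i) \<longlongrightarrow> x i) (at_right 0)) \<and>
    (\<forall>i<n. ((\<lambda>s. S' s i) \<longlongrightarrow> y i) (at_right 0))"
  proof (rule scaling_limit[OF z v0 nt[OF s1] c, of S U S'], unfold at_right_Ioo[OF s1])
    show "((\<lambda>s. S s i * mv n v (S' s) i) \<longlongrightarrow> 1) (at_right 0)" if i: "i < n" for i
      by (rule tendsto_one[OF s1, where C = L]) (use sL i in auto)
    show "((\<lambda>s. S' s i * mv n (flip v) (S s) i) \<longlongrightarrow> 1) (at_right 0)" if i: "i < n" for i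
      by (rule tendsto_one[OF s1, where C = L]) (use sL i in auto)
    show "sum (S s) {..<n} = sum (S' s) {..<n}" if "s \<in> {0<..<s1}" for s
      using Ssum that by simp
    show "c \<le> S s i \<and> S s i \<le> U \<and> c \<le> S' s i \<and> S' s i \<le> U" if "s \<in> {0<..<s1}" "i < n" for s i
      using bounds[OF Sap] that by simp
  qed blast+
  then obtain x' y' where xy': "approx_scaling n v 0 x' y'"
    and Sx': "\<And>i. i < n \<Longrightarrow> ((\<lambda>s. S s i) \<longlongrightarrow> x' i) (at_right 0)"
    and Sy': "\<And>i. i < n \<Longrightarrow> ((\<lambda>s. S' s i) \<longlongrightarrow> y' i) (at_right 0)" by blast
  have same: "x i = x' i" "y i = y' i" if "i < n" for i
    using scaling_unique[OF z v0 xy xy' that] by auto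
  have Sx: "((\<lambda>s. q s $ i) \<longlongrightarrow> x i) (at_right 0)" if "i < n" for i
    using Sx'[OF that] same[OF that] unfolding S_def by simp
  have Sy: "((\<lambda>s. q' s $ i) \<longlongrightarrow> y i) (at_right 0)" if "i < n" for i
    using Sy'[OF that] same[OF that] unfolding S'_def by simp
  note dl = density_limit[OF V v0'[unfolded v_def] n z[unfolded v_def] rho s1 qc
      ms[unfolded v_def S_def S'_def] xy[unfolded v_def] Sx Sy]
  have "measure M {0} \<le> 0"
  proof (rule tendsto_lowerbound[OF dl(1)])
    have M: "prob_space M" "sets M = sets borel" and cdf: "\<And>s. 0 < s \<Longrightarrow> measure M {z. cmod z \<le> s} = radial_cdf n V q q' s"
      using \<mu> unfolding is_mu_def by auto
    interpret prob_space M by (fact M)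
    show "\<forall>\<^sub>F s in at_right 0. measure M {0} \<le> radial_cdf n V q q' s"
      using near[OF s1]
    proof eventually_elim
      case (elim s)
      have "closed {z. cmod z \<le> s}" by (intro closed_Collect_le continuous_intros)
      then have "{z. cmod z \<le> s} \<in> sets M" unfolding M(2) by (rule borel_closed)
      then have "measure M {0} \<le> measure M {z. cmod z \<le> s}" using elim by (intro finite_measure_mono) auto
      then show ?case using cdf elim by simp
    qed
    show "at_right (0::real) \<noteq> bot" by (rule trivial_limit_at_right_real)
  qed
  then have m0: "measure M {0} = 0" using measure_nonneg[of M "{0}"] by linarith
  show ?thesis
    by (rule that[OF xy[unfolded v_def] _ _ Sx Sy m0 dl(2)]) (use Rx Ry in \<open>auto simp: R_def R'_def\<close>)
qed

lemma block_profile_of_variance_profile: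
  assumes dev: "standard_deviation_profile n A" and bound: "\<And>i j. i < n \<Longrightarrow> j < n \<Longrightarrow> A $$ (i, j) \<le> \<sigma>"
    and V: "V = variance_profile n A" and n: "0 < n" and K: "K dvd n"
    and Z: "fully_indecomposable K Z" "\<forall>i<K. \<forall>j<K. Z $$ (i, j) \<in> {0, 1}"
    and I: "(\<Union>i<K. I i) = {..<n}" "disjoint_family_on I {..<K}" "\<forall>i<K. card (I i) = n div K"
    and low: "\<forall>i<K. \<forall>j<K. \<forall>x\<in>I i. \<forall>y\<in>I j. V $$ (x, y) \<ge> \<phi> / real n * Z $$ (i, j)"
  shows "block_profile K \<phi> (\<sigma>\<^sup>2) n (\<lambda>k l. Z $$ (k, l) \<noteq> 0) I (\<lambda>i j. V $$ (i, j))"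
  unfolding block_profile_def
proof (intro conjI allI impI ballI)
  show "indecomposable K (\<lambda>k l. Z $$ (k, l) \<noteq> 0)"
    using Z(1) unfolding indecomposable_def fully_indecomposable_def by blast
  fix i j assume ij: "i < n" "j < n"
  have Vij: "V $$ (i, j) = (A $$ (i, j))\<^sup>2 / n" using ij unfolding V variance_profile_def by simp
  then show "0 \<le> V $$ (i, j)" by simp
  have "(A $$ (i, j))\<^sup>2 \<le> \<sigma>\<^sup>2"
    using dev bound[OF ij] ij unfolding standard_deviation_profile_def by (intro power_mono) auto
  then show "V $$ (i, j) \<le> \<sigma>\<^sup>2 / n" unfolding Vij by (simp add: divide_right_mono)
next
  fix k l i j assume kl: "k < K" "l < K" "Z $$ (k, l) \<noteq> 0" and ij: "i \<in> I k" "j \<in> I l"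
  then have "Z $$ (k, l) = 1" using Z(2) by auto
  moreover have "\<phi> / real n * Z $$ (k, l) \<le> V $$ (i, j)" using low kl ij by blast
  ultimately show "\<phi> / n \<le> V $$ (i, j)" by simp
qed (use n K I in auto)

theorem proposition2p7:
  fixes N :: "nat set"
    and A V :: "nat \<Rightarrow> real mat"
    and r r' :: "nat \<Rightarrow> real \<Rightarrow> real \<Rightarrow> real vec"
    and q q' :: "nat \<Rightarrow> real \<Rightarrow> real vec"
    and \<mu> :: "nat \<Rightarrow> complex measure"
  assumes "infinite N" and "0 \<notin> N"
    and "\<And>n. n \<in> N \<Longrightarrow> standard_deviation_profile n (A n)"
    and "\<And>n. n \<in> N \<Longrightarrow> V n = variance_profile n (A n)"
    and "uniformly_bounded N A"
    and "block_fully_indecomposable N V"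
    and "\<And>n. n \<in> N \<Longrightarrow> is_r n (V n) (r n) (r' n)"
    and "\<And>n. n \<in> N \<Longrightarrow> is_q n (V n) (q n) (q' n)"
    and "\<And>n. n \<in> N \<Longrightarrow> is_mu n (V n) (q n) (q' n) (\<mu> n)"
  shows "\<exists>(q0 :: nat \<Rightarrow> real vec) (q0' :: nat \<Rightarrow> real vec) (f0 :: nat \<Rightarrow> real).
    (\<forall>n\<in>N.
       q0 n \<in> carrier_vec n \<and> q0' n \<in> carrier_vec n \<and>
       (\<forall>i<n. ((\<lambda>t. r n 0 t $ i) \<longlongrightarrow> q0 n $ i) (at_right 0) \<and>
              ((\<lambda>t. r' n 0 t $ i) \<longlongrightarrow> q0' n $ i) (at_right 0) \<and>
              ((\<lambda>s. q n s $ i) \<longlongrightarrow> q0 n $ i) (at_right 0) \<and>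
              ((\<lambda>s. q' n s $ i) \<longlongrightarrow> q0' n $ i) (at_right 0)) \<and>
       (\<forall>i<n. q0 n $ i * (V n *\<^sub>v q0' n) $ i = 1 \<and>
              q0' n $ i * ((V n)\<^sup>T *\<^sub>v q0 n) $ i = 1) \<and>
       measure (\<mu> n) {0} = 0 \<and>
       (mu_density n (V n) (q n) (q' n) \<longlongrightarrow> f0 n) (at 0) \<and>
       f0 n = 1 / (pi * real n) *
         (\<Sum>i<n. 1 / (((V n)\<^sup>T *\<^sub>v q0 n) $ i * (V n *\<^sub>v q0' n) $ i)) \<and>
       f0 n = 1 / (pi * real n) * (\<Sum>i<n. q0 n $ i * q0' n $ i)) \<and>
    (\<exists>\<kappa>1 \<kappa>2. 0 < \<kappa>1 \<and> (\<forall>n\<in>N. \<kappa>1 \<le> f0 n \<and> f0 n \<le> \<kappa>2))"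
proof -
  obtain \<sigma> where \<sigma>: "0 < \<sigma>" "\<And>n i j. n \<in> N \<Longrightarrow> i < n \<Longrightarrow> j < n \<Longrightarrow> A n $$ (i, j) \<le> \<sigma>"
    using assms(5) unfolding uniformly_bounded_def by blast
  obtain \<phi> K where \<phi>: "0 < \<phi>" and K: "1 \<le> K" and blocks: "\<forall>n\<in>N. K dvd n \<and>
        (\<exists>Z I. fully_indecomposable K Z \<and> (\<forall>i<K. \<forall>j<K. Z $$ (i, j) \<in> {0, 1}) \<and>
           (\<Union>i<K. I i) = {..<n} \<and> disjoint_family_on I {..<K} \<and>
           (\<forall>i<K. card (I i) = n div K) \<and>
           (\<forall>i<K. \<forall>j<K. \<forall>x\<in>I i. \<forall>y\<in>I j. V n $$ (x, y) \<ge> \<phi> / real n * Z $$ (i, j)))"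
    using assms(6) unfolding block_fully_indecomposable_def by (elim exE conjE) (rule that)
  have K0: "0 < K" and \<sigma>2: "0 < \<sigma>\<^sup>2" using K \<sigma> by auto
  have n0: "0 < n" if "n \<in> N" for n using that assms(2) by (cases n) auto
  have bp: "\<exists>z I. block_profile K \<phi> (\<sigma>\<^sup>2) n z I (\<lambda>i j. V n $$ (i, j))" if n: "n \<in> N" for n
  proof -
    obtain Z I where ZI: "fully_indecomposable K Z" "\<forall>i<K. \<forall>j<K. Z $$ (i, j) \<in> {0, 1}"
      "(\<Union>i<K. I i) = {..<n}" "disjoint_family_on I {..<K}" "\<forall>i<K. card (I i) = n div K"
      "\<forall>i<K. \<forall>j<K. \<forall>x\<in>I i. \<forall>y\<in>I j. V n $$ (x, y) \<ge> \<phi> / real n * Z $$ (i, j)"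
      and K_dvd: "K dvd n"
      using bspec[OF blocks n] by (elim exE conjE) (rule that)
    show ?thesis
      by (intro exI, rule block_profile_of_variance_profile[OF assms(3)[OF n] _ assms(4)[OF n] n0[OF n] K_dvd ZI])
        (rule \<sigma>(2)[OF n])
  qed
  have carrier: "V n \<in> carrier_mat n n" if "n \<in> N" for n
    unfolding assms(4)[OF that] variance_profile_def by simp
  define limits where "limits n x y \<longleftrightarrow> approx_scaling n (\<lambda>i j. V n $$ (i, j)) 0 x y \<and>
      (\<forall>i<n. ((\<lambda>t. r n 0 t $ i) \<longlongrightarrow> x i) (at_right 0) \<and> ((\<lambda>t. r' n 0 t $ i) \<longlongrightarrow> y i) (at_right 0) \<and>
        ((\<lambda>s. q n s $ i) \<longlongrightarrow> x i) (at_right 0) \<and> ((\<lambda>s. q' n s $ i) \<longlongrightarrow> y i) (at_right 0)) \<and>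
      measure (\<mu> n) {0} = 0 \<and>
      (mu_density n (V n) (q n) (q' n) \<longlongrightarrow> 1 / (pi * n) * (\<Sum>i<n. x i * y i)) (at 0)" for n x y
  have "\<exists>x y. limits n x y" if n: "n \<in> N" for n
  proof -
    obtain z I where bp': "block_profile K \<phi> (\<sigma>\<^sup>2) n z I (\<lambda>i j. V n $$ (i, j))" using bp[OF n] by blast
    show ?thesis
    proof (rule fixed_dimension[OF bp' K0 \<phi> \<sigma>2 carrier[OF n] assms(7)[OF n] assms(8)[OF n] assms(9)[OF n]])
      fix x y
      assume "approx_scaling n (\<lambda>i j. V n $$ (i, j)) 0 x y" "measure (\<mu> n) {0} = 0"
        "\<And>i. i < n \<Longrightarrow> ((\<lambda>t. r n 0 t $ i) \<longlongrightarrow> x i) (at_right 0)"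
        "\<And>i. i < n \<Longrightarrow> ((\<lambda>t. r' n 0 t $ i) \<longlongrightarrow> y i) (at_right 0)"
        "\<And>i. i < n \<Longrightarrow> ((\<lambda>s. q n s $ i) \<longlongrightarrow> x i) (at_right 0)"
        "\<And>i. i < n \<Longrightarrow> ((\<lambda>s. q' n s $ i) \<longlongrightarrow> y i) (at_right 0)"
        "(mu_density n (V n) (q n) (q' n) \<longlongrightarrow> 1 / (pi * n) * (\<Sum>i<n. x i * y i)) (at 0)"
      then have "limits n x y" unfolding limits_def by (intro conjI allI impI)
      then show ?thesis by blast
    qed
  qed
  then obtain x y where "\<And>n. n \<in> N \<Longrightarrow> limits n (x n) (y n)" by metis
  note lim = this[unfolded limits_def]
  have xy: "approx_scaling n (\<lambda>i j. V n $$ (i, j)) 0 (x n) (y n)" if "n \<in> N" for n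
    using lim[OF that] by (rule conjunct1)
  note lims = lim[THEN conjunct2, THEN conjunct1, rule_format]
    and m0 = lim[THEN conjunct2, THEN conjunct2, THEN conjunct1]
    and dens = lim[THEN conjunct2, THEN conjunct2, THEN conjunct2]
  define q0 where "q0 n = vec n (x n)" for n
  define q0' where "q0' n = vec n (y n)" for n
  define f0 where "f0 n = 1 / (pi * real n) * (\<Sum>i<n. x n i * y n i)" for n
  have q0: "q0 n \<in> carrier_vec n" "q0' n \<in> carrier_vec n" for n unfolding q0_def q0'_def by auto
  have q0i: "q0 n $ i = x n i" "q0' n $ i = y n i" if "i < n" for n i using that unfolding q0_def q0'_def by auto
  have exact: "q0 n $ i * (V n *\<^sub>v q0' n) $ i = 1" "q0' n $ i * ((V n)\<^sup>T *\<^sub>v q0 n) $ i = 1"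
    if n: "n \<in> N" and i: "i < n" for n i
  proof -
    have "mv n v (\<lambda>j. q0 n $ j) i = mv n v (x n) i" "mv n v (\<lambda>j. q0' n $ j) i = mv n v (y n) i" for v
      unfolding mv_def using q0i by auto
    then show "q0 n $ i * (V n *\<^sub>v q0' n) $ i = 1" "q0' n $ i * ((V n)\<^sup>T *\<^sub>v q0 n) $ i = 1"
      using exact_scaling(3,4)[OF xy[OF n] i] mult_mat_vec_eq_mv[OF carrier[OF n] q0(2) i]
        mult_mat_vec_eq_mv[OF carrier[OF n] q0(1) i] q0i[OF i] by auto
  qed
  have f0_recip: "f0 n = 1 / (pi * real n) *
         (\<Sum>i<n. 1 / (((V n)\<^sup>T *\<^sub>v q0 n) $ i * (V n *\<^sub>v q0' n) $ i))" if n: "n \<in> N" for n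
  proof -
    have "x n i * y n i = 1 / (((V n)\<^sup>T *\<^sub>v q0 n) $ i * (V n *\<^sub>v q0' n) $ i)" if i: "i < n" for i
      using exact[OF n i] q0i[OF i] exact_scaling(1,2)[OF xy[OF n] i]
      by (metis inverse_eq_divide inverse_mult_distrib inverse_unique mult.commute)
    then show ?thesis unfolding f0_def by simp
  qed
  obtain c U where c: "0 < c" "c \<le> U" and bounds:
    "\<And>n z I v x y i. block_profile K \<phi> (\<sigma>\<^sup>2) n z I v \<Longrightarrow> approx_scaling n v (1 / (4 * real K)) x y \<Longrightarrow>
       i < n \<Longrightarrow> c \<le> x i \<and> x i \<le> U \<and> c \<le> y i \<and> y i \<le> U"
    using approx_scaling_bounds[OF K0 \<phi> \<sigma>2] by blast
  have f0_bounds: "c * c / pi \<le> f0 n \<and> f0 n \<le> U * U / pi" if n: "n \<in> N" for n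
  proof -
    obtain z I where bp': "block_profile K \<phi> (\<sigma>\<^sup>2) n z I (\<lambda>i j. V n $$ (i, j))" using bp[OF n] by blast
    \<comment> \<open>An exact scaling is an approximate one, so that the bounds that are uniform in \<open>n\<close> apply.\<close>
    have "0 \<le> 1 / (4 * real K)" by simp
    then have ap: "approx_scaling n (\<lambda>i j. V n $$ (i, j)) (1 / (4 * real K)) (x n) (y n)"
      using xy[OF n] unfolding approx_scaling_def by force
    have "c * c \<le> x n i * y n i \<and> x n i * y n i \<le> U * U" if "i < n" for i
      using bounds[OF bp' ap that] c by (auto intro!: mult_mono)
    then have "n * (c * c) \<le> (\<Sum>i<n. x n i * y n i)" "(\<Sum>i<n. x n i * y n i) \<le> n * (U * U)"
      using sum_bounded_below[of "{..<n}" "c * c" "\<lambda>i. x n i * y n i"]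
        sum_bounded_above[of "{..<n}" "\<lambda>i. x n i * y n i" "U * U"] by auto
    then show ?thesis unfolding f0_def using n0[OF n] by (simp add: field_simps)
  qed
  show ?thesis
  proof (rule exI[of _ q0], rule exI[of _ q0'], rule exI[of _ f0], intro conjI ballI)
    fix n assume n: "n \<in> N"
    show "\<forall>i<n. ((\<lambda>t. r n 0 t $ i) \<longlongrightarrow> q0 n $ i) (at_right 0) \<and>
              ((\<lambda>t. r' n 0 t $ i) \<longlongrightarrow> q0' n $ i) (at_right 0) \<and>
              ((\<lambda>s. q n s $ i) \<longlongrightarrow> q0 n $ i) (at_right 0) \<and>
              ((\<lambda>s. q' n s $ i) \<longlongrightarrow> q0' n $ i) (at_right 0)"
      using lims[OF n] q0i by simp
    show "\<forall>i<n. q0 n $ i * (V n *\<^sub>v q0' n) $ i = 1 \<and> q0' n $ i * ((V n)\<^sup>T *\<^sub>v q0 n) $ i = 1"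
      using exact[OF n] by blast
    show "(mu_density n (V n) (q n) (q' n) \<longlongrightarrow> f0 n) (at 0)" unfolding f0_def by (rule dens[OF n])
    show "f0 n = 1 / (pi * real n) * (\<Sum>i<n. q0 n $ i * q0' n $ i)" unfolding f0_def using q0i by simp
  next
    show "\<exists>\<kappa>1 \<kappa>2. 0 < \<kappa>1 \<and> (\<forall>n\<in>N. \<kappa>1 \<le> f0 n \<and> f0 n \<le> \<kappa>2)"
      using f0_bounds c by (intro exI[of _ "c * c / pi"] exI[of _ "U * U / pi"]) auto
  qed (use q0 m0 f0_recip in auto)
qed

end
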